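(* Let $x\in\mathbb{R}$ be such that $f(x)\neq 0$. Assume: (i) $K:\mathbb{R}\to\mathbb{R}$ is nonnegative, continuous and bounded, with $\int_{\mathbb{R}}K(z)\,dz=1$, $\int_{\mathbb{R}}zK(z)\,dz=0$ and $\int_{\mathbb{R}}z^2K(z)\,dz<\infty$; (ii) $(\gamma_n)\in\mathcal{GS}(-\alpha)$ with $\alpha\in(\tfrac34,1]$, and the limit of $(n\gamma_n)^{-1}$ as $n\to\infty$ exists; $(h_n)\in\mathcal{GS}(-a)$ with $a\in(\tfrac{1-\alpha}{4},\tfrac{\alpha}{3})$; (iii) $g(s,t)$ is two times continuously differentiable with respect to $s$; for $q\in\{0,1,2\}$, $s\mapsto\int_{\mathbb{R}}t^q g(s,t)\,dt$ is a bounded function continuous at $s=x$; for $q\in[2,3]$, $s\mapsto\int_{\mathbb{R}}|t|^q g(s,t)\,dt$ is bounded; for $q\in\{0,1\}$, $\int_{\mathbb{R}}|t|^q\left|\frac{\partial g}{\partial s}(x,t)\right|dt<\infty$ and $s\mapsto\int_{\mathbb{R}}t^q\frac{\partial^2 g}{\partial s^2}(s,t)\,dt$ is a bounded function continuous at $s=x$. 1. If there exists $c\geq 0$ such that $\gamma_n^{-1}h_n^5\to c$, and if $\lim_{n\to\infty}(n\gamma_n)>(1-a)/(2f(x))$, then $$\sqrt{\gamma_n^{-1}h_n}\,\bigl(r_n(x)-r(x)\bigr)\xrightarrow{\mathcal{D}}\mathcal{N}\left(\frac{\sqrt{c}\,f(x)\,m^{(2)}(x)}{f(x)-2a\xi},\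 \frac{\mathrm{Var}[Y\mid X=x]\,f(x)}{2f(x)-(1-a)\xi}\int_{\mathbb{R}}K^2(z)\,dz\right).$$ 2. If $\gamma_n^{-1}h_n^5\to\infty$, and if $\lim_{n\to\infty}(n\gamma_n)>2a/f(x)$, then $$\frac{1}{h_n^2}\bigl(r_n(x)-r(x)\bigr)\xrightarrow{\mathbb{P}}\frac{f(x)\,m^{(2)}(x)}{f(x)-2a\xi}.$$
   Context: $(X,Y),(X_1,Y_1),(X_2,Y_2),\ldots$ are independent, identically distributed pairs of real random variables with joint density $g(s,t)$; $f(s)=\int_{\mathbb{R}}g(s,t)\,dt$ is the density of $X$ and $r(x)=\mathbb{E}(Y\mid X=x)$ (that is, $r(x)=f(x)^{-1}\int_{\mathbb{R}}t\,g(x,t)\,dt$ when $f(x)\neq0$). $K$ is a kernel; the stepsize $(\gamma_n)$ and the bandwidth $(h_n)$ are nonrandom sequences of positive reals going to zero. For $n\ge1$ set $Z_n(x)=h_n^{-1}K\left(\frac{x-X_n}{h_n}\right)$ and $W_n(x)=h_n^{-1}Y_nK\left(\frac{x-X_n}{h_n}\right)$. The generalized Révész estimator is defined by setting $r_0(x)\in\mathbb{R}$ and, for $n\geq1$, $r_n(x)=r_{n-1}(x)+\gamma_n\left[W_n(x)-Z_n(x)r_{n-1}(x)\right]$. For $\gamma\in\mathbb{R}$, a nonrandom positive sequence $(v_n)_{n\ge1}$ belongs to $\mathcal{GS}(\gamma)$ if $\lim_{n\to\infty}n\left[1-\frac{v_{n-1}}{v_n}\right]=\gamma$. Set $\xi=\lim_{n\to\infty}(n\gamma_n)^{-1}$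 (so $\xi=0$ when $n\gamma_n\to\infty$; the case $\lim n\gamma_n=\infty$ is allowed) and, for $f(x)\neq0$, $m^{(2)}(x)=\frac{1}{2f(x)}\left[\int_{\mathbb{R}}t\frac{\partial^2g}{\partial s^2}(x,t)\,dt-r(x)\int_{\mathbb{R}}\frac{\partial^2g}{\partial s^2}(x,t)\,dt\right]\int_{\mathbb{R}}z^2K(z)\,dz$. $\xrightarrow{\mathcal{D}}$ is convergence in distribution, $\xrightarrow{\mathbb{P}}$ convergence in probability, $\mathcal{N}(\mu,\sigma^2)$ the Gaussian distribution with mean $\mu$ and variance $\sigma^2$.
   Formalization: Added to (iii): for q in {0,1}, t^q ∂²g/∂s²(s,t) is Lebesgue integrable on some strip [x-δ,x+δ]×R; with only the signed integrals ∫ t^q ∂²g/∂s²(s,t) dt bounded and continuous at x, f may have a kink at x, the bias is then of order h_n, and the claim fails. *)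

theory Defs
  imports "HOL-Probability.Probability"
begin

text \<open>Sequences are indexed by \<^typ>\<open>nat\<close>, but only the indices \<open>n \<ge> 1\<close> matter; the values at \<open>0\<close>
  of \<open>v\<close>, \<open>\<gamma>\<close>, \<open>h\<close>, \<open>X\<close>, \<open>Y\<close> are junk and occur in limits only.\<close>

definition GS :: "real \<Rightarrow> (nat \<Rightarrow> real) set" where
  "GS \<gamma> = {v. (\<forall>n\<ge>1. 0 < v n) \<and> (\<lambda>n. real n * (1 - v (n - 1) / v n)) \<longlonglongrightarrow> \<gamma>}"

definition twice_cont_diff :: "(real \<Rightarrow> real) \<Rightarrow> bool" where
  "twice_cont_diff u \<longleftrightarrow>
     (\<forall>s. u differentiable (at s)) \<and> (\<forall>s. deriv u differentiable (at s)) \<and>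
     continuous_on UNIV (deriv (deriv u))"

text \<open>Partial derivatives with respect to the first argument.\<close>

definition ds :: "(real \<Rightarrow> real \<Rightarrow> real) \<Rightarrow> real \<Rightarrow> real \<Rightarrow> real" where
  "ds g s t = deriv (\<lambda>u. g u t) s"

definition dss :: "(real \<Rightarrow> real \<Rightarrow> real) \<Rightarrow> real \<Rightarrow> real \<Rightarrow> real" where
  "dss g s t = deriv (deriv (\<lambda>u. g u t)) s"

text \<open>\<open>s \<mapsto> \<integral> F s t dt\<close> is a bounded function. Integrability is required separately because the
  library integral of a non-integrable function is \<open>0\<close>.\<close>

definition bounded_param_integral :: "(real \<Rightarrow> real \<Rightarrow> real) \<Rightarrow> bool" where
  "bounded_param_integral F \<longleftrightarrow>
     (\<forall>s. integrable lborel (F s)) \<and> bounded (range (\<lambda>s. \<integral>t. F s t \<partial>lborel))"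

text \<open>Density of \<open>X\<close>, regression function \<open>E(Y | X = s)\<close> and conditional variance \<open>Var[Y | X = s]\<close>,
  in the version given by the joint density \<open>g\<close>; the last two are meaningful where
  \<open>x_density g s \<noteq> 0\<close>.\<close>

definition x_density :: "(real \<Rightarrow> real \<Rightarrow> real) \<Rightarrow> real \<Rightarrow> real" where
  "x_density g s = (\<integral>t. g s t \<partial>lborel)"

definition regression :: "(real \<Rightarrow> real \<Rightarrow> real) \<Rightarrow> real \<Rightarrow> real" where
  "regression g s = (\<integral>t. t * g s t \<partial>lborel) / x_density g s"

definition cond_var :: "(real \<Rightarrow> real \<Rightarrow> real) \<Rightarrow> real \<Rightarrow> real" where
  "cond_var g s = (\<integral>t. (t - regression g s)\<^sup>2 * g s t \<partial>lborel) / x_density g s"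

definition m2 :: "(real \<Rightarrow> real) \<Rightarrow> (real \<Rightarrow> real \<Rightarrow> real) \<Rightarrow> real \<Rightarrow> real" where
  "m2 K g x = 1 / (2 * x_density g x) *
     ((\<integral>t. t * dss g x t \<partial>lborel) - regression g x * (\<integral>t. dss g x t \<partial>lborel)) *
     (\<integral>z. z\<^sup>2 * K z \<partial>lborel)"

definition Zterm ::
  "(real \<Rightarrow> real) \<Rightarrow> (nat \<Rightarrow> real) \<Rightarrow> (nat \<Rightarrow> 'a \<Rightarrow> real) \<Rightarrow> nat \<Rightarrow> real \<Rightarrow> 'a \<Rightarrow> real" where
  "Zterm K h X n x \<omega> = inverse (h n) * K ((x - X n \<omega>) / h n)"

definition Wterm ::
  "(real \<Rightarrow> real) \<Rightarrow> (nat \<Rightarrow> real) \<Rightarrow> (nat \<Rightarrow> 'a \<Rightarrow> real) \<Rightarrow> (nat \<Rightarrow> 'a \<Rightarrow> real) \<Rightarrow>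
     nat \<Rightarrow> real \<Rightarrow> 'a \<Rightarrow> real" where
  "Wterm K h X Y n x \<omega> = inverse (h n) * Y n \<omega> * K ((x - X n \<omega>) / h n)"

primrec revesz ::
  "(real \<Rightarrow> real) \<Rightarrow> (nat \<Rightarrow> real) \<Rightarrow> (nat \<Rightarrow> real) \<Rightarrow> (real \<Rightarrow> real) \<Rightarrow>
     (nat \<Rightarrow> 'a \<Rightarrow> real) \<Rightarrow> (nat \<Rightarrow> 'a \<Rightarrow> real) \<Rightarrow> nat \<Rightarrow> real \<Rightarrow> 'a \<Rightarrow> real" where
  "revesz K \<gamma> h r0 X Y 0 x \<omega> = r0 x"
| "revesz K \<gamma> h r0 X Y (Suc n) x \<omega> =
     revesz K \<gamma> h r0 X Y n x \<omega> +
     \<gamma> (Suc n) * (Wterm K h X Y (Suc n) x \<omega> - Zterm K h X (Suc n) x \<omega> * revesz K \<gamma> h r0 X Y n x \<omega>)"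

text \<open>Second argument: the variance (the library's \<^const>\<open>normal_density\<close> takes the standard
  deviation). Only positive variances are meaningful here.\<close>

definition gaussian :: "real \<Rightarrow> real \<Rightarrow> real measure" where
  "gaussian \<mu> v = density lborel (\<lambda>y. ennreal (normal_density \<mu> (sqrt v) y))"

definition conv_in_distr :: "'a measure \<Rightarrow> (nat \<Rightarrow> 'a \<Rightarrow> real) \<Rightarrow> real measure \<Rightarrow> bool" where
  "conv_in_distr M V N \<longleftrightarrow> weak_conv_m (\<lambda>n. distr M borel (V n)) N"

definition conv_in_prob :: "'a measure \<Rightarrow> (nat \<Rightarrow> 'a \<Rightarrow> real) \<Rightarrow> real \<Rightarrow> bool" where
  "conv_in_prob M V l \<longleftrightarrow>
     (\<forall>\<epsilon>>0. (\<lambda>n. measure M {\<omega> \<in> space M. \<bar>V n \<omega> - l\<bar> > \<epsilon>}) \<longlonglongrightarrow> 0)"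

text \<open>Integrability of \<open>t\<^sup>q \<cdot> \<partial>\<^sup>2g/\<partial>s\<^sup>2\<close>, \<open>q \<in> {0,1}\<close>, on a strip around \<open>s = x\<close>. This makes
  \<open>\<integral> t\<^sup>q \<cdot> \<partial>\<^sup>2g/\<partial>s\<^sup>2 (s,t) dt\<close> the second derivative of \<open>\<integral> t\<^sup>q g(s,t) dt\<close> at \<open>s = x\<close>
  (it allows the interchange of the integrals over \<open>s\<close> and \<open>t\<close> in Taylor's formula). Pointwise
  integrability in \<open>t\<close> and boundedness of the signed integrals do not imply it: a \<open>g\<close> for which
  \<open>x_density g\<close> has a kink at \<open>x\<close> can satisfy them.
  It follows as soon as the functions \<open>s \<mapsto> \<integral> \<bar>t\<bar>\<^sup>q \<bar>\<partial>\<^sup>2g/\<partial>s\<^sup>2 (s,t)\<bar> dt\<close> are bounded near \<open>x\<close>.\<close>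

definition dss_locally_integrable :: "(real \<Rightarrow> real \<Rightarrow> real) \<Rightarrow> real \<Rightarrow> bool" where
  "dss_locally_integrable g x \<longleftrightarrow>
     (\<exists>\<delta>>0. \<forall>q\<in>{0, 1::nat}.
        set_integrable (lborel \<Otimes>\<^sub>M lborel) ({x - \<delta>..x + \<delta>} \<times> UNIV) (\<lambda>(s, t). t ^ q * dss g s t))"

end

theory Submission
  imports Defs
begin

text \<open>Put \<open>D n = revesz \<dots> n x - regression g x\<close>, \<open>Z n = Zterm \<dots>\<close> and
\<open>\<eta> n = Wterm \<dots> - regression g x * Zterm \<dots>\<close>. The definition of the estimator then reads
\<open>D (Suc n) = (1 - \<gamma> Z) D n + \<gamma> \<eta>\<close>, with \<open>\<gamma>\<close>, \<open>Z\<close>, \<open>\<eta>\<close> taken at \<open>Suc n\<close>: a linear recursion whose random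
coefficients are independent of the past. Only the first two moments of \<open>Z n\<close> and the first three
moments of \<open>\<eta> n\<close> enter the asymptotics, and independence turns every question about moments of \<open>D n\<close>
into a deterministic affine recursion.

All those recursions are settled by one fact: if \<open>u (Suc n) = (1 - \<gamma> q) u n + \<gamma> e\<close> with \<open>q \<longlonglongrightarrow> p > 0\<close>,
\<open>e \<longlonglongrightarrow> E\<close>, steps \<open>\<gamma>\<close> tending to zero and \<open>\<Sum>\<gamma> = \<infinity>\<close>, then \<open>u \<longlonglongrightarrow> E / p\<close> (\<open>affine_recursion_tendsto\<close>, and
\<open>limsup_affine_recursion\<close> for inequalities). Multiplying \<open>u\<close> by a weight \<open>v\<close> with
\<open>v (Suc n) / v n = 1 + \<gamma> (\<zeta> + o(1))\<close> changes \<open>p\<close> into \<open>p - \<zeta>\<close>. This is where the denominators of the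
theorem come from: membership in \<open>GS s\<close> together with \<open>1 / (n \<gamma> n) \<longlonglongrightarrow> \<xi>\<close> gives \<open>\<zeta> = s \<xi>\<close>, and the lower
bounds on \<open>lim n \<gamma> n\<close> say precisely that \<open>\<zeta> < f\<close>, where \<open>f = x_density g x\<close>.

For the limit law, replace the random coefficient \<open>Z\<close> by its limiting mean \<open>f\<close>. The linearized recursion
splits into a deterministic bias \<open>b n\<close> and a centered weighted sum \<open>S n\<close> of independent terms, and
\<open>D n = S n + b n + R n\<close>. A second-moment recursion shows that \<open>v n * D n\<close> is bounded in \<open>L\<^sup>2\<close>
(\<open>second_moment_bounded\<close>); since \<open>R\<close> is driven by \<open>\<gamma> (f - Z) D\<close>, a further one gives \<open>v n * R n \<longlonglongrightarrow> 0\<close> in \<open>L\<^sup>2\<close>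
(\<open>remainder_tendsto\<close>). The characteristic function of \<open>S n\<close> stays within \<open>\<bar>t\<bar>^3 T n + t^4 Q n\<close> of a
centered Gaussian one (\<open>char_S_approx\<close>), where \<open>T\<close> and \<open>Q\<close> again obey affine recursions, and Levy's continuity
theorem concludes (\<open>asymptotic_normality\<close>). If the scaled variance vanishes, Chebyshev's inequality gives
convergence in probability instead (\<open>convergence_in_probability\<close>).

What remains are the moments. A change of variables turns \<open>E[k ((x - X n) / h n) * m (Y n)]\<close> into
\<open>h n\<close> times a kernel average of \<open>s \<mapsto> \<integral> m t g s t dt\<close> over a window of width \<open>h n\<close> around \<open>x\<close>
(\<open>kernel_moment\<close>). Dominated convergence handles second and third moments. The mean of \<open>\<eta> n\<close> is of order
\<open>(h n)\<^sup>2\<close> because \<open>s \<mapsto> \<integral> (t - r) g s t dt\<close> vanishes at \<open>x\<close> and its linear Taylor term is killed by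
\<open>\<integral> z K z dz = 0\<close>; the quadratic term yields \<open>f * m2 K g x\<close> (\<open>kernel_average_bias\<close>). The theorem is the case
\<open>v n = sqrt (h n / \<gamma> n)\<close> of this scheme for the first part, and \<open>v n = 1 / (h n)\<^sup>2\<close> for the second.\<close>

section \<open>Affine recursions with vanishing steps\<close>

text \<open>Where \<open>e n < c q n\<close>, the constant \<open>c\<close> is a supersolution, so the positive part of \<open>u - c\<close> contracts by
\<open>exp (- Q \<gamma> / 2)\<close> at each step, and divergence of \<open>\<Sum>\<gamma>\<close> drives it to zero. Any \<open>c > E / Q\<close> qualifies eventually.\<close>

lemma limsup_affine_recursion:
  fixes u \<gamma> q e :: "nat \<Rightarrow> real"
  assumes rec: "\<forall>\<^sub>F n in sequentially. u (Suc n) \<le> (1 - \<gamma> (Suc n) * q n) * u n + \<gamma> (Suc n) * e n"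
    and pos: "\<And>n. n \<ge> 1 \<Longrightarrow> 0 < \<gamma> n" and to0: "\<gamma> \<longlonglongrightarrow> 0" and div: "\<not> summable \<gamma>"
    and q: "q \<longlonglongrightarrow> Q" and Q: "0 < Q" and e: "e \<longlonglongrightarrow> E" and b: "E / Q < b"
  shows "\<forall>\<^sub>F n in sequentially. u n < b"
proof -
  obtain c where c: "E / Q < c" "c < b" using dense[OF b] by blast
  have "(\<lambda>n. e n - q n * c) \<longlonglongrightarrow> E - Q * c" by (intro tendsto_intros q e)
  moreover have "E - Q * c < 0" using c Q by (simp add: field_simps)
  ultimately have ev1: "\<forall>\<^sub>F n in sequentially. e n - q n * c < 0" by (rule order_tendstoD)
  have ev2: "\<forall>\<^sub>F n in sequentially. Q / 2 < q n" using q Q by (intro order_tendstoD) auto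
  have "(\<lambda>n. \<gamma> (Suc n) * q n) \<longlonglongrightarrow> 0 * Q" by (intro tendsto_mult LIMSEQ_Suc to0 q)
  then have ev3: "\<forall>\<^sub>F n in sequentially. \<gamma> (Suc n) * q n < 1" by (intro order_tendstoD) auto
  obtain N where N: "\<And>n. n \<ge> N \<Longrightarrow> u (Suc n) \<le> (1 - \<gamma> (Suc n) * q n) * u n + \<gamma> (Suc n) * e n \<and>
      e n - q n * c < 0 \<and> Q / 2 < q n \<and> \<gamma> (Suc n) * q n < 1"
    using eventually_conj[OF rec eventually_conj[OF ev1 eventually_conj[OF ev2 ev3]]]
    unfolding eventually_sequentially by blast
  define y where "y n = max 0 (u n - c)" for n
  have step: "y (Suc n) \<le> exp (- (Q / 2 * \<gamma> (Suc n))) * y n" if n: "n \<ge> N" for n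
  proof -
    have g: "0 < \<gamma> (Suc n)" using pos by simp
    have "u (Suc n) - c \<le> (1 - \<gamma> (Suc n) * q n) * (u n - c) + \<gamma> (Suc n) * (e n - q n * c)"
      using N[OF n] by (simp add: algebra_simps)
    also have "\<dots> \<le> (1 - \<gamma> (Suc n) * q n) * (u n - c)"
      using N[OF n] g by (simp add: mult_pos_neg less_imp_le)
    also have "\<dots> \<le> (1 - \<gamma> (Suc n) * q n) * y n"
      using N[OF n] by (intro mult_left_mono) (auto simp: y_def)
    also have "\<dots> \<le> exp (- (\<gamma> (Suc n) * q n)) * y n"
      using exp_ge_add_one_self[of "- (\<gamma> (Suc n) * q n)"] by (intro mult_right_mono) (auto simp: y_def)
    also have "\<dots> \<le> exp (- (Q / 2 * \<gamma> (Suc n))) * y n"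
      using N[OF n] g by (intro mult_right_mono) (auto simp: y_def)
    finally show ?thesis by (auto simp: y_def)
  qed
  have y_bound: "y (N + k) \<le> exp (- (Q / 2 * (\<Sum>i<k. \<gamma> (Suc (N + i))))) * y N" for k
  proof (induction k)
    case (Suc k)
    have "y (N + Suc k) \<le> exp (- (Q / 2 * \<gamma> (Suc (N + k)))) * y (N + k)" using step[of "N + k"] by simp
    also have "\<dots> \<le> exp (- (Q / 2 * \<gamma> (Suc (N + k)))) * (exp (- (Q / 2 * (\<Sum>i<k. \<gamma> (Suc (N + i))))) * y N)"
      by (intro mult_left_mono Suc.IH) auto
    also have "\<dots> = exp (- (Q / 2 * (\<Sum>i<Suc k. \<gamma> (Suc (N + i))))) * y N"
      by (simp add: exp_add[symmetric] algebra_simps)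
    finally show ?case .
  qed simp
  have "\<not> summable (\<lambda>i. \<gamma> (i + Suc N))" using div by (subst summable_iff_shift)
  then have ns: "\<not> summable (\<lambda>i. \<gamma> (Suc (N + i)))" by (simp add: add.commute)
  have unb: "\<exists>k. B < (\<Sum>i<k. \<gamma> (Suc (N + i)))" for B
  proof (rule ccontr)
    assume "\<nexists>k. B < (\<Sum>i<k. \<gamma> (Suc (N + i)))"
    then have "summable (\<lambda>i. \<gamma> (Suc (N + i)))"
      using pos by (intro summableI_nonneg_bounded[where x = B]) (auto simp: less_imp_le not_less)
    with ns show False by blast
  qed
  have mono: "(\<Sum>i<k. \<gamma> (Suc (N + i))) \<le> (\<Sum>i<l. \<gamma> (Suc (N + i)))" if "k \<le> l" for k l
    by (rule sum_mono2) (use that pos in \<open>auto simp: less_imp_le\<close>)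
  have "filterlim (\<lambda>k. \<Sum>i<k. \<gamma> (Suc (N + i))) at_top sequentially"
    unfolding filterlim_at_top eventually_sequentially
  proof
    fix B
    obtain k where "B < (\<Sum>i<k. \<gamma> (Suc (N + i)))" using unb by blast
    then show "\<exists>k. \<forall>l\<ge>k. B \<le> (\<Sum>i<l. \<gamma> (Suc (N + i)))"
      by (intro exI[of _ k] allI impI) (rule order_trans[OF less_imp_le mono])
  qed
  then have "(\<lambda>k. exp (- (Q / 2 * (\<Sum>i<k. \<gamma> (Suc (N + i))))) * y N) \<longlonglongrightarrow> 0"
    using Q by (intro tendsto_mult_left_zero filterlim_compose[OF exp_at_bot]
      filterlim_compose[OF filterlim_uminus_at_bot_at_top]
      filterlim_tendsto_pos_mult_at_top[OF tendsto_const, of "Q / 2"]) simp_all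
  then have "\<forall>\<^sub>F k in sequentially. exp (- (Q / 2 * (\<Sum>i<k. \<gamma> (Suc (N + i))))) * y N < b - c"
    using c by (intro order_tendstoD) auto
  then have "\<forall>\<^sub>F k in sequentially. u (k + N) < b"
  proof eventually_elim
    case (elim k)
    then have "y (N + k) < b - c" using y_bound[of k] by linarith
    then show ?case by (simp add: y_def add.commute)
  qed
  then show ?thesis using eventually_sequentially_seg[of "\<lambda>n. u n < b" N] by simp
qed

lemma affine_recursion_tendsto:
  fixes u \<gamma> q e :: "nat \<Rightarrow> real"
  assumes rec: "\<forall>\<^sub>F n in sequentially. u (Suc n) = (1 - \<gamma> (Suc n) * q n) * u n + \<gamma> (Suc n) * e n"
    and pos: "\<And>n. n \<ge> 1 \<Longrightarrow> 0 < \<gamma> n" and to0: "\<gamma> \<longlonglongrightarrow> 0" and div: "\<not> summable \<gamma>"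
    and q: "q \<longlonglongrightarrow> Q" and Q: "0 < Q" and e: "e \<longlonglongrightarrow> E"
  shows "u \<longlonglongrightarrow> E / Q"
proof (rule order_tendstoI)
  fix b assume "E / Q < b"
  then show "\<forall>\<^sub>F n in sequentially. u n < b"
    by (intro limsup_affine_recursion[OF _ pos to0 div q Q e] eventually_mono[OF rec]) auto
next
  fix b assume b: "b < E / Q"
  have "\<forall>\<^sub>F n in sequentially. - u n < - b"
  proof (rule limsup_affine_recursion[OF _ pos to0 div q Q tendsto_minus[OF e]])
    show "\<forall>\<^sub>F n in sequentially. - u (Suc n) \<le> (1 - \<gamma> (Suc n) * q n) * - u n + \<gamma> (Suc n) * - e n"
      using rec by eventually_elim auto
  qed (use b in auto)
  then show "\<forall>\<^sub>F n in sequentially. b < u n" by simp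
qed

section \<open>Weights with a relative growth rate\<close>

text \<open>\<open>v (Suc n) / v n = 1 + \<gamma> (Suc n) (\<zeta> + o(1))\<close>: a logarithmic derivative of \<open>v\<close> in the time scale of the steps
\<open>\<gamma>\<close>. With \<open>\<gamma> n = 1 / n\<close> it describes the class \<open>GS \<zeta>\<close>, and an arbitrary \<open>\<gamma>\<close> measures a weight in the time scale
of the recursion that it is going to multiply.\<close>

definition growth_rate :: "(nat \<Rightarrow> real) \<Rightarrow> (nat \<Rightarrow> real) \<Rightarrow> real \<Rightarrow> bool" where
  "growth_rate \<gamma> v \<zeta> \<longleftrightarrow> (\<forall>n\<ge>1. 0 < v n) \<and>
     (\<lambda>n. (v (Suc n) / v n - 1) / \<gamma> (Suc n)) \<longlonglongrightarrow> \<zeta>"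

lemma growth_rate_ratio:
  assumes "growth_rate \<gamma> v \<zeta>" "\<And>n. n \<ge> 1 \<Longrightarrow> 0 < \<gamma> n" "\<gamma> \<longlonglongrightarrow> 0"
  shows "(\<lambda>n. v (Suc n) / v n) \<longlonglongrightarrow> 1"
proof -
  have "(\<lambda>n. (v (Suc n) / v n - 1) / \<gamma> (Suc n) * \<gamma> (Suc n) + 1) \<longlonglongrightarrow> \<zeta> * 0 + 1"
    using assms unfolding growth_rate_def by (intro tendsto_intros LIMSEQ_Suc) auto
  moreover have "\<gamma> (Suc n) \<noteq> 0" for n using assms(2)[of "Suc n"] by simp
  ultimately show ?thesis by simp
qed

lemma growth_rate_mult:
  assumes v: "growth_rate \<gamma> v \<zeta>" and w: "growth_rate \<gamma> w \<eta>"
    and \<gamma>: "\<And>n. n \<ge> 1 \<Longrightarrow> 0 < \<gamma> n" "\<gamma> \<longlonglongrightarrow> 0"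
  shows "growth_rate \<gamma> (\<lambda>n. v n * w n) (\<zeta> + \<eta>)"
proof -
  have "(\<lambda>n. (v (Suc n) / v n - 1) / \<gamma> (Suc n) * (w (Suc n) / w n) + (w (Suc n) / w n - 1) / \<gamma> (Suc n))
      \<longlonglongrightarrow> \<zeta> * 1 + \<eta>"
    using v w growth_rate_ratio[OF w \<gamma>] unfolding growth_rate_def by (intro tendsto_intros) auto
  moreover have "(v (Suc n) / v n - 1) / \<gamma> (Suc n) * (w (Suc n) / w n) + (w (Suc n) / w n - 1) / \<gamma> (Suc n)
      = (v (Suc n) * w (Suc n) / (v n * w n) - 1) / \<gamma> (Suc n)" for n
    by (simp add: diff_divide_distrib add_divide_distrib left_diff_distrib)
  ultimately show ?thesis using v w unfolding growth_rate_def by simp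
qed

lemma growth_rate_inverse:
  assumes v: "growth_rate \<gamma> v \<zeta>" and \<gamma>: "\<And>n. n \<ge> 1 \<Longrightarrow> 0 < \<gamma> n" "\<gamma> \<longlonglongrightarrow> 0"
  shows "growth_rate \<gamma> (\<lambda>n. inverse (v n)) (- \<zeta>)"
proof -
  have "(\<lambda>n. - ((v (Suc n) / v n - 1) / \<gamma> (Suc n) / (v (Suc n) / v n))) \<longlonglongrightarrow> - (\<zeta> / 1)"
    using v growth_rate_ratio[OF v \<gamma>] unfolding growth_rate_def by (intro tendsto_intros) auto
  moreover have "\<forall>\<^sub>F n in sequentially. - ((v (Suc n) / v n - 1) / \<gamma> (Suc n) / (v (Suc n) / v n))
      = (inverse (v (Suc n)) / inverse (v n) - 1) / \<gamma> (Suc n)"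
    using eventually_ge_at_top[of 1]
  proof eventually_elim
    case (elim n)
    then have "0 < v n" "0 < v (Suc n)" "0 < \<gamma> (Suc n)" using v \<gamma> unfolding growth_rate_def by auto
    then show ?case by (simp add: field_simps)
  qed
  ultimately have "(\<lambda>n. (inverse (v (Suc n)) / inverse (v n) - 1) / \<gamma> (Suc n)) \<longlonglongrightarrow> - (\<zeta> / 1)"
    by (rule Lim_transform_eventually)
  then show ?thesis using v unfolding growth_rate_def by simp
qed

lemma growth_rate_sqrt:
  assumes v: "growth_rate \<gamma> v \<zeta>" and \<gamma>: "\<And>n. n \<ge> 1 \<Longrightarrow> 0 < \<gamma> n" "\<gamma> \<longlonglongrightarrow> 0"
  shows "growth_rate \<gamma> (\<lambda>n. sqrt (v n)) (\<zeta> / 2)"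
proof -
  have "(\<lambda>n. (v (Suc n) / v n - 1) / \<gamma> (Suc n) / (sqrt (v (Suc n) / v n) + 1)) \<longlonglongrightarrow> \<zeta> / (sqrt 1 + 1)"
    using v growth_rate_ratio[OF v \<gamma>] unfolding growth_rate_def by (intro tendsto_intros) auto
  moreover have "\<forall>\<^sub>F n in sequentially. (v (Suc n) / v n - 1) / \<gamma> (Suc n) / (sqrt (v (Suc n) / v n) + 1)
      = (sqrt (v (Suc n)) / sqrt (v n) - 1) / \<gamma> (Suc n)"
    using eventually_ge_at_top[of 1]
  proof eventually_elim
    case (elim n)
    then have p: "0 < v n" "0 < v (Suc n)" "0 < \<gamma> (Suc n)" using v \<gamma> unfolding growth_rate_def by auto
    define r where "r = sqrt (v (Suc n) / v n)"
    have r: "r > 0" "v (Suc n) / v n = r\<^sup>2" using p by (auto simp: r_def)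
    have "r\<^sup>2 - 1 = (r - 1) * (r + 1)" by (simp add: power2_eq_square algebra_simps)
    then have "(r\<^sup>2 - 1) / \<gamma> (Suc n) / (r + 1) = (r - 1) / \<gamma> (Suc n)" using r by simp
    moreover have "sqrt (v (Suc n)) / sqrt (v n) = r" by (simp add: r_def real_sqrt_divide)
    moreover have "sqrt (v (Suc n) / v n) = r" by (simp add: r_def)
    ultimately show ?case by (simp only: r(2))
  qed
  ultimately have "(\<lambda>n. (sqrt (v (Suc n)) / sqrt (v n) - 1) / \<gamma> (Suc n)) \<longlonglongrightarrow> \<zeta> / (sqrt 1 + 1)"
    by (rule Lim_transform_eventually)
  then show ?thesis using v unfolding growth_rate_def by simp
qed

lemma growth_rate_power:
  assumes v: "growth_rate \<gamma> v \<zeta>" and \<gamma>: "\<And>n. n \<ge> 1 \<Longrightarrow> 0 < \<gamma> n" "\<gamma> \<longlonglongrightarrow> 0"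
  shows "growth_rate \<gamma> (\<lambda>n. v n ^ k) (real k * \<zeta>)"
proof (induction k)
  case 0
  then show ?case by (simp add: growth_rate_def)
next
  case (Suc k)
  have "growth_rate \<gamma> (\<lambda>n. v n * v n ^ k) (\<zeta> + real k * \<zeta>)" by (rule growth_rate_mult[OF v Suc \<gamma>])
  then show ?case by (simp add: algebra_simps)
qed

text \<open>Such a weight solves the affine recursion with \<open>q \<longlonglongrightarrow> - \<zeta> > 0\<close> and no forcing term.\<close>

lemma growth_rate_decay:
  assumes v: "growth_rate \<gamma> v \<zeta>" and \<gamma>: "\<And>n. n \<ge> 1 \<Longrightarrow> 0 < \<gamma> n" "\<gamma> \<longlonglongrightarrow> 0" "\<not> summable \<gamma>"
    and neg: "\<zeta> < 0"
  shows "v \<longlonglongrightarrow> 0"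
proof -
  have "v \<longlonglongrightarrow> 0 / (- \<zeta>)"
  proof (rule affine_recursion_tendsto[OF _ \<gamma>])
    show "(\<lambda>n. - ((v (Suc n) / v n - 1) / \<gamma> (Suc n))) \<longlonglongrightarrow> - \<zeta>"
      using v unfolding growth_rate_def by (intro tendsto_minus) auto
    show "\<forall>\<^sub>F n in sequentially. v (Suc n) =
        (1 - \<gamma> (Suc n) * - ((v (Suc n) / v n - 1) / \<gamma> (Suc n))) * v n + \<gamma> (Suc n) * 0"
      using eventually_ge_at_top[of 1]
    proof eventually_elim
      case (elim n)
      then have "0 < v n" "0 < \<gamma> (Suc n)" using v \<gamma>(1) unfolding growth_rate_def by auto
      then show ?case by (simp add: field_simps)
    qed
  qed (use neg in auto)
  then show ?thesis by simp
qed

text \<open>A nonzero rate sends \<open>v\<close> or its inverse to zero. This identifies exponents: it forces \<open>\<alpha> = 1\<close> as soon as \<open>\<xi> > 0\<close>,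
and \<open>\<xi> = 5 a \<xi>\<close> as soon as \<open>h^5 / \<gamma>\<close> has a positive limit.\<close>

lemma growth_rate_eq_0:
  assumes v: "growth_rate \<gamma> v \<zeta>" and \<gamma>: "\<And>n. n \<ge> 1 \<Longrightarrow> 0 < \<gamma> n" "\<gamma> \<longlonglongrightarrow> 0" "\<not> summable \<gamma>"
    and lim: "v \<longlonglongrightarrow> c" "c \<noteq> 0"
  shows "\<zeta> = 0"
proof (rule ccontr)
  assume "\<zeta> \<noteq> 0"
  then consider "\<zeta> < 0" | "- \<zeta> < 0" by linarith
  then show False
  proof cases
    case 1
    then show False using growth_rate_decay[OF v \<gamma>] lim LIMSEQ_unique by blast
  next
    case 2
    have "(\<lambda>n. inverse (v n)) \<longlonglongrightarrow> 0"
      by (rule growth_rate_decay[OF growth_rate_inverse[OF v \<gamma>(1,2)] \<gamma> 2])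
    then show False using tendsto_inverse[OF lim] lim LIMSEQ_unique by fastforce
  qed
qed

lemma harmonic_step:
  "n \<ge> 1 \<Longrightarrow> 0 < 1 / real n" "(\<lambda>n. 1 / real n) \<longlonglongrightarrow> 0" "\<not> summable (\<lambda>n. 1 / real n)"
  using not_summable_harmonic[where 'a = real] by (auto simp: lim_1_over_n inverse_eq_divide)

text \<open>\<^const>\<open>GS\<close> compares \<open>v n\<close> with \<open>v (Suc n)\<close> in the denominator and \<^const>\<open>growth_rate\<close> with \<open>v n\<close>; the two agree in
the limit because the ratio tends to 1.\<close>

lemma GS_growth_rate:
  assumes "v \<in> GS s"
  shows "growth_rate (\<lambda>n. 1 / real n) v s"
proof -
  have pos: "0 < v n" if "n \<ge> 1" for n using assms that by (auto simp: GS_def)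
  have lim: "(\<lambda>n. real (Suc n) * (1 - v n / v (Suc n))) \<longlonglongrightarrow> s"
    using assms LIMSEQ_Suc[of "\<lambda>n. real n * (1 - v (n - 1) / v n)" s] by (simp add: GS_def)
  have "(\<lambda>n. 1 - 1 / real (Suc n) * (real (Suc n) * (1 - v n / v (Suc n)))) \<longlonglongrightarrow> 1 - 0 * s"
    by (intro tendsto_intros lim LIMSEQ_Suc[OF harmonic_step(2)])
  then have ratio: "(\<lambda>n. v n / v (Suc n)) \<longlonglongrightarrow> 1" by simp
  have "(\<lambda>n. real (Suc n) * (1 - v n / v (Suc n)) / (v n / v (Suc n))) \<longlonglongrightarrow> s / 1"
    by (intro tendsto_divide lim ratio) auto
  moreover have "\<forall>\<^sub>F n in sequentially. real (Suc n) * (1 - v n / v (Suc n)) / (v n / v (Suc n))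
      = (v (Suc n) / v n - 1) / (1 / real (Suc n))"
    using eventually_ge_at_top[of 1]
  proof eventually_elim
    case (elim n)
    then have "0 < v n" "0 < v (Suc n)" using pos by auto
    then show ?case by (simp add: field_simps)
  qed
  ultimately have "(\<lambda>n. (v (Suc n) / v n - 1) / (1 / real (Suc n))) \<longlonglongrightarrow> s / 1"
    by (rule Lim_transform_eventually)
  then show ?thesis using pos by (simp add: growth_rate_def)
qed

lemma growth_rate_change_step:
  assumes v: "growth_rate \<delta> v s" and \<delta>: "\<And>n. n \<ge> 1 \<Longrightarrow> 0 < \<delta> n"
    and lim: "(\<lambda>n. \<delta> n / \<gamma> n) \<longlonglongrightarrow> \<xi>"
  shows "growth_rate \<gamma> v (s * \<xi>)"
proof -
  have "(\<lambda>n. (v (Suc n) / v n - 1) / \<delta> (Suc n) * (\<delta> (Suc n) / \<gamma> (Suc n))) \<longlonglongrightarrow> s * \<xi>"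
    using v unfolding growth_rate_def by (intro tendsto_mult LIMSEQ_Suc[OF lim]) auto
  moreover have "\<delta> (Suc n) \<noteq> 0" for n using \<delta>[of "Suc n"] by simp
  ultimately show ?thesis using v unfolding growth_rate_def by simp
qed

text \<open>Multiplying the solution of a recursion by \<open>v\<close> multiplies its contraction factor by \<open>v (Suc n) / v n\<close>; to first order
in \<open>\<gamma>\<close> this lowers the contraction rate by \<open>\<zeta>\<close>.\<close>

lemma weighted_recursion_factor:
  assumes v: "growth_rate \<gamma> v \<zeta>" and \<gamma>: "\<And>n. n \<ge> 1 \<Longrightarrow> 0 < \<gamma> n" "\<gamma> \<longlonglongrightarrow> 0" and q: "q \<longlonglongrightarrow> Q"
  obtains q' where "q' \<longlonglongrightarrow> Q - \<zeta>"
    and "\<And>n. v (Suc n) / v n * (1 - \<gamma> (Suc n) * q n) = 1 - \<gamma> (Suc n) * q' n"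
proof
  define q' where "q' n = q n * (v (Suc n) / v n) - (v (Suc n) / v n - 1) / \<gamma> (Suc n)" for n
  have "q' \<longlonglongrightarrow> Q * 1 - \<zeta>"
    unfolding q'_def using v growth_rate_ratio[OF v \<gamma>]
    by (intro tendsto_intros q) (auto simp: growth_rate_def)
  then show "q' \<longlonglongrightarrow> Q - \<zeta>" by simp
  show "v (Suc n) / v n * (1 - \<gamma> (Suc n) * q n) = 1 - \<gamma> (Suc n) * q' n" for n
  proof -
    define \<rho> where "\<rho> = v (Suc n) / v n"
    have "\<gamma> (Suc n) * q' n = \<gamma> (Suc n) * q n * \<rho> - (\<rho> - 1)"
    proof -
      have "\<gamma> (Suc n) * ((\<rho> - 1) / \<gamma> (Suc n)) = \<rho> - 1" using \<gamma>(1)[of "Suc n"] by simp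
      then show ?thesis unfolding q'_def \<rho>_def[symmetric] right_diff_distrib[of "\<gamma> (Suc n)"] by simp
    qed
    then show ?thesis by (simp add: \<rho>_def[symmetric] algebra_simps)
  qed
qed

lemma weighted_recursion_tendsto:
  assumes rec: "\<forall>\<^sub>F n in sequentially. u (Suc n) = (1 - \<gamma> (Suc n) * q n) * u n + \<gamma> (Suc n) * e n"
    and v: "growth_rate \<gamma> v \<zeta>"
    and \<gamma>: "\<And>n. n \<ge> 1 \<Longrightarrow> 0 < \<gamma> n" "\<gamma> \<longlonglongrightarrow> 0" "\<not> summable \<gamma>"
    and q: "q \<longlonglongrightarrow> Q" and Q: "\<zeta> < Q" and e: "(\<lambda>n. v (Suc n) * e n) \<longlonglongrightarrow> E"
  shows "(\<lambda>n. v n * u n) \<longlonglongrightarrow> E / (Q - \<zeta>)"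
proof -
  obtain q' where q': "q' \<longlonglongrightarrow> Q - \<zeta>"
    "\<And>n. v (Suc n) / v n * (1 - \<gamma> (Suc n) * q n) = 1 - \<gamma> (Suc n) * q' n"
    using weighted_recursion_factor[OF v \<gamma>(1,2) q] by blast
  show ?thesis
  proof (rule affine_recursion_tendsto[OF _ \<gamma> q'(1) _ e])
    show "\<forall>\<^sub>F n in sequentially. v (Suc n) * u (Suc n) =
        (1 - \<gamma> (Suc n) * q' n) * (v n * u n) + \<gamma> (Suc n) * (v (Suc n) * e n)"
      using rec eventually_ge_at_top[of 1]
    proof eventually_elim
      case (elim n)
      have "v n \<noteq> 0" using v elim by (auto simp: growth_rate_def less_imp_neq[symmetric])
      then have "(1 - \<gamma> (Suc n) * q' n) * (v n * u n) = v (Suc n) * ((1 - \<gamma> (Suc n) * q n) * u n)"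
        by (simp add: q'(2)[symmetric])
      then show ?case by (simp add: elim algebra_simps)
    qed
  qed (use Q in auto)
qed

lemma weighted_recursion_limsup:
  assumes rec: "\<forall>\<^sub>F n in sequentially. u (Suc n) \<le> (1 - \<gamma> (Suc n) * q n) * u n + \<gamma> (Suc n) * e n"
    and v: "growth_rate \<gamma> v \<zeta>"
    and \<gamma>: "\<And>n. n \<ge> 1 \<Longrightarrow> 0 < \<gamma> n" "\<gamma> \<longlonglongrightarrow> 0" "\<not> summable \<gamma>"
    and q: "q \<longlonglongrightarrow> Q" and Q: "\<zeta> < Q" and e: "(\<lambda>n. v (Suc n) * e n) \<longlonglongrightarrow> E" and b: "E / (Q - \<zeta>) < b"
  shows "\<forall>\<^sub>F n in sequentially. v n * u n < b"
proof -
  obtain q' where q': "q' \<longlonglongrightarrow> Q - \<zeta>"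
    "\<And>n. v (Suc n) / v n * (1 - \<gamma> (Suc n) * q n) = 1 - \<gamma> (Suc n) * q' n"
    using weighted_recursion_factor[OF v \<gamma>(1,2) q] by blast
  show ?thesis
  proof (rule limsup_affine_recursion[OF _ \<gamma> q'(1) _ e b])
    show "\<forall>\<^sub>F n in sequentially. v (Suc n) * u (Suc n) \<le>
        (1 - \<gamma> (Suc n) * q' n) * (v n * u n) + \<gamma> (Suc n) * (v (Suc n) * e n)"
      using rec eventually_ge_at_top[of 1]
    proof eventually_elim
      case (elim n)
      have p: "v n \<noteq> 0" "v (Suc n) > 0" using v elim by (auto simp: growth_rate_def less_imp_neq[symmetric])
      have "v (Suc n) * u (Suc n) \<le> v (Suc n) * ((1 - \<gamma> (Suc n) * q n) * u n + \<gamma> (Suc n) * e n)"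
        using elim p by (intro mult_left_mono) auto
      also have "\<dots> = (1 - \<gamma> (Suc n) * q' n) * (v n * u n) + \<gamma> (Suc n) * (v (Suc n) * e n)"
      proof -
        have "(1 - \<gamma> (Suc n) * q' n) * (v n * u n) = v (Suc n) * ((1 - \<gamma> (Suc n) * q n) * u n)"
          using p by (simp add: q'(2)[symmetric])
        then show ?thesis by (simp add: algebra_simps)
      qed
      finally show ?case .
    qed
  qed (use Q in auto)
qed

section \<open>Independence of the past and characteristic functions\<close>

text \<open>The state \<open>U n\<close> is a measurable function \<open>F n\<close> of the family \<open>\<xi> 1, \<dots>, \<xi> n\<close>, from which \<open>\<xi> (Suc n)\<close> is independent. The
measurability of \<open>F n\<close> is proved over every index set \<open>I \<supseteq> {1..n}\<close>, since the induction step needs it over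
\<open>{1..Suc n}\<close>.\<close>

lemma (in prob_space) indep_var_recursion:
  fixes start :: "'b :: topological_space" and \<xi> :: "nat \<Rightarrow> 'a \<Rightarrow> 'b"
  assumes ind: "indep_vars (\<lambda>_. borel) \<xi> {1..}"
    and U0: "\<And>\<omega>. U 0 \<omega> = start"
    and step: "\<And>n \<omega>. U (Suc n) \<omega> = \<Psi> n (U n \<omega>) (\<xi> (Suc n) \<omega>)"
    and meas: "\<And>n. (\<lambda>p. \<Psi> n (fst p) (snd p)) \<in> borel_measurable (borel \<Otimes>\<^sub>M borel)"
  shows "indep_var borel (U n) borel (\<xi> (Suc n))"
proof -
  define F where "F n p = rec_nat start (\<lambda>k u. \<Psi> k u (p (Suc k))) n" for n and p :: "nat \<Rightarrow> 'b"
  have F_meas: "F n \<in> borel_measurable (PiM I (\<lambda>_. borel))" if "{1..n} \<subseteq> I" for n I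
    using that
  proof (induction n)
    case 0
    then show ?case by (simp add: F_def)
  next
    case (Suc n)
    have "{1..n} \<subseteq> I" "Suc n \<in> I" using Suc.prems by auto
    then have [measurable]: "F n \<in> borel_measurable (PiM I (\<lambda>_. borel))"
      "(\<lambda>p. p (Suc n)) \<in> measurable (PiM I (\<lambda>_. borel)) borel"
      using Suc.IH by (auto intro!: measurable_component_singleton)
    have "(\<lambda>p. (F n p, p (Suc n))) \<in> measurable (PiM I (\<lambda>_. borel)) (borel \<Otimes>\<^sub>M borel)" by measurable
    from measurable_compose[OF this meas[of n]] show ?case by (simp add: F_def)
  qed
  have F_U: "U n \<omega> = F n (restrict (\<lambda>i. \<xi> i \<omega>) I)" if "{1..n} \<subseteq> I" for n I \<omega>
    using that
  proof (induction n)
    case 0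
    then show ?case by (simp add: F_def U0)
  next
    case (Suc n)
    have "{1..n} \<subseteq> I" "Suc n \<in> I" using Suc.prems by auto
    then show ?case using Suc.IH by (simp add: F_def step)
  qed
  have "indep_var borel (F n \<circ> (\<lambda>\<omega>. restrict (\<lambda>i. \<xi> i \<omega>) {1..n}))
      borel ((\<lambda>p. p (Suc n)) \<circ> (\<lambda>\<omega>. restrict (\<lambda>i. \<xi> i \<omega>) {Suc n}))"
    by (rule indep_var_compose[OF indep_var_restrict[OF ind]])
       (auto intro!: F_meas measurable_component_singleton)
  moreover have "F n \<circ> (\<lambda>\<omega>. restrict (\<lambda>i. \<xi> i \<omega>) {1..n}) = U n" using F_U[of n "{1..n}"] by auto
  moreover have "(\<lambda>p. p (Suc n)) \<circ> (\<lambda>\<omega>. restrict (\<lambda>i. \<xi> i \<omega>) {Suc n}) = \<xi> (Suc n)" by auto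
  ultimately show ?thesis by simp
qed

lemma (in prob_space) integrable_prod_squares:
  fixes X Y :: "'a \<Rightarrow> real"
  assumes [measurable]: "X \<in> borel_measurable M" "Y \<in> borel_measurable M"
    and X: "integrable M (\<lambda>\<omega>. (X \<omega>)\<^sup>2)" and Y: "integrable M (\<lambda>\<omega>. (Y \<omega>)\<^sup>2)"
  shows "integrable M (\<lambda>\<omega>. X \<omega> * Y \<omega>)" "integrable M (\<lambda>\<omega>. (X \<omega> + Y \<omega>)\<^sup>2)"
    "integrable M (\<lambda>\<omega>. (X \<omega> - Y \<omega>)\<^sup>2)"
proof -
  show "integrable M (\<lambda>\<omega>. X \<omega> * Y \<omega>)"
  proof (rule Bochner_Integration.integrable_bound[OF Bochner_Integration.integrable_add[OF X Y]])
    show "AE \<omega> in M. norm (X \<omega> * Y \<omega>) \<le> norm ((X \<omega>)\<^sup>2 + (Y \<omega>)\<^sup>2)"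
    proof (rule AE_I2)
      fix \<omega>
      have "2 * (\<bar>X \<omega>\<bar> * \<bar>Y \<omega>\<bar>) \<le> (X \<omega>)\<^sup>2 + (Y \<omega>)\<^sup>2"
        using sum_squares_bound[of "\<bar>X \<omega>\<bar>" "\<bar>Y \<omega>\<bar>"] by simp
      moreover have "0 \<le> \<bar>X \<omega>\<bar> * \<bar>Y \<omega>\<bar>" by simp
      ultimately show "norm (X \<omega> * Y \<omega>) \<le> norm ((X \<omega>)\<^sup>2 + (Y \<omega>)\<^sup>2)"
        unfolding real_norm_def abs_mult by linarith
    qed
  qed simp
  then show "integrable M (\<lambda>\<omega>. (X \<omega> + Y \<omega>)\<^sup>2)" "integrable M (\<lambda>\<omega>. (X \<omega> - Y \<omega>)\<^sup>2)"
    using X Y by (auto simp: power2_sum power2_diff mult.assoc)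
qed

lemma (in prob_space) sq_expectation_le:
  fixes X :: "'a \<Rightarrow> real"
  assumes "X \<in> borel_measurable M" "integrable M (\<lambda>\<omega>. (X \<omega>)\<^sup>2)"
  shows "(expectation X)\<^sup>2 \<le> expectation (\<lambda>\<omega>. (X \<omega>)\<^sup>2)"
  using variance_eq[of X] variance_positive[of X] square_integrable_imp_integrable[OF assms] assms by simp

lemma char_normal_density:
  assumes "0 < \<sigma>"
  shows "char (density lborel (\<lambda>y. ennreal (normal_density \<mu> \<sigma> y))) t =
    iexp (t * \<mu>) * complex_of_real (exp (- (\<sigma>\<^sup>2 * t\<^sup>2 / 2)))"
proof -
  interpret P: prob_space std_normal_distribution using prob_space_normal_density[of 1 0] by simp
  have "distributed std_normal_distribution lborel (\<lambda>x. x) std_normal_density"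
    by (auto simp: distributed_def distr_id2 intro!: distr_id2)
  from P.normal_density_affine[OF this, of \<sigma> \<mu>] assms
  have "distributed std_normal_distribution lborel (\<lambda>x. \<mu> + \<sigma> * x) (normal_density \<mu> \<sigma>)" by simp
  then have "density lborel (\<lambda>y. ennreal (normal_density \<mu> \<sigma> y)) =
      distr std_normal_distribution lborel (\<lambda>x. \<mu> + \<sigma> * x)"
    by (simp add: distributed_distr_eq_density)
  then have "char (density lborel (\<lambda>y. ennreal (normal_density \<mu> \<sigma> y))) t =
      (CLINT x|std_normal_distribution. iexp (t * (\<mu> + \<sigma> * x)))"
    by (simp add: char_def integral_distr)
  also have "\<dots> = (CLINT x|std_normal_distribution. iexp (t * \<mu>) * iexp ((t * \<sigma>) * x))"
    by (intro Bochner_Integration.integral_cong refl) (simp add: exp_add[symmetric] algebra_simps)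
  also have "\<dots> = iexp (t * \<mu>) * char std_normal_distribution (t * \<sigma>)"
    by (simp add: char_def)
  finally show ?thesis
    by (simp add: char_std_normal_distribution power_mult_distrib mult.commute)
qed

lemma (in prob_space) char_distr_scale:
  assumes "random_variable borel X"
  shows "char (distr M borel (\<lambda>\<omega>. c * X \<omega>)) t = char (distr M borel X) (c * t)"
  using assms by (simp add: char_def integral_distr mult_ac)

lemma abs_exp_minus_le:
  fixes u :: real assumes "0 \<le> u"
  shows "\<bar>exp (- u) - (1 - u)\<bar> \<le> u\<^sup>2 / 2"
proof -
  have "1 - u \<le> exp (- u)" using exp_ge_add_one_self[of "- u"] by simp
  moreover have "exp (- u) \<le> 1 - u + u\<^sup>2 / 2"
  proof -
    have "1 - 0 + 0\<^sup>2 / 2 - exp (- 0) \<le> 1 - u + u\<^sup>2 / 2 - exp (- u)"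
    proof (rule DERIV_nonneg_imp_nondecreasing[OF assms])
      fix x :: real
      have "((\<lambda>u. 1 - u + u\<^sup>2 / 2 - exp (- u)) has_real_derivative - 1 + x + exp (- x)) (at x)"
        by (auto intro!: derivative_eq_intros)
      moreover have "0 \<le> - 1 + x + exp (- x)" using exp_ge_add_one_self[of "- x"] by simp
      ultimately show "\<exists>y. ((\<lambda>u. 1 - u + u\<^sup>2 / 2 - exp (- u)) has_real_derivative y) (at x) \<and> 0 \<le> y" by blast
    qed
    then show ?thesis by simp
  qed
  ultimately show ?thesis by simp
qed

text \<open>Both sides agree with \<open>1 - t\<^sup>2 w / 2\<close> up to the stated error. The second error term comes from the exponential;
\<open>u\<^sup>2\<close> with \<open>u = t\<^sup>2 w\<close> is a fourth power of \<open>t\<close>.\<close>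

lemma (in prob_space) char_centered_approx:
  assumes X: "random_variable borel X" "integrable M X" "integrable M (\<lambda>\<omega>. (X \<omega>)\<^sup>2)"
      "integrable M (\<lambda>\<omega>. \<bar>X \<omega>\<bar> ^ 3)"
    and mean: "expectation X = 0"
  defines "w \<equiv> expectation (\<lambda>\<omega>. (X \<omega>)\<^sup>2)"
  shows "cmod (char (distr M borel X) t - complex_of_real (exp (- (t\<^sup>2 * w / 2)))) \<le>
    \<bar>t\<bar> ^ 3 * expectation (\<lambda>\<omega>. \<bar>X \<omega>\<bar> ^ 3) + t ^ 4 * w\<^sup>2"
proof -
  have w: "0 \<le> w" by (simp add: w_def)
  have "cmod (char (distr M borel X) t - complex_of_real (1 - t\<^sup>2 * w / 2)) \<le>
      (t\<^sup>2 / 6) * expectation (\<lambda>\<omega>. min (6 * (X \<omega>)\<^sup>2) (\<bar>t\<bar> * \<bar>X \<omega>\<bar> ^ 3))"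
    using char_approx3'[OF X(1,2,3) mean _ refl, of w t] mean by (simp add: w_def)
  also have "\<dots> \<le> (t\<^sup>2 / 6) * expectation (\<lambda>\<omega>. \<bar>t\<bar> * \<bar>X \<omega>\<bar> ^ 3)"
    using X by (intro mult_left_mono integral_mono integrable_min) auto
  also have "\<dots> = \<bar>t\<bar> ^ 3 * expectation (\<lambda>\<omega>. \<bar>X \<omega>\<bar> ^ 3) / 6"
    by (simp add: power3_eq_cube power2_eq_square)
  also have "\<dots> \<le> \<bar>t\<bar> ^ 3 * expectation (\<lambda>\<omega>. \<bar>X \<omega>\<bar> ^ 3)" by simp
  finally have 1: "cmod (char (distr M borel X) t - complex_of_real (1 - t\<^sup>2 * w / 2)) \<le>
      \<bar>t\<bar> ^ 3 * expectation (\<lambda>\<omega>. \<bar>X \<omega>\<bar> ^ 3)" .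
  have "cmod (complex_of_real (1 - t\<^sup>2 * w / 2) - complex_of_real (exp (- (t\<^sup>2 * w / 2)))) =
      \<bar>exp (- (t\<^sup>2 * w / 2)) - (1 - t\<^sup>2 * w / 2)\<bar>"
    by (metis norm_minus_commute norm_of_real of_real_diff)
  also have "\<dots> \<le> (t\<^sup>2 * w / 2)\<^sup>2 / 2" using w by (intro abs_exp_minus_le) auto
  also have "\<dots> = t ^ 4 * w\<^sup>2 / 8" by (simp add: power_mult_distrib power_divide)
  also have "\<dots> \<le> t ^ 4 * w\<^sup>2" by simp
  finally have 2: "cmod (complex_of_real (1 - t\<^sup>2 * w / 2) - complex_of_real (exp (- (t\<^sup>2 * w / 2)))) \<le> t ^ 4 * w\<^sup>2" .
  have "cmod (char (distr M borel X) t - complex_of_real (exp (- (t\<^sup>2 * w / 2)))) \<le>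
     cmod (char (distr M borel X) t - complex_of_real (1 - t\<^sup>2 * w / 2)) +
     cmod (complex_of_real (1 - t\<^sup>2 * w / 2) - complex_of_real (exp (- (t\<^sup>2 * w / 2))))"
    by (rule norm_triangle_ineq[THEN order_trans[rotated]]) simp
  with 1 2 show ?thesis by linarith
qed

text \<open>\<open>\<bar>e\<^sup>i\<^sup>a - e\<^sup>i\<^sup>b\<bar> \<le> \<bar>a - b\<bar>\<close>, followed by the Cauchy-Schwarz inequality: a perturbation that is small in \<open>L\<^sup>2\<close> does not change the
limit law.\<close>

lemma (in prob_space) cmod_char_diff_le:
  assumes "random_variable borel X" "random_variable borel Y" and int: "integrable M (\<lambda>\<omega>. (X \<omega> - Y \<omega>)\<^sup>2)"
  shows "cmod (char (distr M borel X) t - char (distr M borel Y) t) \<le>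
    \<bar>t\<bar> * sqrt (expectation (\<lambda>\<omega>. (X \<omega> - Y \<omega>)\<^sup>2))"
proof -
  note [measurable] = assms(1,2)
  have iX: "integrable M (\<lambda>\<omega>. iexp (t * X \<omega>))" "integrable M (\<lambda>\<omega>. iexp (t * Y \<omega>))"
    by (auto intro!: integrable_iexp)
  have intd: "integrable M (\<lambda>\<omega>. X \<omega> - Y \<omega>)"
    by (rule square_integrable_imp_integrable[OF _ int]) simp
  have "char (distr M borel X) t - char (distr M borel Y) t = (CLINT \<omega>|M. iexp (t * X \<omega>) - iexp (t * Y \<omega>))"
    using iX by (simp add: char_def integral_distr)
  also have "cmod \<dots> \<le> expectation (\<lambda>\<omega>. cmod (iexp (t * X \<omega>) - iexp (t * Y \<omega>)))"
    by (rule integral_norm_bound)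
  also have "\<dots> \<le> expectation (\<lambda>\<omega>. \<bar>t\<bar> * \<bar>X \<omega> - Y \<omega>\<bar>)"
  proof (rule integral_mono)
    show "integrable M (\<lambda>\<omega>. cmod (iexp (t * X \<omega>) - iexp (t * Y \<omega>)))" using iX by auto
    show "integrable M (\<lambda>\<omega>. \<bar>t\<bar> * \<bar>X \<omega> - Y \<omega>\<bar>)" using intd by auto
    fix \<omega>
    have "iexp (t * X \<omega>) - iexp (t * Y \<omega>) = iexp (t * Y \<omega>) * (iexp (t * X \<omega> - t * Y \<omega>) - 1)"
      by (simp add: algebra_simps exp_diff)
    then have "cmod (iexp (t * X \<omega>) - iexp (t * Y \<omega>)) = cmod (iexp (t * X \<omega> - t * Y \<omega>) - 1)"
      by (simp add: norm_mult)
    also have "\<dots> \<le> \<bar>t * X \<omega> - t * Y \<omega>\<bar>"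
      using iexp_approx1[of "t * X \<omega> - t * Y \<omega>" 0] by simp
    also have "\<dots> = \<bar>t\<bar> * \<bar>X \<omega> - Y \<omega>\<bar>" by (simp add: abs_mult right_diff_distrib[symmetric])
    finally show "cmod (iexp (t * X \<omega>) - iexp (t * Y \<omega>)) \<le> \<bar>t\<bar> * \<bar>X \<omega> - Y \<omega>\<bar>" .
  qed
  also have "\<dots> = \<bar>t\<bar> * expectation (\<lambda>\<omega>. \<bar>X \<omega> - Y \<omega>\<bar>)" by simp
  also have "expectation (\<lambda>\<omega>. \<bar>X \<omega> - Y \<omega>\<bar>) \<le> sqrt (expectation (\<lambda>\<omega>. (X \<omega> - Y \<omega>)\<^sup>2))"
  proof (rule real_le_rsqrt)
    show "(expectation (\<lambda>\<omega>. \<bar>X \<omega> - Y \<omega>\<bar>))\<^sup>2 \<le> expectation (\<lambda>\<omega>. (X \<omega> - Y \<omega>)\<^sup>2)"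
      using variance_eq[of "\<lambda>\<omega>. \<bar>X \<omega> - Y \<omega>\<bar>"] variance_positive[of "\<lambda>\<omega>. \<bar>X \<omega> - Y \<omega>\<bar>"] intd int by simp
  qed
  finally show ?thesis by (simp add: mult_left_mono)
qed

section \<open>Linear recursions with independent random coefficients\<close>

text \<open>The error of the Revesz estimator at the point \<open>x\<close>, reduced to what its asymptotics depend on. The weight \<open>v\<close> is the
normalization under study. The noise \<open>\<eta>\<close> may have a mean, of order \<open>\<beta> / v\<close>; \<open>\<tau>\<close> is the size of its variance in the scale
of \<open>v\<close>, and \<open>\<tau> = 0\<close> means that the fluctuations are negligible in that scale. The condition on third moments is Lyapunov's.\<close>

locale linear_recursion = prob_space M for M :: "'a measure" +
  fixes Z \<eta> D :: "nat \<Rightarrow> 'a \<Rightarrow> real" and \<gamma> v :: "nat \<Rightarrow> real" and d0 f \<beta> \<tau> \<zeta> :: real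
  assumes indep: "indep_vars (\<lambda>_. borel) (\<lambda>n \<omega>. (Z n \<omega>, \<eta> n \<omega>)) {1..}"
    and D_0: "\<And>\<omega>. D 0 \<omega> = d0"
    and D_Suc: "\<And>n \<omega>. D (Suc n) \<omega> = (1 - \<gamma> (Suc n) * Z (Suc n) \<omega>) * D n \<omega> + \<gamma> (Suc n) * \<eta> (Suc n) \<omega>"
    and int_Z2: "\<And>n. n \<ge> 1 \<Longrightarrow> integrable M (\<lambda>\<omega>. (Z n \<omega>)\<^sup>2)"
    and int_\<eta>2: "\<And>n. n \<ge> 1 \<Longrightarrow> integrable M (\<lambda>\<omega>. (\<eta> n \<omega>)\<^sup>2)"
    and int_\<eta>3: "\<And>n. n \<ge> 1 \<Longrightarrow> integrable M (\<lambda>\<omega>. \<bar>\<eta> n \<omega>\<bar> ^ 3)"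
    and \<gamma>: "\<And>n. n \<ge> 1 \<Longrightarrow> 0 < \<gamma> n" "\<gamma> \<longlonglongrightarrow> 0" "\<not> summable \<gamma>"
    and v: "growth_rate \<gamma> v \<zeta>" and \<zeta>: "\<zeta> < f"
    and EZ: "(\<lambda>n. expectation (Z n)) \<longlonglongrightarrow> f"
    and EZ2: "(\<lambda>n. \<gamma> n * expectation (\<lambda>\<omega>. (Z n \<omega>)\<^sup>2)) \<longlonglongrightarrow> 0"
    and E\<eta>: "(\<lambda>n. v n * expectation (\<eta> n)) \<longlonglongrightarrow> \<beta>"
    and E\<eta>2: "(\<lambda>n. (v n)\<^sup>2 * \<gamma> n * expectation (\<lambda>\<omega>. (\<eta> n \<omega>)\<^sup>2)) \<longlonglongrightarrow> \<tau>"
    and E\<eta>3: "(\<lambda>n. v n ^ 3 * (\<gamma> n)\<^sup>2 * expectation (\<lambda>\<omega>. \<bar>\<eta> n \<omega>\<bar> ^ 3)) \<longlonglongrightarrow> 0"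
begin

text \<open>\<open>S\<close> and \<open>b\<close> are the centered part and the mean of the solution of the recursion in which \<open>Z\<close> is replaced by \<open>f\<close>; \<open>b\<close>
carries the initial value, so that \<open>S\<close> and the remainder \<open>R\<close> start at zero.\<close>

primrec S :: "nat \<Rightarrow> 'a \<Rightarrow> real" where
  "S 0 \<omega> = 0"
| "S (Suc n) \<omega> = (1 - \<gamma> (Suc n) * f) * S n \<omega> + \<gamma> (Suc n) * (\<eta> (Suc n) \<omega> - expectation (\<eta> (Suc n)))"

primrec b :: "nat \<Rightarrow> real" where
  "b 0 = d0"
| "b (Suc n) = (1 - \<gamma> (Suc n) * f) * b n + \<gamma> (Suc n) * expectation (\<eta> (Suc n))"

definition R :: "nat \<Rightarrow> 'a \<Rightarrow> real" where
  "R n \<omega> = D n \<omega> - S n \<omega> - b n"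

lemma R_Suc: "R (Suc n) \<omega> = (1 - \<gamma> (Suc n) * f) * R n \<omega> + \<gamma> (Suc n) * (f - Z (Suc n) \<omega>) * D n \<omega>"
  by (simp add: R_def D_Suc algebra_simps)

lemma measurable_Z_\<eta> [measurable]:
  "n \<ge> 1 \<Longrightarrow> Z n \<in> borel_measurable M" "n \<ge> 1 \<Longrightarrow> \<eta> n \<in> borel_measurable M"
proof -
  assume n: "n \<ge> 1"
  have "(\<lambda>\<omega>. (Z n \<omega>, \<eta> n \<omega>)) \<in> borel_measurable M" using indep n by (simp add: indep_vars_def)
  then have *: "(\<lambda>\<omega>. (Z n \<omega>, \<eta> n \<omega>)) \<in> measurable M (borel \<Otimes>\<^sub>M borel)" by (simp add: borel_prod)
  show "Z n \<in> borel_measurable M" using measurable_compose[OF * measurable_fst] by simp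
  show "\<eta> n \<in> borel_measurable M" using measurable_compose[OF * measurable_snd] by simp
qed

lemma indep_state: "indep_var borel (\<lambda>\<omega>. (D n \<omega>, S n \<omega>)) borel (\<lambda>\<omega>. (Z (Suc n) \<omega>, \<eta> (Suc n) \<omega>))"
proof (rule indep_var_recursion[OF indep, where start = "(d0, 0)" and \<Psi> = "\<lambda>n u z.
    ((1 - \<gamma> (Suc n) * fst z) * fst u + \<gamma> (Suc n) * snd z,
     (1 - \<gamma> (Suc n) * f) * snd u + \<gamma> (Suc n) * (snd z - expectation (\<eta> (Suc n))))"])
  fix n
  show "(\<lambda>p. ((1 - \<gamma> (Suc n) * fst (snd p)) * fst (fst p) + \<gamma> (Suc n) * snd (snd p),
     (1 - \<gamma> (Suc n) * f) * snd (fst p) + \<gamma> (Suc n) * (snd (snd p) - expectation (\<eta> (Suc n)))))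
    \<in> borel_measurable (borel \<Otimes>\<^sub>M borel :: ((real \<times> real) \<times> (real \<times> real)) measure)"
    unfolding borel_prod[symmetric] by measurable
qed (simp_all add: D_0 D_Suc)

lemma measurable_D_S [measurable]: "D n \<in> borel_measurable M" "S n \<in> borel_measurable M" "R n \<in> borel_measurable M"
proof -
  have "(\<lambda>\<omega>. (D n \<omega>, S n \<omega>)) \<in> borel_measurable M" using indep_state by (rule indep_var_rv1)
  then have *: "(\<lambda>\<omega>. (D n \<omega>, S n \<omega>)) \<in> measurable M (borel \<Otimes>\<^sub>M borel)" by (simp add: borel_prod)
  show [measurable]: "D n \<in> borel_measurable M" using measurable_compose[OF * measurable_fst] by simp
  show [measurable]: "S n \<in> borel_measurable M" using measurable_compose[OF * measurable_snd] by simp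
  show "R n \<in> borel_measurable M" unfolding R_def[abs_def] by measurable
qed

text \<open>\<open>R n\<close> is a function of \<open>D n\<close> and \<open>S n\<close>, so the pair of these two is all of the past that the moment recursions use.\<close>

lemma indep_next:
  assumes "(\<lambda>p. \<phi> (fst p) (snd p)) \<in> borel_measurable (borel \<Otimes>\<^sub>M borel :: (real \<times> real) measure)"
    and "(\<lambda>p. \<psi> (fst p) (snd p)) \<in> borel_measurable (borel \<Otimes>\<^sub>M borel :: (real \<times> real) measure)"
  shows "indep_var borel (\<lambda>\<omega>. \<phi> (D n \<omega>) (S n \<omega>) :: real) borel (\<lambda>\<omega>. \<psi> (Z (Suc n) \<omega>) (\<eta> (Suc n) \<omega>) :: real)"
  using indep_var_compose[OF indep_state[of n], of "\<lambda>p. \<phi> (fst p) (snd p)" borel "\<lambda>p. \<psi> (fst p) (snd p)" borel] assms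
  by (simp add: borel_prod comp_def)

lemma expectation_next:
  assumes "(\<lambda>p. \<phi> (fst p) (snd p)) \<in> borel_measurable (borel \<Otimes>\<^sub>M borel :: (real \<times> real) measure)"
    and "(\<lambda>p. \<psi> (fst p) (snd p)) \<in> borel_measurable (borel \<Otimes>\<^sub>M borel :: (real \<times> real) measure)"
    and "integrable M (\<lambda>\<omega>. \<phi> (D n \<omega>) (S n \<omega>) :: real)"
    and "integrable M (\<lambda>\<omega>. \<psi> (Z (Suc n) \<omega>) (\<eta> (Suc n) \<omega>) :: real)"
  shows "expectation (\<lambda>\<omega>. \<phi> (D n \<omega>) (S n \<omega>) * \<psi> (Z (Suc n) \<omega>) (\<eta> (Suc n) \<omega>)) =
      expectation (\<lambda>\<omega>. \<phi> (D n \<omega>) (S n \<omega>)) * expectation (\<lambda>\<omega>. \<psi> (Z (Suc n) \<omega>) (\<eta> (Suc n) \<omega>))"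
    and "integrable M (\<lambda>\<omega>. \<phi> (D n \<omega>) (S n \<omega>) * \<psi> (Z (Suc n) \<omega>) (\<eta> (Suc n) \<omega>))"
  using indep_var_lebesgue_integral[OF indep_next[of \<phi> \<psi> n, OF assms(1,2)] assms(3,4)]
    indep_var_integrable[OF indep_next[of \<phi> \<psi> n, OF assms(1,2)] assms(3,4)]
  by auto

lemma int_Z_\<eta>:
  assumes "n \<ge> 1" shows "integrable M (Z n)" "integrable M (\<eta> n)"
  using assms int_Z2[of n] int_\<eta>2[of n]
  by (auto intro!: square_integrable_imp_integrable)

lemma int_D2: "integrable M (\<lambda>\<omega>. (D n \<omega>)\<^sup>2)"
proof (induction n)
  case 0
  then show ?case by (simp add: D_0)
next
  case (Suc n)
  have "integrable M (\<lambda>\<omega>. (D n \<omega>)\<^sup>2 * (Z (Suc n) \<omega>)\<^sup>2)"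
    by (rule expectation_next(2)[of "\<lambda>d s. d\<^sup>2" "\<lambda>z e. z\<^sup>2"]) (use Suc int_Z2 in auto)
  then have 1: "integrable M (\<lambda>\<omega>. (\<gamma> (Suc n) * (Z (Suc n) \<omega> * D n \<omega>))\<^sup>2)"
    by (simp add: power_mult_distrib mult.commute)
  have 2: "integrable M (\<lambda>\<omega>. (\<gamma> (Suc n) * \<eta> (Suc n) \<omega>)\<^sup>2)"
    using int_\<eta>2[of "Suc n"] by (simp add: power_mult_distrib)
  have "integrable M (\<lambda>\<omega>. (D n \<omega> - \<gamma> (Suc n) * (Z (Suc n) \<omega> * D n \<omega>) + \<gamma> (Suc n) * \<eta> (Suc n) \<omega>)\<^sup>2)"
    by (intro integrable_prod_squares Suc 1 2) auto
  then show ?case by (simp add: D_Suc algebra_simps)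
qed

lemma int_S2: "integrable M (\<lambda>\<omega>. (S n \<omega>)\<^sup>2)"
proof (induction n)
  case (Suc n)
  have "integrable M (\<lambda>\<omega>. (\<eta> (Suc n) \<omega> - expectation (\<eta> (Suc n)))\<^sup>2)"
    by (intro integrable_prod_squares int_\<eta>2) auto
  then have 2: "integrable M (\<lambda>\<omega>. (\<gamma> (Suc n) * (\<eta> (Suc n) \<omega> - expectation (\<eta> (Suc n))))\<^sup>2)"
    by (simp add: power_mult_distrib)
  have 1: "integrable M (\<lambda>\<omega>. ((1 - \<gamma> (Suc n) * f) * S n \<omega>)\<^sup>2)"
    using Suc by (simp add: power_mult_distrib)
  show ?case unfolding S.simps by (intro integrable_prod_squares 1 2) auto
qed simp

lemma int_R2: "integrable M (\<lambda>\<omega>. (R n \<omega>)\<^sup>2)"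
  unfolding R_def by (intro integrable_prod_squares int_D2 int_S2) auto

lemma int_D_S: "integrable M (D n)" "integrable M (S n)" "integrable M (R n)"
  by (auto intro!: square_integrable_imp_integrable int_D2 int_S2 int_R2)

lemma rate2: "growth_rate \<gamma> (\<lambda>n. (v n)\<^sup>2) (2 * \<zeta>)"
  using growth_rate_power[OF v \<gamma>(1,2), of 2] by simp

text \<open>The square of \<open>D - \<gamma> Z D + \<gamma> \<eta>\<close> is bounded before taking expectations: the product \<open>- 2 \<gamma>\<^sup>2 Z \<eta> D\<close> is absorbed by
\<open>\<gamma>\<^sup>2 Z\<^sup>2 D\<^sup>2 + \<gamma>\<^sup>2 \<eta>\<^sup>2\<close>, so that only pure moments of \<open>Z\<close> and \<open>\<eta>\<close> remain. The drift term \<open>2 \<gamma> E\<eta> E D\<close> costs an arbitrarily small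
part \<open>\<epsilon>\<close> of the contraction rate.\<close>

lemma second_moment_rec:
  assumes \<epsilon>: "0 < \<epsilon>"
  shows "expectation (\<lambda>\<omega>. (D (Suc n) \<omega>)\<^sup>2) \<le>
    (1 - \<gamma> (Suc n) * (2 * expectation (Z (Suc n)) - 2 * (\<gamma> (Suc n) * expectation (\<lambda>\<omega>. (Z (Suc n) \<omega>)\<^sup>2)) - \<epsilon>)) *
      expectation (\<lambda>\<omega>. (D n \<omega>)\<^sup>2) +
    \<gamma> (Suc n) * ((expectation (\<eta> (Suc n)))\<^sup>2 / \<epsilon> + 2 * (\<gamma> (Suc n) * expectation (\<lambda>\<omega>. (\<eta> (Suc n) \<omega>)\<^sup>2)))"
proof -
  define g where "g = \<gamma> (Suc n)"
  have g: "0 < g" using \<gamma>(1) by (simp add: g_def)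
  define z1 z2 e1 e2 p d where "z1 = expectation (Z (Suc n))" and "z2 = expectation (\<lambda>\<omega>. (Z (Suc n) \<omega>)\<^sup>2)"
    and "e1 = expectation (\<eta> (Suc n))" and "e2 = expectation (\<lambda>\<omega>. (\<eta> (Suc n) \<omega>)\<^sup>2)"
    and "p = expectation (\<lambda>\<omega>. (D n \<omega>)\<^sup>2)" and "d = expectation (D n)"
  let ?a = "\<lambda>\<omega>. 1 - 2 * g * Z (Suc n) \<omega> + 2 * g\<^sup>2 * (Z (Suc n) \<omega>)\<^sup>2"
  have ia: "integrable M ?a" using int_Z_\<eta> int_Z2 by auto
  have E1: "expectation (\<lambda>\<omega>. (D n \<omega>)\<^sup>2 * ?a \<omega>) = p * (1 - 2 * g * z1 + 2 * g\<^sup>2 * z2)"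
    "integrable M (\<lambda>\<omega>. (D n \<omega>)\<^sup>2 * ?a \<omega>)"
    using expectation_next[of "\<lambda>d s. d\<^sup>2" "\<lambda>z e. 1 - 2 * g * z + 2 * g\<^sup>2 * z\<^sup>2" n] ia int_D2 int_Z_\<eta> int_Z2
    by (auto simp: p_def z1_def z2_def prob_space)
  have E2: "expectation (\<lambda>\<omega>. D n \<omega> * \<eta> (Suc n) \<omega>) = d * e1" "integrable M (\<lambda>\<omega>. D n \<omega> * \<eta> (Suc n) \<omega>)"
    using expectation_next[of "\<lambda>d s. d" "\<lambda>z e. e" n] int_D_S int_Z_\<eta> by (auto simp: d_def e1_def)
  have "expectation (\<lambda>\<omega>. (D (Suc n) \<omega>)\<^sup>2) \<le>
      expectation (\<lambda>\<omega>. (D n \<omega>)\<^sup>2 * ?a \<omega> + 2 * g * (D n \<omega> * \<eta> (Suc n) \<omega>) + 2 * g\<^sup>2 * (\<eta> (Suc n) \<omega>)\<^sup>2)"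
  proof (rule integral_mono[OF int_D2])
    show "integrable M (\<lambda>\<omega>. (D n \<omega>)\<^sup>2 * ?a \<omega> + 2 * g * (D n \<omega> * \<eta> (Suc n) \<omega>) + 2 * g\<^sup>2 * (\<eta> (Suc n) \<omega>)\<^sup>2)"
      using E1(2) E2(2) int_\<eta>2 by auto
    fix \<omega>
    have "0 \<le> (g * Z (Suc n) \<omega> * D n \<omega> + g * \<eta> (Suc n) \<omega>)\<^sup>2" by simp
    then show "(D (Suc n) \<omega>)\<^sup>2 \<le>
        (D n \<omega>)\<^sup>2 * ?a \<omega> + 2 * g * (D n \<omega> * \<eta> (Suc n) \<omega>) + 2 * g\<^sup>2 * (\<eta> (Suc n) \<omega>)\<^sup>2"
      unfolding D_Suc g_def[symmetric] by (simp add: power2_eq_square algebra_simps)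
  qed
  also have "\<dots> = p * (1 - 2 * g * z1 + 2 * g\<^sup>2 * z2) + 2 * g * (d * e1) + 2 * g\<^sup>2 * e2"
    using E1 E2 int_\<eta>2 by (simp add: e2_def)
  also have "\<dots> \<le> p * (1 - 2 * g * z1 + 2 * g\<^sup>2 * z2) + g * (\<epsilon> * p + e1\<^sup>2 / \<epsilon>) + 2 * g\<^sup>2 * e2"
  proof -
    have "2 * (d * e1) \<le> \<epsilon> * d\<^sup>2 + e1\<^sup>2 / \<epsilon>"
    proof -
      have "0 \<le> (\<epsilon> * d - e1)\<^sup>2 / \<epsilon>" using \<epsilon> by simp
      also have "\<dots> = \<epsilon> * d\<^sup>2 + e1\<^sup>2 / \<epsilon> - 2 * (d * e1)"
        using \<epsilon> by (simp add: power2_eq_square field_simps)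
      finally show ?thesis by simp
    qed
    moreover have "\<epsilon> * d\<^sup>2 \<le> \<epsilon> * p"
      unfolding d_def p_def using \<epsilon> by (intro mult_left_mono sq_expectation_le int_D2) auto
    ultimately have "2 * (d * e1) \<le> \<epsilon> * p + e1\<^sup>2 / \<epsilon>" by linarith
    from mult_left_mono[OF this, of g] g show ?thesis by (simp add: mult_ac)
  qed
  also have "\<dots> = (1 - g * (2 * z1 - 2 * (g * z2) - \<epsilon>)) * p + g * (e1\<^sup>2 / \<epsilon> + 2 * (g * e2))"
    by (simp add: power2_eq_square algebra_simps)
  finally show ?thesis by (simp add: g_def z1_def z2_def e1_def e2_def p_def)
qed

lemma second_moment_bounded:
  obtains B where "\<forall>\<^sub>F n in sequentially. (v n)\<^sup>2 * expectation (\<lambda>\<omega>. (D n \<omega>)\<^sup>2) < B"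
proof -
  \<comment> \<open>This leaves the rate \<open>2 f - \<epsilon> - 2 \<zeta> = f - \<zeta> > 0\<close> for the square of the weighted solution.\<close>
  define \<epsilon> where "\<epsilon> = f - \<zeta>"
  have \<epsilon>: "0 < \<epsilon>" using \<zeta> by (simp add: \<epsilon>_def)
  define E where "E = \<beta>\<^sup>2 / \<epsilon> + 2 * \<tau>"
  have lim: "(\<lambda>n. (v (Suc n))\<^sup>2 * ((expectation (\<eta> (Suc n)))\<^sup>2 / \<epsilon> +
      2 * (\<gamma> (Suc n) * expectation (\<lambda>\<omega>. (\<eta> (Suc n) \<omega>)\<^sup>2)))) \<longlonglongrightarrow> E"
  proof -
    have "(\<lambda>n. (v (Suc n) * expectation (\<eta> (Suc n)))\<^sup>2 / \<epsilon> +
        2 * ((v (Suc n))\<^sup>2 * \<gamma> (Suc n) * expectation (\<lambda>\<omega>. (\<eta> (Suc n) \<omega>)\<^sup>2))) \<longlonglongrightarrow> E"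
      unfolding E_def using \<epsilon> by (intro tendsto_intros LIMSEQ_Suc[OF E\<eta>] LIMSEQ_Suc[OF E\<eta>2]) auto
    then show ?thesis by (simp add: power_mult_distrib algebra_simps)
  qed
  have q: "(\<lambda>n. 2 * expectation (Z (Suc n)) - 2 * (\<gamma> (Suc n) * expectation (\<lambda>\<omega>. (Z (Suc n) \<omega>)\<^sup>2)) - \<epsilon>)
      \<longlonglongrightarrow> 2 * f - 2 * 0 - \<epsilon>"
    by (intro tendsto_intros LIMSEQ_Suc[OF EZ] LIMSEQ_Suc[OF EZ2])
  have "\<forall>\<^sub>F n in sequentially. (v n)\<^sup>2 * expectation (\<lambda>\<omega>. (D n \<omega>)\<^sup>2) < E / (2 * f - 2 * 0 - \<epsilon> - 2 * \<zeta>) + 1"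
    by (rule weighted_recursion_limsup[OF _ rate2 \<gamma> q _ lim])
       (use second_moment_rec[OF \<epsilon>] \<zeta> in \<open>auto simp: \<epsilon>_def\<close>)
  then show ?thesis by (rule that)
qed

text \<open>In \<open>R (Suc n) = (1 - \<gamma> f) R + \<gamma> (f - Z) D\<close> the cross term contributes only a multiple of \<open>\<gamma> \<bar>f - E Z\<bar> E \<bar>D R\<bar>\<close>, by independence, and the
square contributes \<open>\<gamma> (\<gamma> E (f - Z)\<^sup>2) E D\<^sup>2\<close>. Both coefficients are \<open>o(\<gamma>)\<close>.\<close>

lemma remainder_rec:
  "expectation (\<lambda>\<omega>. (R (Suc n) \<omega>)\<^sup>2) \<le>
    (1 - \<gamma> (Suc n) * (2 * f - \<gamma> (Suc n) * f\<^sup>2 - \<bar>1 - \<gamma> (Suc n) * f\<bar> * \<bar>f - expectation (Z (Suc n))\<bar>)) *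
      expectation (\<lambda>\<omega>. (R n \<omega>)\<^sup>2) +
    \<gamma> (Suc n) * ((\<bar>1 - \<gamma> (Suc n) * f\<bar> * \<bar>f - expectation (Z (Suc n))\<bar> +
      \<gamma> (Suc n) * (f\<^sup>2 - 2 * f * expectation (Z (Suc n))) + \<gamma> (Suc n) * expectation (\<lambda>\<omega>. (Z (Suc n) \<omega>)\<^sup>2)) *
      expectation (\<lambda>\<omega>. (D n \<omega>)\<^sup>2))"
proof -
  define g where "g = \<gamma> (Suc n)"
  have g: "0 < g" using \<gamma>(1) by (simp add: g_def)
  define z1 z2 p r c where "z1 = expectation (Z (Suc n))" and "z2 = expectation (\<lambda>\<omega>. (Z (Suc n) \<omega>)\<^sup>2)"
    and "p = expectation (\<lambda>\<omega>. (D n \<omega>)\<^sup>2)" and "r = expectation (\<lambda>\<omega>. (R n \<omega>)\<^sup>2)"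
    and "c = expectation (\<lambda>\<omega>. D n \<omega> * R n \<omega>)"
  have iDR: "integrable M (\<lambda>\<omega>. D n \<omega> * R n \<omega>)" by (intro integrable_prod_squares int_D2 int_R2) auto
  have iz: "integrable M (\<lambda>\<omega>. f - Z (Suc n) \<omega>)" using int_Z_\<eta> by auto
  have iz2: "integrable M (\<lambda>\<omega>. f\<^sup>2 - 2 * f * Z (Suc n) \<omega> + (Z (Suc n) \<omega>)\<^sup>2)" using int_Z_\<eta> int_Z2 by auto
  have E1: "expectation (\<lambda>\<omega>. (D n \<omega> * R n \<omega>) * (f - Z (Suc n) \<omega>)) = c * (f - z1)"
    "integrable M (\<lambda>\<omega>. (D n \<omega> * R n \<omega>) * (f - Z (Suc n) \<omega>))"
    using expectation_next[of "\<lambda>d s. d * (d - s - b n)" "\<lambda>z e. f - z" n] iDR iz int_Z_\<eta>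
    by (auto simp: R_def c_def z1_def prob_space)
  have E2: "expectation (\<lambda>\<omega>. (D n \<omega>)\<^sup>2 * (f\<^sup>2 - 2 * f * Z (Suc n) \<omega> + (Z (Suc n) \<omega>)\<^sup>2)) = p * (f\<^sup>2 - 2 * f * z1 + z2)"
    "integrable M (\<lambda>\<omega>. (D n \<omega>)\<^sup>2 * (f\<^sup>2 - 2 * f * Z (Suc n) \<omega> + (Z (Suc n) \<omega>)\<^sup>2))"
    using expectation_next[of "\<lambda>d s. d\<^sup>2" "\<lambda>z e. f\<^sup>2 - 2 * f * z + z\<^sup>2" n] iz2 int_D2 int_Z_\<eta> int_Z2
    by (auto simp: p_def z1_def z2_def prob_space)
  have "(R (Suc n) \<omega>)\<^sup>2 = (1 - g * f)\<^sup>2 * (R n \<omega>)\<^sup>2 +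
      2 * (1 - g * f) * g * ((D n \<omega> * R n \<omega>) * (f - Z (Suc n) \<omega>)) +
      g\<^sup>2 * ((D n \<omega>)\<^sup>2 * (f\<^sup>2 - 2 * f * Z (Suc n) \<omega> + (Z (Suc n) \<omega>)\<^sup>2))" for \<omega>
    unfolding R_Suc g_def[symmetric] by (simp add: power2_eq_square algebra_simps)
  then have "expectation (\<lambda>\<omega>. (R (Suc n) \<omega>)\<^sup>2) =
      (1 - g * f)\<^sup>2 * r + 2 * (1 - g * f) * g * (c * (f - z1)) + g\<^sup>2 * (p * (f\<^sup>2 - 2 * f * z1 + z2))"
    using E1 E2 int_R2 by (simp add: r_def)
  also have "\<dots> \<le> (1 - g * f)\<^sup>2 * r + g * (\<bar>1 - g * f\<bar> * \<bar>f - z1\<bar> * (p + r)) + g\<^sup>2 * (p * (f\<^sup>2 - 2 * f * z1 + z2))"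
  proof -
    have "expectation (\<lambda>\<omega>. 2 * \<bar>D n \<omega> * R n \<omega>\<bar>) \<le> expectation (\<lambda>\<omega>. (D n \<omega>)\<^sup>2 + (R n \<omega>)\<^sup>2)"
    proof (rule integral_mono)
      show "2 * \<bar>D n \<omega> * R n \<omega>\<bar> \<le> (D n \<omega>)\<^sup>2 + (R n \<omega>)\<^sup>2" for \<omega>
        using sum_squares_bound[of "\<bar>D n \<omega>\<bar>" "\<bar>R n \<omega>\<bar>"] by (simp add: abs_mult mult.assoc)
    qed (use iDR int_D2 int_R2 in auto)
    then have "2 * expectation (\<lambda>\<omega>. \<bar>D n \<omega> * R n \<omega>\<bar>) \<le> p + r"
      using int_D2 int_R2 by (simp add: p_def r_def)
    moreover have "\<bar>c\<bar> \<le> expectation (\<lambda>\<omega>. \<bar>D n \<omega> * R n \<omega>\<bar>)" unfolding c_def by (rule integral_abs_bound)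
    ultimately have c: "2 * \<bar>c\<bar> \<le> p + r" by linarith
    have "2 * (1 - g * f) * g * (c * (f - z1)) = g * ((1 - g * f) * (f - z1) * (2 * c))"
      by (simp only: mult_ac)
    also have "\<dots> \<le> g * \<bar>(1 - g * f) * (f - z1) * (2 * c)\<bar>" using g by (intro mult_left_mono) auto
    also have "\<dots> = g * (\<bar>1 - g * f\<bar> * \<bar>f - z1\<bar> * (2 * \<bar>c\<bar>))" by (simp only: abs_mult abs_numeral)
    also have "\<dots> \<le> g * (\<bar>1 - g * f\<bar> * \<bar>f - z1\<bar> * (p + r))"
      using g c by (intro mult_left_mono) auto
    finally show ?thesis by simp
  qed
  also have "\<dots> = (1 - g * (2 * f - g * f\<^sup>2 - \<bar>1 - g * f\<bar> * \<bar>f - z1\<bar>)) * r +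
      g * ((\<bar>1 - g * f\<bar> * \<bar>f - z1\<bar> + g * (f\<^sup>2 - 2 * f * z1) + g * z2) * p)"
    by (simp add: power2_eq_square algebra_simps)
  finally show ?thesis by (simp add: g_def z1_def z2_def p_def r_def)
qed

lemma remainder_tendsto: "(\<lambda>n. (v n)\<^sup>2 * expectation (\<lambda>\<omega>. (R n \<omega>)\<^sup>2)) \<longlonglongrightarrow> 0"
proof -
  obtain B where B: "\<forall>\<^sub>F n in sequentially. (v n)\<^sup>2 * expectation (\<lambda>\<omega>. (D n \<omega>)\<^sup>2) < B"
    by (rule second_moment_bounded)
  let ?d = "\<lambda>n. \<bar>1 - \<gamma> (Suc n) * f\<bar> * \<bar>f - expectation (Z (Suc n))\<bar>"
  let ?k = "\<lambda>n. ?d n + \<gamma> (Suc n) * (f\<^sup>2 - 2 * f * expectation (Z (Suc n))) +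
      \<gamma> (Suc n) * expectation (\<lambda>\<omega>. (Z (Suc n) \<omega>)\<^sup>2)"
  note lims = LIMSEQ_Suc[OF EZ] LIMSEQ_Suc[OF EZ2] LIMSEQ_Suc[OF \<gamma>(2)]
  have d: "?d \<longlonglongrightarrow> \<bar>1 - 0 * f\<bar> * \<bar>f - f\<bar>" by (intro tendsto_intros lims)
  then have "?k \<longlonglongrightarrow> \<bar>1 - 0 * f\<bar> * \<bar>f - f\<bar> + 0 * (f\<^sup>2 - 2 * f * f) + 0" by (intro tendsto_intros lims)
  then have k: "?k \<longlonglongrightarrow> 0" by simp
  have q: "(\<lambda>n. 2 * f - \<gamma> (Suc n) * f\<^sup>2 - ?d n) \<longlonglongrightarrow> 2 * f - 0 * f\<^sup>2 - \<bar>1 - 0 * f\<bar> * \<bar>f - f\<bar>"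
    by (intro tendsto_intros lims d)
  have e: "(\<lambda>n. (v (Suc n))\<^sup>2 * (?k n * expectation (\<lambda>\<omega>. (D n \<omega>)\<^sup>2))) \<longlonglongrightarrow> 0"
  proof -
    have r: "(\<lambda>n. (v (Suc n) / v n)\<^sup>2 * ?k n) \<longlonglongrightarrow> 1\<^sup>2 * 0"
      by (intro tendsto_intros growth_rate_ratio[OF v \<gamma>(1,2)] k)
    have "(\<lambda>n. ((v (Suc n) / v n)\<^sup>2 * ?k n) * ((v n)\<^sup>2 * expectation (\<lambda>\<omega>. (D n \<omega>)\<^sup>2))) \<longlonglongrightarrow> 0"
    proof (rule lim_null_mult_right_bounded[where B = B])
      show "(\<lambda>n. (v (Suc n) / v n)\<^sup>2 * ?k n) \<longlonglongrightarrow> 0" using r by simp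
      show "\<forall>\<^sub>F n in sequentially. norm ((v n)\<^sup>2 * expectation (\<lambda>\<omega>. (D n \<omega>)\<^sup>2)) \<le> B"
        using B by eventually_elim (auto simp: abs_mult)
    qed
    then show ?thesis
    proof (rule Lim_transform_eventually)
      show "\<forall>\<^sub>F n in sequentially. ((v (Suc n) / v n)\<^sup>2 * ?k n) * ((v n)\<^sup>2 * expectation (\<lambda>\<omega>. (D n \<omega>)\<^sup>2)) =
          (v (Suc n))\<^sup>2 * (?k n * expectation (\<lambda>\<omega>. (D n \<omega>)\<^sup>2))"
        using eventually_ge_at_top[of 1]
      proof eventually_elim
        case (elim n)
        then have "v n \<noteq> 0" using v by (auto simp: growth_rate_def less_imp_neq[symmetric])
        then show ?case by (simp add: power_divide)
      qed
    qed
  qed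
  show ?thesis
  proof (rule order_tendstoI)
    fix y :: real assume "0 < y"
    then show "\<forall>\<^sub>F n in sequentially. (v n)\<^sup>2 * expectation (\<lambda>\<omega>. (R n \<omega>)\<^sup>2) < y"
      by (intro weighted_recursion_limsup[OF _ rate2 \<gamma> q _ e])
         (use remainder_rec \<zeta> in auto)
  next
    fix y :: real assume "y < 0"
    then show "\<forall>\<^sub>F n in sequentially. y < (v n)\<^sup>2 * expectation (\<lambda>\<omega>. (R n \<omega>)\<^sup>2)"
      by (intro always_eventually allI) (auto intro: less_le_trans)
  qed
qed

lemma bias_tendsto: "(\<lambda>n. v n * b n) \<longlonglongrightarrow> \<beta> / (f - \<zeta>)"
  by (rule weighted_recursion_tendsto[OF _ v \<gamma> tendsto_const \<zeta> LIMSEQ_Suc[OF E\<eta>]]) simp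

definition w :: "nat \<Rightarrow> real" where
  "w n = expectation (\<lambda>\<omega>. (\<eta> n \<omega> - expectation (\<eta> n))\<^sup>2)"

text \<open>The variance of \<open>S n\<close> (see \<open>V_eq\<close>), defined by the recursion that it obeys.\<close>

primrec V :: "nat \<Rightarrow> real" where
  "V 0 = 0"
| "V (Suc n) = (1 - \<gamma> (Suc n) * f)\<^sup>2 * V n + (\<gamma> (Suc n))\<^sup>2 * w (Suc n)"

lemma w_eq: "n \<ge> 1 \<Longrightarrow> w n = expectation (\<lambda>\<omega>. (\<eta> n \<omega>)\<^sup>2) - (expectation (\<eta> n))\<^sup>2"
  unfolding w_def using int_Z_\<eta> int_\<eta>2 by (intro variance_eq) auto

lemma noise_variance_tendsto: "(\<lambda>n. (v n)\<^sup>2 * (\<gamma> n * w n)) \<longlonglongrightarrow> \<tau>"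
proof -
  have "(\<lambda>n. (v n)\<^sup>2 * \<gamma> n * expectation (\<lambda>\<omega>. (\<eta> n \<omega>)\<^sup>2) - (v n * expectation (\<eta> n))\<^sup>2 * \<gamma> n) \<longlonglongrightarrow> \<tau> - \<beta>\<^sup>2 * 0"
    by (intro tendsto_intros E\<eta> E\<eta>2 \<gamma>)
  then have "(\<lambda>n. (v n)\<^sup>2 * \<gamma> n * expectation (\<lambda>\<omega>. (\<eta> n \<omega>)\<^sup>2) - (v n * expectation (\<eta> n))\<^sup>2 * \<gamma> n) \<longlonglongrightarrow> \<tau>" by simp
  moreover have "\<forall>\<^sub>F n in sequentially.
      (v n)\<^sup>2 * \<gamma> n * expectation (\<lambda>\<omega>. (\<eta> n \<omega>)\<^sup>2) - (v n * expectation (\<eta> n))\<^sup>2 * \<gamma> n = (v n)\<^sup>2 * (\<gamma> n * w n)"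
    using eventually_ge_at_top[of 1] by eventually_elim (simp add: w_eq power_mult_distrib algebra_simps)
  ultimately show ?thesis by (rule Lim_transform_eventually)
qed

lemma V_tendsto: "(\<lambda>n. (v n)\<^sup>2 * V n) \<longlonglongrightarrow> \<tau> / (2 * (f - \<zeta>))"
proof -
  have q: "(\<lambda>n. 2 * f - \<gamma> (Suc n) * f\<^sup>2) \<longlonglongrightarrow> 2 * f - 0 * f\<^sup>2"
    by (intro tendsto_intros LIMSEQ_Suc[OF \<gamma>(2)])
  have "(\<lambda>n. (v n)\<^sup>2 * V n) \<longlonglongrightarrow> \<tau> / (2 * f - 0 * f\<^sup>2 - 2 * \<zeta>)"
    by (rule weighted_recursion_tendsto[OF _ rate2 \<gamma> q _ LIMSEQ_Suc[OF noise_variance_tendsto]])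
       (use \<zeta> in \<open>auto simp: power2_eq_square algebra_simps\<close>)
  then show ?thesis by (simp add: right_diff_distrib)
qed

lemma V_eq: "V n = expectation (\<lambda>\<omega>. (S n \<omega>)\<^sup>2)"
proof (induction n)
  case (Suc n)
  define g where "g = \<gamma> (Suc n)"
  let ?e = "\<lambda>\<omega>. \<eta> (Suc n) \<omega> - expectation (\<eta> (Suc n))"
  have ie: "integrable M ?e" "integrable M (\<lambda>\<omega>. (?e \<omega>)\<^sup>2)"
    using int_Z_\<eta> int_\<eta>2 by (auto intro!: integrable_prod_squares)
  have E: "expectation (\<lambda>\<omega>. S n \<omega> * ?e \<omega>) = 0" "integrable M (\<lambda>\<omega>. S n \<omega> * ?e \<omega>)"
    using expectation_next[of "\<lambda>d s. s" "\<lambda>z e. e - expectation (\<eta> (Suc n))" n] int_D_S ie int_Z_\<eta>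
    by (auto simp: prob_space)
  have "(S (Suc n) \<omega>)\<^sup>2 = (1 - g * f)\<^sup>2 * (S n \<omega>)\<^sup>2 + 2 * (1 - g * f) * g * (S n \<omega> * ?e \<omega>) + g\<^sup>2 * (?e \<omega>)\<^sup>2" for \<omega>
    by (simp add: g_def power2_eq_square algebra_simps)
  then have "expectation (\<lambda>\<omega>. (S (Suc n) \<omega>)\<^sup>2) = (1 - g * f)\<^sup>2 * expectation (\<lambda>\<omega>. (S n \<omega>)\<^sup>2) + g\<^sup>2 * w (Suc n)"
    using E ie int_S2 by (simp add: w_def del: S.simps)
  then show ?case by (simp add: Suc g_def)
qed simp

end

lemma char_distr_shift:
  assumes "prob_space M" and [measurable]: "X \<in> borel_measurable M"
  shows "char (distr M borel (\<lambda>\<omega>. X \<omega> + c)) t = char (distr M borel X) t * iexp (t * c)"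
proof -
  have "char (distr M borel (\<lambda>\<omega>. X \<omega> + c)) t = (CLINT \<omega>|M. iexp (t * X \<omega>) * iexp (t * c))"
    by (simp add: char_def integral_distr exp_add[symmetric] algebra_simps)
  then show ?thesis by (simp add: char_def integral_distr)
qed

lemma cube_sum_le:
  fixes x y :: real
  assumes "0 \<le> x" "0 \<le> y"
  shows "(x + y) ^ 3 \<le> 4 * (x ^ 3 + y ^ 3)"
proof -
  have "0 \<le> 3 * (x + y) * (x - y)\<^sup>2" using assms by simp
  then show ?thesis by (simp add: power3_eq_cube power2_eq_square algebra_simps)
qed

lemma abs_diff_cube_le:
  fixes x y :: real
  shows "\<bar>x - y\<bar> ^ 3 \<le> 4 * (\<bar>x\<bar> ^ 3 + \<bar>y\<bar> ^ 3)"
proof -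
  have "\<bar>x - y\<bar> ^ 3 \<le> (\<bar>x\<bar> + \<bar>y\<bar>) ^ 3" by (intro power_mono) auto
  also have "\<dots> \<le> 4 * (\<bar>x\<bar> ^ 3 + \<bar>y\<bar> ^ 3)" by (rule cube_sum_le) auto
  finally show ?thesis .
qed

lemma norm_mult_diff_le:
  fixes a b c d :: complex
  assumes "cmod b \<le> 1" "cmod c \<le> 1"
  shows "cmod (a * b - c * d) \<le> cmod (a - c) + cmod (b - d)"
proof -
  have "a * b - c * d = (a - c) * b + c * (b - d)" by (simp add: algebra_simps)
  then have "cmod (a * b - c * d) \<le> cmod (a - c) * cmod b + cmod c * cmod (b - d)"
    by (metis norm_mult norm_triangle_ineq)
  also have "\<dots> \<le> cmod (a - c) * 1 + 1 * cmod (b - d)"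
    using assms by (intro add_mono mult_left_mono mult_right_mono) auto
  finally show ?thesis by simp
qed

context linear_recursion
begin

definition m3 :: "nat \<Rightarrow> real" where
  "m3 n = expectation (\<lambda>\<omega>. \<bar>\<eta> n \<omega> - expectation (\<eta> n)\<bar> ^ 3)"

lemma int_centered3:
  assumes "n \<ge> 1" shows "integrable M (\<lambda>\<omega>. \<bar>\<eta> n \<omega> - expectation (\<eta> n)\<bar> ^ 3)"
proof -
  have [measurable]: "\<eta> n \<in> borel_measurable M" using assms by measurable
  show ?thesis
  proof (rule Bochner_Integration.integrable_bound)
    show "integrable M (\<lambda>\<omega>. 4 * (\<bar>\<eta> n \<omega>\<bar> ^ 3 + \<bar>expectation (\<eta> n)\<bar> ^ 3))"
      using int_\<eta>3[OF assms] by auto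
    show "AE \<omega> in M. norm (\<bar>\<eta> n \<omega> - expectation (\<eta> n)\<bar> ^ 3) \<le> norm (4 * (\<bar>\<eta> n \<omega>\<bar> ^ 3 + \<bar>expectation (\<eta> n)\<bar> ^ 3))"
      using abs_diff_cube_le by (intro AE_I2) (auto simp: abs_of_nonneg)
  qed measurable
qed

lemma m3_tendsto: "(\<lambda>n. v n ^ 3 * ((\<gamma> n)\<^sup>2 * m3 n)) \<longlonglongrightarrow> 0"
proof (rule tendsto_sandwich)
  have vpos: "0 < v n" if "n \<ge> 1" for n using v that by (simp add: growth_rate_def)
  show "\<forall>\<^sub>F n in sequentially. 0 \<le> v n ^ 3 * ((\<gamma> n)\<^sup>2 * m3 n)"
    using eventually_ge_at_top[of 1]
  proof eventually_elim
    case (elim n)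
    then show ?case using vpos[of n] by (simp add: m3_def)
  qed
  show "\<forall>\<^sub>F n in sequentially. v n ^ 3 * ((\<gamma> n)\<^sup>2 * m3 n) \<le>
      4 * (v n ^ 3 * (\<gamma> n)\<^sup>2 * expectation (\<lambda>\<omega>. \<bar>\<eta> n \<omega>\<bar> ^ 3) + \<bar>v n * expectation (\<eta> n)\<bar> ^ 3 * (\<gamma> n)\<^sup>2)"
    using eventually_ge_at_top[of 1]
  proof eventually_elim
    case (elim n)
    have "m3 n \<le> expectation (\<lambda>\<omega>. 4 * (\<bar>\<eta> n \<omega>\<bar> ^ 3 + \<bar>expectation (\<eta> n)\<bar> ^ 3))"
      unfolding m3_def using int_\<eta>3[OF elim]
      by (intro integral_mono int_centered3 elim abs_diff_cube_le) auto
    also have "\<dots> = 4 * (expectation (\<lambda>\<omega>. \<bar>\<eta> n \<omega>\<bar> ^ 3) + \<bar>expectation (\<eta> n)\<bar> ^ 3)"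
      using int_\<eta>3[OF elim] by (simp add: prob_space)
    finally have "v n ^ 3 * ((\<gamma> n)\<^sup>2 * m3 n) \<le>
        v n ^ 3 * ((\<gamma> n)\<^sup>2 * (4 * (expectation (\<lambda>\<omega>. \<bar>\<eta> n \<omega>\<bar> ^ 3) + \<bar>expectation (\<eta> n)\<bar> ^ 3)))"
      using vpos[OF elim] by (intro mult_left_mono) auto
    also have "\<dots> = 4 * (v n ^ 3 * (\<gamma> n)\<^sup>2 * expectation (\<lambda>\<omega>. \<bar>\<eta> n \<omega>\<bar> ^ 3) + \<bar>v n * expectation (\<eta> n)\<bar> ^ 3 * (\<gamma> n)\<^sup>2)"
      using vpos[OF elim] by (simp add: abs_mult power_mult_distrib algebra_simps)
    finally show ?case .
  qed
  have "(\<lambda>n. 4 * (v n ^ 3 * (\<gamma> n)\<^sup>2 * expectation (\<lambda>\<omega>. \<bar>\<eta> n \<omega>\<bar> ^ 3) + \<bar>v n * expectation (\<eta> n)\<bar> ^ 3 * (\<gamma> n)\<^sup>2))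
      \<longlonglongrightarrow> 4 * (0 + \<bar>\<beta>\<bar> ^ 3 * 0\<^sup>2)"
    by (intro tendsto_intros E\<eta> E\<eta>3 \<gamma>)
  then show "(\<lambda>n. 4 * (v n ^ 3 * (\<gamma> n)\<^sup>2 * expectation (\<lambda>\<omega>. \<bar>\<eta> n \<omega>\<bar> ^ 3) + \<bar>v n * expectation (\<eta> n)\<bar> ^ 3 * (\<gamma> n)\<^sup>2))
      \<longlonglongrightarrow> 0" by simp
qed simp

text \<open>\<open>T\<close> and \<open>Q\<close> accumulate the errors of the Gaussian approximation of the single noise terms. They contract with the third
and fourth power of \<open>1 - \<gamma> f\<close>, in accordance with the factors \<open>\<bar>t\<bar>^3\<close> and \<open>t^4\<close> which they multiply in
\<open>char_S_approx\<close>.\<close>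

primrec T :: "nat \<Rightarrow> real" where
  "T 0 = 0"
| "T (Suc n) = \<bar>1 - \<gamma> (Suc n) * f\<bar> ^ 3 * T n + \<gamma> (Suc n) ^ 3 * m3 (Suc n)"

primrec Q :: "nat \<Rightarrow> real" where
  "Q 0 = 0"
| "Q (Suc n) = (1 - \<gamma> (Suc n) * f) ^ 4 * Q n + \<gamma> (Suc n) ^ 4 * (w (Suc n))\<^sup>2"

lemma T_tendsto: "(\<lambda>n. v n ^ 3 * T n) \<longlonglongrightarrow> 0"
proof -
  have q: "(\<lambda>n. 3 * f - 3 * \<gamma> (Suc n) * f\<^sup>2 + (\<gamma> (Suc n))\<^sup>2 * f ^ 3) \<longlonglongrightarrow> 3 * f - 3 * 0 * f\<^sup>2 + 0\<^sup>2 * f ^ 3"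
    by (intro tendsto_intros LIMSEQ_Suc[OF \<gamma>(2)])
  have "(\<lambda>n. \<gamma> (Suc n) * f) \<longlonglongrightarrow> 0 * f" by (intro tendsto_intros LIMSEQ_Suc[OF \<gamma>(2)])
  then have "\<forall>\<^sub>F n in sequentially. \<gamma> (Suc n) * f < 1" by (intro order_tendstoD) auto
  then have rec: "\<forall>\<^sub>F n in sequentially. T (Suc n) =
      (1 - \<gamma> (Suc n) * (3 * f - 3 * \<gamma> (Suc n) * f\<^sup>2 + (\<gamma> (Suc n))\<^sup>2 * f ^ 3)) * T n +
      \<gamma> (Suc n) * ((\<gamma> (Suc n))\<^sup>2 * m3 (Suc n))"
    by eventually_elim (simp add: abs_of_pos power3_eq_cube power2_eq_square algebra_simps)
  have "growth_rate \<gamma> (\<lambda>n. v n ^ 3) (3 * \<zeta>)" using growth_rate_power[OF v \<gamma>(1,2), of 3] by simp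
  from weighted_recursion_tendsto[OF rec this \<gamma> q _ LIMSEQ_Suc[OF m3_tendsto]] \<zeta>
  show ?thesis by simp
qed

lemma Q_tendsto: "(\<lambda>n. v n ^ 4 * Q n) \<longlonglongrightarrow> 0"
proof -
  have q: "(\<lambda>n. 4 * f - 6 * \<gamma> (Suc n) * f\<^sup>2 + 4 * (\<gamma> (Suc n))\<^sup>2 * f ^ 3 - \<gamma> (Suc n) ^ 3 * f ^ 4)
      \<longlonglongrightarrow> 4 * f - 6 * 0 * f\<^sup>2 + 4 * 0\<^sup>2 * f ^ 3 - 0 ^ 3 * f ^ 4"
    by (intro tendsto_intros LIMSEQ_Suc[OF \<gamma>(2)])
  have rec: "Q (Suc n) =
      (1 - \<gamma> (Suc n) * (4 * f - 6 * \<gamma> (Suc n) * f\<^sup>2 + 4 * (\<gamma> (Suc n))\<^sup>2 * f ^ 3 - \<gamma> (Suc n) ^ 3 * f ^ 4)) * Q n +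
      \<gamma> (Suc n) * (\<gamma> (Suc n) ^ 3 * (w (Suc n))\<^sup>2)" for n
    by (simp add: power4_eq_xxxx power3_eq_cube power2_eq_square algebra_simps)
  have "(\<lambda>n. ((v n)\<^sup>2 * (\<gamma> n * w n))\<^sup>2 * \<gamma> n) \<longlonglongrightarrow> \<tau>\<^sup>2 * 0" by (intro tendsto_intros noise_variance_tendsto \<gamma>)
  then have e: "(\<lambda>n. v n ^ 4 * (\<gamma> n ^ 3 * (w n)\<^sup>2)) \<longlonglongrightarrow> 0"
    by (simp add: power4_eq_xxxx power3_eq_cube power2_eq_square mult_ac)
  have "growth_rate \<gamma> (\<lambda>n. v n ^ 4) (4 * \<zeta>)" using growth_rate_power[OF v \<gamma>(1,2), of 4] by simp
  from weighted_recursion_tendsto[OF always_eventually[OF allI[OF rec]] this \<gamma> q _ LIMSEQ_Suc[OF e]] \<zeta>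
  show ?thesis by simp
qed

text \<open>Lyapunov's theorem, one step at a time: the characteristic functions of \<open>S (Suc n)\<close> and of its Gaussian counterpart both
factor into a rescaled copy of stage \<open>n\<close> and a contribution of the new noise term, so the errors add up.\<close>

lemma char_S_approx:
  "cmod (char (distr M borel (S n)) t - complex_of_real (exp (- (t\<^sup>2 * V n / 2)))) \<le> \<bar>t\<bar> ^ 3 * T n + t ^ 4 * Q n"
proof (induction n arbitrary: t)
  case 0
  have "distr M borel (S 0) = return borel 0"
    using distr_const[of 0 borel] by (simp add: S.simps(1)[abs_def])
  then show ?case by (simp add: char_def integral_return)
next
  case (Suc n)
  define g c where "g = \<gamma> (Suc n)" and "c = 1 - g * f"
  define e where "e \<omega> = \<eta> (Suc n) \<omega> - expectation (\<eta> (Suc n))" for \<omega>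
  have [measurable]: "e \<in> borel_measurable M" unfolding e_def[abs_def] by measurable
  have "indep_var borel (\<lambda>\<omega>. c * S n \<omega>) borel (\<lambda>\<omega>. g * e \<omega>)"
    unfolding e_def using indep_next[of "\<lambda>d s. c * s" "\<lambda>z e. g * (e - expectation (\<eta> (Suc n)))" n] by simp
  from char_distr_add[OF this, of t]
  have split: "char (distr M borel (S (Suc n))) t = char (distr M borel (S n)) (c * t) * char (distr M borel e) (g * t)"
    by (simp add: S.simps(2)[abs_def] char_distr_scale g_def[symmetric] c_def e_def[abs_def])
  have gauss: "complex_of_real (exp (- (t\<^sup>2 * V (Suc n) / 2))) =
      complex_of_real (exp (- ((c * t)\<^sup>2 * V n / 2))) * complex_of_real (exp (- ((g * t)\<^sup>2 * w (Suc n) / 2)))"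
  proof -
    have "V (Suc n) = c\<^sup>2 * V n + g\<^sup>2 * w (Suc n)" by (simp add: c_def g_def)
    then have "- (t\<^sup>2 * V (Suc n) / 2) = - ((c * t)\<^sup>2 * V n / 2) + - ((g * t)\<^sup>2 * w (Suc n) / 2)"
      by (simp only: power_mult_distrib) (simp add: field_simps)
    then show ?thesis by (simp only: exp_add of_real_mult)
  qed
  have e_approx: "cmod (char (distr M borel e) (g * t) - complex_of_real (exp (- ((g * t)\<^sup>2 * w (Suc n) / 2))))
      \<le> \<bar>g * t\<bar> ^ 3 * m3 (Suc n) + (g * t) ^ 4 * (w (Suc n))\<^sup>2"
  proof -
    have ie: "integrable M e" "integrable M (\<lambda>\<omega>. (e \<omega>)\<^sup>2)"
      unfolding e_def using int_Z_\<eta> int_\<eta>2 by (auto intro!: integrable_prod_squares)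
    have "integrable M (\<lambda>\<omega>. \<bar>e \<omega>\<bar> ^ 3)" unfolding e_def by (intro int_centered3) auto
    moreover have "expectation e = 0" unfolding e_def using int_Z_\<eta> by (simp add: prob_space)
    ultimately show ?thesis
      using char_centered_approx[of e "g * t"] ie by (simp add: m3_def w_def e_def)
  qed
  have "cmod (char (distr M borel (S n)) (c * t) * char (distr M borel e) (g * t) -
      complex_of_real (exp (- ((c * t)\<^sup>2 * V n / 2))) * complex_of_real (exp (- ((g * t)\<^sup>2 * w (Suc n) / 2))))
    \<le> cmod (char (distr M borel (S n)) (c * t) - complex_of_real (exp (- ((c * t)\<^sup>2 * V n / 2)))) +
      cmod (char (distr M borel e) (g * t) - complex_of_real (exp (- ((g * t)\<^sup>2 * w (Suc n) / 2))))"
  proof (rule norm_mult_diff_le)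
    show "cmod (char (distr M borel e) (g * t)) \<le> 1"
      by (rule real_distribution.cmod_char_le_1) auto
    have "0 \<le> V n" by (simp add: V_eq)
    then show "cmod (complex_of_real (exp (- ((c * t)\<^sup>2 * V n / 2)))) \<le> 1" by simp
  qed
  also have "\<dots> \<le> (\<bar>c * t\<bar> ^ 3 * T n + (c * t) ^ 4 * Q n) + (\<bar>g * t\<bar> ^ 3 * m3 (Suc n) + (g * t) ^ 4 * (w (Suc n))\<^sup>2)"
    by (intro add_mono Suc.IH e_approx)
  also have "\<dots> = \<bar>t\<bar> ^ 3 * T (Suc n) + t ^ 4 * Q (Suc n)"
  proof -
    have "0 < g" using \<gamma>(1) by (simp add: g_def)
    then have "\<bar>g\<bar> = g" by simp
    moreover have "T (Suc n) = \<bar>c\<bar> ^ 3 * T n + g ^ 3 * m3 (Suc n)" "Q (Suc n) = c ^ 4 * Q n + g ^ 4 * (w (Suc n))\<^sup>2"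
      by (simp_all add: c_def g_def)
    ultimately show ?thesis by (simp add: abs_mult power_mult_distrib algebra_simps del: T.simps Q.simps)
  qed
  finally show ?case unfolding split gauss .
qed

text \<open>The statement includes the degenerate case \<open>\<tau> = 0\<close>, where the limit is a point mass.\<close>

lemma char_scaled_tendsto:
  "(\<lambda>n. char (distr M borel (\<lambda>\<omega>. v n * D n \<omega>)) t) \<longlonglongrightarrow>
     iexp (t * (\<beta> / (f - \<zeta>))) * complex_of_real (exp (- (\<tau> / (2 * (f - \<zeta>)) * t\<^sup>2 / 2)))"
proof -
  let ?lin = "\<lambda>n \<omega>. v n * S n \<omega> + v n * b n"
  let ?err = "\<lambda>n. \<bar>v n * t\<bar> ^ 3 * T n + (v n * t) ^ 4 * Q n"
  have gauss: "(\<lambda>n. char (distr M borel (S n)) (v n * t)) \<longlonglongrightarrow>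
      complex_of_real (exp (- (t\<^sup>2 * (\<tau> / (2 * (f - \<zeta>))) / 2)))"
  proof (rule LIM_zero_cancel)
    show "(\<lambda>n. char (distr M borel (S n)) (v n * t) -
        complex_of_real (exp (- (t\<^sup>2 * (\<tau> / (2 * (f - \<zeta>))) / 2)))) \<longlonglongrightarrow> 0"
    proof -
      have "(\<lambda>n. \<bar>t\<bar> ^ 3 * (v n ^ 3 * T n) + t ^ 4 * (v n ^ 4 * Q n)) \<longlonglongrightarrow> \<bar>t\<bar> ^ 3 * 0 + t ^ 4 * 0"
        by (intro tendsto_intros T_tendsto Q_tendsto)
      moreover have "\<forall>\<^sub>F n in sequentially. \<bar>t\<bar> ^ 3 * (v n ^ 3 * T n) + t ^ 4 * (v n ^ 4 * Q n) = ?err n"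
        using eventually_ge_at_top[of 1]
      proof eventually_elim
        case (elim n)
        then have "0 < v n" using v by (auto simp: growth_rate_def)
        then show ?case by (simp add: abs_mult power_mult_distrib)
      qed
      ultimately have err: "?err \<longlonglongrightarrow> 0" by (simp add: tendsto_cong)
      have 1: "(\<lambda>n. char (distr M borel (S n)) (v n * t) - complex_of_real (exp (- ((v n * t)\<^sup>2 * V n / 2)))) \<longlonglongrightarrow> 0"
        by (rule Lim_null_comparison[OF always_eventually[OF allI[OF char_S_approx]] err])
      have "(\<lambda>n. complex_of_real (exp (- (t\<^sup>2 * ((v n)\<^sup>2 * V n) / 2)))) \<longlonglongrightarrow>
          complex_of_real (exp (- (t\<^sup>2 * (\<tau> / (2 * (f - \<zeta>))) / 2)))"
        by (intro tendsto_intros V_tendsto) simp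
      then have 2: "(\<lambda>n. complex_of_real (exp (- ((v n * t)\<^sup>2 * V n / 2)))) \<longlonglongrightarrow>
          complex_of_real (exp (- (t\<^sup>2 * (\<tau> / (2 * (f - \<zeta>))) / 2)))"
        by (simp only: power_mult_distrib mult.assoc mult.left_commute[of "(v _)\<^sup>2" "t\<^sup>2"])
      then show ?thesis using tendsto_add[OF 1 LIM_zero[OF 2]] by simp
    qed
  qed
  have lin_char: "char (distr M borel (?lin n)) t = char (distr M borel (S n)) (v n * t) * iexp (t * (v n * b n))" for n
  proof -
    have "char (distr M borel (?lin n)) t = char (distr M borel (\<lambda>\<omega>. v n * S n \<omega>)) t * iexp (t * (v n * b n))"
      by (rule char_distr_shift) (auto intro: prob_space_axioms)
    then show ?thesis by (simp add: char_distr_scale)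
  qed
  have "(\<lambda>n. char (distr M borel (?lin n)) t) \<longlonglongrightarrow>
      complex_of_real (exp (- (t\<^sup>2 * (\<tau> / (2 * (f - \<zeta>))) / 2))) * iexp (t * (\<beta> / (f - \<zeta>)))"
    unfolding lin_char by (intro tendsto_intros gauss bias_tendsto)
  moreover have "(\<lambda>n. char (distr M borel (\<lambda>\<omega>. v n * D n \<omega>)) t - char (distr M borel (?lin n)) t) \<longlonglongrightarrow> 0"
  proof (rule Lim_null_comparison)
    have "(\<lambda>n. \<bar>t\<bar> * sqrt ((v n)\<^sup>2 * expectation (\<lambda>\<omega>. (R n \<omega>)\<^sup>2))) \<longlonglongrightarrow> \<bar>t\<bar> * sqrt 0"
      by (intro tendsto_intros remainder_tendsto)
    then show "(\<lambda>n. \<bar>t\<bar> * sqrt ((v n)\<^sup>2 * expectation (\<lambda>\<omega>. (R n \<omega>)\<^sup>2))) \<longlonglongrightarrow> 0" by simp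
    show "\<forall>\<^sub>F n in sequentially. cmod (char (distr M borel (\<lambda>\<omega>. v n * D n \<omega>)) t - char (distr M borel (?lin n)) t)
        \<le> \<bar>t\<bar> * sqrt ((v n)\<^sup>2 * expectation (\<lambda>\<omega>. (R n \<omega>)\<^sup>2))"
    proof (intro always_eventually allI)
      fix n
      have eq: "(v n * D n \<omega> - ?lin n \<omega>)\<^sup>2 = (v n)\<^sup>2 * (R n \<omega>)\<^sup>2" for \<omega>
        unfolding power_mult_distrib[symmetric] by (simp add: R_def algebra_simps)
      show "cmod (char (distr M borel (\<lambda>\<omega>. v n * D n \<omega>)) t - char (distr M borel (?lin n)) t)
        \<le> \<bar>t\<bar> * sqrt ((v n)\<^sup>2 * expectation (\<lambda>\<omega>. (R n \<omega>)\<^sup>2))"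
        using cmod_char_diff_le[of "\<lambda>\<omega>. v n * D n \<omega>" "?lin n" t] int_R2[of n] unfolding eq by simp
    qed
  qed
  ultimately have "(\<lambda>n. (char (distr M borel (\<lambda>\<omega>. v n * D n \<omega>)) t - char (distr M borel (?lin n)) t) +
      char (distr M borel (?lin n)) t) \<longlonglongrightarrow>
      0 + complex_of_real (exp (- (t\<^sup>2 * (\<tau> / (2 * (f - \<zeta>))) / 2))) * iexp (t * (\<beta> / (f - \<zeta>)))"
    by (intro tendsto_add)
  then show ?thesis by (simp add: mult.commute)
qed

theorem asymptotic_normality:
  assumes "0 < \<tau>"
  shows "weak_conv_m (\<lambda>n. distr M borel (\<lambda>\<omega>. v n * D n \<omega>))
    (density lborel (\<lambda>y. ennreal (normal_density (\<beta> / (f - \<zeta>)) (sqrt (\<tau> / (2 * (f - \<zeta>)))) y)))"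
proof -
  have pos: "0 < \<tau> / (2 * (f - \<zeta>))" using assms \<zeta> by simp
  show ?thesis
  proof (rule levy_continuity)
    show "real_distribution (distr M borel (\<lambda>\<omega>. v n * D n \<omega>))" for n by auto
    show "real_distribution (density lborel
        (\<lambda>y. ennreal (normal_density (\<beta> / (f - \<zeta>)) (sqrt (\<tau> / (2 * (f - \<zeta>)))) y)))"
      using prob_space_normal_density[of "sqrt (\<tau> / (2 * (f - \<zeta>)))"] pos
      by (auto simp: real_distribution_def real_distribution_axioms_def)
    show "(\<lambda>n. char (distr M borel (\<lambda>\<omega>. v n * D n \<omega>)) t) \<longlonglongrightarrow>
       char (density lborel (\<lambda>y. ennreal (normal_density (\<beta> / (f - \<zeta>)) (sqrt (\<tau> / (2 * (f - \<zeta>)))) y))) t" for t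
      using char_scaled_tendsto[of t] pos by (simp add: char_normal_density)
  qed
qed

theorem convergence_in_probability:
  assumes "\<tau> = 0" "0 < \<epsilon>"
  shows "(\<lambda>n. prob {\<omega> \<in> space M. \<bar>v n * D n \<omega> - \<beta> / (f - \<zeta>)\<bar> > \<epsilon>}) \<longlonglongrightarrow> 0"
proof -
  define \<mu> where "\<mu> = \<beta> / (f - \<zeta>)"
  let ?bnd = "\<lambda>n. 3 * ((v n)\<^sup>2 * expectation (\<lambda>\<omega>. (R n \<omega>)\<^sup>2) + (v n)\<^sup>2 * V n + (v n * b n - \<mu>)\<^sup>2) / \<epsilon>\<^sup>2"
  have bound: "prob {\<omega> \<in> space M. \<bar>v n * D n \<omega> - \<mu>\<bar> > \<epsilon>} \<le> ?bnd n" for n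
  proof -
    have int: "integrable M (\<lambda>\<omega>. (v n * D n \<omega> - \<mu>)\<^sup>2)"
    proof (rule integrable_prod_squares)
      show "integrable M (\<lambda>\<omega>. (v n * D n \<omega>)\<^sup>2)" using int_D2[of n] by (simp add: power_mult_distrib)
    qed auto
    have "prob {\<omega> \<in> space M. \<bar>v n * D n \<omega> - \<mu>\<bar> > \<epsilon>} \<le> prob {\<omega> \<in> space M. (v n * D n \<omega> - \<mu>)\<^sup>2 \<ge> \<epsilon>\<^sup>2}"
    proof (rule finite_measure_mono)
      show "{\<omega> \<in> space M. \<bar>v n * D n \<omega> - \<mu>\<bar> > \<epsilon>} \<subseteq> {\<omega> \<in> space M. (v n * D n \<omega> - \<mu>)\<^sup>2 \<ge> \<epsilon>\<^sup>2}"
        using assms(2) by (auto intro!: abs_le_square_iff[THEN iffD1])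
    qed measurable
    also have "\<dots> \<le> expectation (\<lambda>\<omega>. (v n * D n \<omega> - \<mu>)\<^sup>2) / \<epsilon>\<^sup>2"
      using integral_Markov_inequality_measure[OF int, of "space M" "\<epsilon>\<^sup>2"] assms(2) by simp
    also have "expectation (\<lambda>\<omega>. (v n * D n \<omega> - \<mu>)\<^sup>2) \<le>
        expectation (\<lambda>\<omega>. 3 * ((v n)\<^sup>2 * (R n \<omega>)\<^sup>2 + (v n)\<^sup>2 * (S n \<omega>)\<^sup>2 + (v n * b n - \<mu>)\<^sup>2))"
    proof (rule integral_mono[OF int])
      show "integrable M (\<lambda>\<omega>. 3 * ((v n)\<^sup>2 * (R n \<omega>)\<^sup>2 + (v n)\<^sup>2 * (S n \<omega>)\<^sup>2 + (v n * b n - \<mu>)\<^sup>2))"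
        using int_R2 int_S2 by auto
      fix \<omega>
      have sq3: "(x + y + z)\<^sup>2 \<le> 3 * (x\<^sup>2 + y\<^sup>2 + z\<^sup>2)" for x y z :: real
      proof -
        have "0 \<le> (x - y)\<^sup>2 + (y - z)\<^sup>2 + (x - z)\<^sup>2" by simp
        then show ?thesis by (simp add: power2_eq_square algebra_simps)
      qed
      show "(v n * D n \<omega> - \<mu>)\<^sup>2 \<le> 3 * ((v n)\<^sup>2 * (R n \<omega>)\<^sup>2 + (v n)\<^sup>2 * (S n \<omega>)\<^sup>2 + (v n * b n - \<mu>)\<^sup>2)"
      proof -
        have "v n * D n \<omega> - \<mu> = v n * R n \<omega> + v n * S n \<omega> + (v n * b n - \<mu>)"
          by (simp add: R_def algebra_simps)
        then show ?thesis
          using sq3[of "v n * R n \<omega>" "v n * S n \<omega>" "v n * b n - \<mu>"] by (simp only: power_mult_distrib)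
      qed
    qed
    also have "\<dots> = 3 * ((v n)\<^sup>2 * expectation (\<lambda>\<omega>. (R n \<omega>)\<^sup>2) + (v n)\<^sup>2 * V n + (v n * b n - \<mu>)\<^sup>2)"
      using int_R2 int_S2 by (simp add: V_eq prob_space)
    finally show ?thesis by (simp add: divide_right_mono)
  qed
  have "?bnd \<longlonglongrightarrow> 3 * (0 + \<tau> / (2 * (f - \<zeta>)) + (\<mu> - \<mu>)\<^sup>2) / \<epsilon>\<^sup>2"
    using assms bias_tendsto by (intro tendsto_intros remainder_tendsto V_tendsto) (auto simp: \<mu>_def)
  then have lim: "?bnd \<longlonglongrightarrow> 0" using assms by simp
  show ?thesis
    using tendsto_sandwich[OF _ _ tendsto_const lim] bound unfolding \<mu>_def[symmetric] by auto
qed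

end

section \<open>Kernel averages and Taylor expansion\<close>

lemma kernel_integral_tendsto:
  fixes k G :: "real \<Rightarrow> real" and h :: "nat \<Rightarrow> real"
  assumes k: "integrable lborel k" and [measurable]: "G \<in> borel_measurable borel"
    and bounded: "\<And>s. \<bar>G s\<bar> \<le> C" and cont: "isCont G x" and h: "h \<longlonglongrightarrow> 0"
  shows "(\<lambda>n. \<integral>z. k z * G (x - h n * z) \<partial>lborel) \<longlonglongrightarrow> G x * (\<integral>z. k z \<partial>lborel)"
proof -
  have [measurable]: "k \<in> borel_measurable borel" using borel_measurable_integrable[OF k] by simp
  have "(\<lambda>n. \<integral>z. k z * G (x - h n * z) \<partial>lborel) \<longlonglongrightarrow> (\<integral>z. k z * G x \<partial>lborel)"
  proof (rule integral_dominated_convergence)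
    show "integrable lborel (\<lambda>z. C * \<bar>k z\<bar>)" using k by auto
    show "AE z in lborel. (\<lambda>n. k z * G (x - h n * z)) \<longlonglongrightarrow> k z * G x"
    proof (rule AE_I2)
      fix z
      have "(\<lambda>n. x - h n * z) \<longlonglongrightarrow> x - 0 * z" by (intro tendsto_intros h)
      then have "(\<lambda>n. G (x - h n * z)) \<longlonglongrightarrow> G x" using isCont_tendsto_compose[OF cont] by simp
      then show "(\<lambda>n. k z * G (x - h n * z)) \<longlonglongrightarrow> k z * G x" by (intro tendsto_intros)
    qed
    show "AE z in lborel. norm (k z * G (x - h n * z)) \<le> C * \<bar>k z\<bar>" for n
    proof (rule AE_I2)
      fix z
      have "\<bar>k z\<bar> * \<bar>G (x - h n * z)\<bar> \<le> \<bar>k z\<bar> * C" by (intro mult_left_mono bounded) auto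
      then show "norm (k z * G (x - h n * z)) \<le> C * \<bar>k z\<bar>" by (simp add: abs_mult mult.commute)
    qed
  qed measurable
  then show ?thesis by (simp add: mult.commute)
qed

text \<open>The weight \<open>\<bar>s - v\<bar>\<close> on the unordered interval between \<open>x\<close> and \<open>s\<close> covers both signs of \<open>s - x\<close>. The antiderivative is
\<open>(s - v) F' v + F v\<close>.\<close>

lemma taylor_integral_remainder:
  fixes F F' F'' :: "real \<Rightarrow> real"
  assumes d1: "\<And>v. (F has_real_derivative F' v) (at v)" and d2: "\<And>v. (F' has_real_derivative F'' v) (at v)"
    and cont: "continuous_on UNIV F''"
  shows "has_bochner_integral lborel (\<lambda>v. indicator {min x s..max x s} v * (\<bar>s - v\<bar> * F'' v))
    (F s - F x - (s - x) * F' x)"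
proof -
  define P where "P v = (s - v) * F' v + F v" for v
  have P: "(P has_real_derivative (s - v) * F'' v) (at v)" for v
    unfolding P_def by (auto intro!: derivative_eq_intros d1 d2)
  have contP: "continuous_on A (\<lambda>v. (s - v) * F'' v)" for A
    by (intro continuous_intros continuous_on_subset[OF cont]) auto
  show ?thesis
  proof (cases "x \<le> s")
    case True
    have "has_bochner_integral lborel (\<lambda>v. indicator {x..s} v *\<^sub>R ((s - v) * F'' v)) (P s - P x)"
      by (rule has_bochner_integral_FTC_Icc[OF True _ contP])
         (auto intro!: has_field_derivative_at_within P simp: has_real_derivative_iff_has_vector_derivative[symmetric])
    moreover have "(\<lambda>v. indicator {x..s} v *\<^sub>R ((s - v) * F'' v)) = (\<lambda>v. indicator {min x s..max x s} v * (\<bar>s - v\<bar> * F'' v))"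
      using True by (auto simp: fun_eq_iff indicator_def min_def max_def)
    moreover have "P s - P x = F s - F x - (s - x) * F' x" by (simp add: P_def)
    ultimately show ?thesis by (simp only:)
  next
    case False
    then have sx: "s \<le> x" by simp
    have "has_bochner_integral lborel (\<lambda>v. indicator {s..x} v *\<^sub>R ((s - v) * F'' v)) (P x - P s)"
      by (rule has_bochner_integral_FTC_Icc[OF sx _ contP])
         (auto intro!: has_field_derivative_at_within P simp: has_real_derivative_iff_has_vector_derivative[symmetric])
    from has_bochner_integral_minus[OF this]
    have "has_bochner_integral lborel (\<lambda>v. - (indicator {s..x} v *\<^sub>R ((s - v) * F'' v))) (P s - P x)" by simp
    moreover have "(\<lambda>v. - (indicator {s..x} v *\<^sub>R ((s - v) * F'' v))) = (\<lambda>v. indicator {min x s..max x s} v * (\<bar>s - v\<bar> * F'' v))"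
      using False by (auto simp: fun_eq_iff indicator_def min_def max_def) (simp add: algebra_simps)
    moreover have "P s - P x = F s - F x - (s - x) * F' x" by (simp add: P_def)
    ultimately show ?thesis by (simp only:)
  qed
qed

text \<open>The previous formula for \<open>F v = v\<^sup>2 / 2\<close>.\<close>

lemma taylor_remainder_weight:
  fixes x s :: real
  shows "has_bochner_integral lborel (\<lambda>v. indicator {min x s..max x s} v * \<bar>s - v\<bar>) ((s - x)\<^sup>2 / 2)"
proof -
  have "has_bochner_integral lborel (\<lambda>v. indicator {min x s..max x s} v * (\<bar>s - v\<bar> * 1)) (s\<^sup>2 / 2 - x\<^sup>2 / 2 - (s - x) * x)"
    by (rule taylor_integral_remainder[where F' = "\<lambda>v. v"]) (auto intro!: derivative_eq_intros)
  moreover have "s\<^sup>2 / 2 - x\<^sup>2 / 2 - (s - x) * x = (s - x)\<^sup>2 / 2"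
    by (simp add: power2_eq_square field_simps)
  ultimately show ?thesis by simp
qed

text \<open>Taylor's formula in \<open>s\<close> for each \<open>t\<close>, integrated against \<open>m\<close>. Fubini's theorem applies because the remainder only involves the
strip of width \<open>\<delta>\<close> around \<open>x\<close>, where \<open>m t * dss p s t\<close> is integrable in both variables. In this way \<open>s \<mapsto> \<integral> m t p s t dt\<close>
obtains a Taylor formula without any differentiation under the integral sign.\<close>

lemma parametric_taylor:
  fixes p :: "real \<Rightarrow> real \<Rightarrow> real" and m :: "real \<Rightarrow> real"
  assumes C2: "\<And>t. twice_cont_diff (\<lambda>s. p s t)"
    and int0: "\<And>s. integrable lborel (\<lambda>t. m t * p s t)"
    and int1: "integrable lborel (\<lambda>t. m t * ds p x t)"
    and int2: "set_integrable (lborel \<Otimes>\<^sub>M lborel) ({x - \<delta>..x + \<delta>} \<times> UNIV) (\<lambda>(s, t). m t * dss p s t)"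
    and s: "\<bar>s - x\<bar> \<le> \<delta>"
  defines "H2 \<equiv> \<lambda>v. \<integral>t. m t * dss p v t \<partial>lborel"
  shows "integrable lborel (\<lambda>v. indicator {min x s..max x s} v * (\<bar>s - v\<bar> * H2 v))"
    and "(\<integral>t. m t * p s t \<partial>lborel) = (\<integral>t. m t * p x t \<partial>lborel) + (s - x) * (\<integral>t. m t * ds p x t \<partial>lborel)
      + (\<integral>v. indicator {min x s..max x s} v * (\<bar>s - v\<bar> * H2 v) \<partial>lborel)"
proof -
  let ?k = "\<lambda>v. indicator {min x s..max x s} v * \<bar>s - v\<bar> :: real"
  let ?J = "\<lambda>v t. ?k v * (m t * dss p v t)"
  have intJ: "integrable (lborel \<Otimes>\<^sub>M lborel) (\<lambda>(v, t). ?J v t)"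
  proof -
    let ?L = "\<lambda>y. indicator ({x - \<delta>..x + \<delta>} \<times> UNIV) y *\<^sub>R (case y of (s, t) \<Rightarrow> m t * dss p s t)"
    have L: "integrable (lborel \<Otimes>\<^sub>M lborel) ?L" using int2 by (simp add: set_integrable_def)
    have "integrable (lborel \<Otimes>\<^sub>M lborel) (\<lambda>y. ?k (fst y) * ?L y)"
    proof (rule Bochner_Integration.integrable_bound[OF integrable_mult_right[OF L, of "\<bar>s - x\<bar>"]])
      have [measurable]: "?L \<in> borel_measurable (lborel \<Otimes>\<^sub>M lborel)" using L by (rule borel_measurable_integrable)
      show "(\<lambda>y. ?k (fst y) * ?L y) \<in> borel_measurable (lborel \<Otimes>\<^sub>M lborel)" by measurable
      show "AE y in lborel \<Otimes>\<^sub>M lborel. norm (?k (fst y) * ?L y) \<le> norm (\<bar>s - x\<bar> * ?L y)"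
      proof (rule AE_I2)
        fix y :: "real \<times> real"
        have "\<bar>?k (fst y)\<bar> \<le> \<bar>s - x\<bar>" by (auto simp: indicator_def min_def max_def split: if_splits)
        then show "norm (?k (fst y) * ?L y) \<le> norm (\<bar>s - x\<bar> * ?L y)"
          unfolding real_norm_def abs_mult[of "?k (fst y)"] abs_mult[of "\<bar>s - x\<bar>"]
            by (intro mult_right_mono) auto
      qed
    qed
    moreover have "(\<lambda>y. ?k (fst y) * ?L y) = (\<lambda>(v, t). ?J v t)"
      using s by (auto simp: fun_eq_iff indicator_def)
    ultimately show ?thesis by simp
  qed
  have d1: "((\<lambda>s. p s t) has_real_derivative ds p v t) (at v)" for v t
    using C2[of t] unfolding twice_cont_diff_def ds_def by (simp add: DERIV_deriv_iff_real_differentiable)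
  have d2: "((\<lambda>v. ds p v t) has_real_derivative dss p v t) (at v)" for v t
  proof -
    have "(\<lambda>v. ds p v t) = deriv (\<lambda>u. p u t)" by (simp add: ds_def fun_eq_iff)
    then show ?thesis
      using C2[of t] unfolding twice_cont_diff_def dss_def by (simp add: DERIV_deriv_iff_real_differentiable)
  qed
  have cont: "continuous_on UNIV (\<lambda>v. dss p v t)" for t
  proof -
    have "(\<lambda>v. dss p v t) = deriv (deriv (\<lambda>u. p u t))" by (simp add: dss_def fun_eq_iff)
    moreover have "continuous_on UNIV (deriv (deriv (\<lambda>u. p u t)))" using C2[of t] by (simp add: twice_cont_diff_def)
    ultimately show ?thesis by metis
  qed
  have taylor: "(\<integral>v. ?J v t \<partial>lborel) = m t * p s t - m t * p x t - (s - x) * (m t * ds p x t)" for t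
  proof -
    have "has_bochner_integral lborel (\<lambda>v. m t * (indicator {min x s..max x s} v * (\<bar>s - v\<bar> * dss p v t)))
        (m t * (p s t - p x t - (s - x) * ds p x t))"
      by (intro has_bochner_integral_mult_right taylor_integral_remainder[OF d1 d2 cont])
    then have "(\<integral>v. m t * (indicator {min x s..max x s} v * (\<bar>s - v\<bar> * dss p v t)) \<partial>lborel) =
        m t * (p s t - p x t - (s - x) * ds p x t)"
      by (rule has_bochner_integral_integral_eq)
    moreover have "(\<lambda>v. m t * (indicator {min x s..max x s} v * (\<bar>s - v\<bar> * dss p v t))) = (\<lambda>v. ?J v t)"
      by (simp add: fun_eq_iff)
    moreover have "m t * (p s t - p x t - (s - x) * ds p x t) = m t * p s t - m t * p x t - (s - x) * (m t * ds p x t)"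
      by (simp add: algebra_simps)
    ultimately show ?thesis by (simp only:)
  qed
  have inner: "(\<integral>t. ?J v t \<partial>lborel) = indicator {min x s..max x s} v * (\<bar>s - v\<bar> * H2 v)" for v
    by (simp add: H2_def mult.assoc)
  show "integrable lborel (\<lambda>v. indicator {min x s..max x s} v * (\<bar>s - v\<bar> * H2 v))"
    using lborel_pair.integrable_fst'[OF intJ] by (simp add: H2_def mult.assoc)
  have "(\<integral>v. (\<integral>t. ?J v t \<partial>lborel) \<partial>lborel) = (\<integral>t. (\<integral>v. ?J v t \<partial>lborel) \<partial>lborel)"
    using lborel_pair.Fubini_integral[OF intJ] by simp
  also have "\<dots> = (\<integral>t. m t * p s t \<partial>lborel) - (\<integral>t. m t * p x t \<partial>lborel) - (s - x) * (\<integral>t. m t * ds p x t \<partial>lborel)"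
    unfolding taylor using int0 int1 by simp
  finally show "(\<integral>t. m t * p s t \<partial>lborel) = (\<integral>t. m t * p x t \<partial>lborel) + (s - x) * (\<integral>t. m t * ds p x t \<partial>lborel)
      + (\<integral>v. indicator {min x s..max x s} v * (\<bar>s - v\<bar> * H2 v) \<partial>lborel)"
    unfolding inner by linarith
qed

lemma peano_remainder:
  fixes H H2 :: "real \<Rightarrow> real"
  assumes \<delta>: "0 < \<delta>"
    and int: "\<And>s. \<bar>s - x\<bar> \<le> \<delta> \<Longrightarrow> integrable lborel (\<lambda>v. indicator {min x s..max x s} v * (\<bar>s - v\<bar> * H2 v))"
    and eq: "\<And>s. \<bar>s - x\<bar> \<le> \<delta> \<Longrightarrow> H s = H x + (s - x) * L + (\<integral>v. indicator {min x s..max x s} v * (\<bar>s - v\<bar> * H2 v) \<partial>lborel)"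
    and cont: "isCont H2 x" and \<epsilon>: "0 < \<epsilon>"
  obtains d where "0 < d" "\<And>s. \<bar>s - x\<bar> < d \<Longrightarrow> \<bar>H s - H x - (s - x) * L - (s - x)\<^sup>2 / 2 * H2 x\<bar> \<le> \<epsilon> * (s - x)\<^sup>2"
proof -
  obtain d0 where d0: "0 < d0" "\<And>v. \<bar>v - x\<bar> < d0 \<Longrightarrow> \<bar>H2 v - H2 x\<bar> < \<epsilon>"
    using cont \<epsilon> unfolding continuous_at_eps_delta dist_real_def by blast
  show ?thesis
  proof (rule that[of "min d0 \<delta>"])
    show "0 < min d0 \<delta>" using d0 \<delta> by simp
    fix s assume s: "\<bar>s - x\<bar> < min d0 \<delta>"
    let ?k = "\<lambda>v. indicator {min x s..max x s} v * \<bar>s - v\<bar> :: real"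
    note w = taylor_remainder_weight[of x s]
    have i1: "integrable lborel (\<lambda>v. ?k v * H2 v)" using int[of s] s by (simp add: mult.assoc)
    have ik: "integrable lborel ?k" using w by (rule integrable.intros)
    have ek: "(\<integral>v. ?k v \<partial>lborel) = (s - x)\<^sup>2 / 2" using w by (rule has_bochner_integral_integral_eq)
    have diff: "H s - H x - (s - x) * L - (s - x)\<^sup>2 / 2 * H2 x = (\<integral>v. ?k v * H2 v \<partial>lborel) - (\<integral>v. ?k v * H2 x \<partial>lborel)"
    proof -
      have "(\<integral>v. ?k v * H2 x \<partial>lborel) = (s - x)\<^sup>2 / 2 * H2 x" unfolding ek[symmetric] by (rule integral_mult_left_zero)
      moreover have "H s = H x + (s - x) * L + (\<integral>v. ?k v * H2 v \<partial>lborel)"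
        using eq[of s] s by (simp only: mult.assoc)
      ultimately show ?thesis by linarith
    qed
    have "(\<integral>v. ?k v * H2 v \<partial>lborel) - (\<integral>v. ?k v * H2 x \<partial>lborel) = (\<integral>v. ?k v * H2 v - ?k v * H2 x \<partial>lborel)"
      by (intro Bochner_Integration.integral_diff[symmetric] i1 integrable_mult_left ik)
    then have "\<bar>H s - H x - (s - x) * L - (s - x)\<^sup>2 / 2 * H2 x\<bar> = \<bar>\<integral>v. ?k v * H2 v - ?k v * H2 x \<partial>lborel\<bar>"
      by (simp only: diff)
    also have "\<dots> \<le> (\<integral>v. \<bar>?k v * H2 v - ?k v * H2 x\<bar> \<partial>lborel)" by (rule integral_abs_bound)
    also have "\<dots> \<le> (\<integral>v. ?k v * \<epsilon> \<partial>lborel)"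
    proof (rule integral_mono)
      show "integrable lborel (\<lambda>v. \<bar>?k v * H2 v - ?k v * H2 x\<bar>)"
        by (intro integrable_abs Bochner_Integration.integrable_diff i1 integrable_mult_left ik)
      show "integrable lborel (\<lambda>v. ?k v * \<epsilon>)" by (intro integrable_mult_left ik)
      fix v
      show "\<bar>?k v * H2 v - ?k v * H2 x\<bar> \<le> ?k v * \<epsilon>"
      proof (cases "v \<in> {min x s..max x s}")
        case True
        then have "\<bar>v - x\<bar> < d0" using s unfolding atLeastAtMost_iff by linarith
        then have "\<bar>H2 v - H2 x\<bar> \<le> \<epsilon>" using d0 by (simp add: less_imp_le)
        then have "?k v * \<bar>H2 v - H2 x\<bar> \<le> ?k v * \<epsilon>" by (intro mult_left_mono) auto
        moreover have "\<bar>?k v * H2 v - ?k v * H2 x\<bar> = ?k v * \<bar>H2 v - H2 x\<bar>"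
          by (simp add: right_diff_distrib[symmetric] abs_mult)
        ultimately show ?thesis by simp
      qed simp
    qed
    also have "\<dots> = (s - x)\<^sup>2 / 2 * \<epsilon>" unfolding ek[symmetric] by (rule integral_mult_left_zero)
    also have "\<dots> \<le> \<epsilon> * (s - x)\<^sup>2" using \<epsilon> by simp
    finally show "\<bar>H s - H x - (s - x) * L - (s - x)\<^sup>2 / 2 * H2 x\<bar> \<le> \<epsilon> * (s - x)\<^sup>2" .
  qed
qed

text \<open>The linear term of the expansion integrates to zero against \<open>K\<close>. The Peano remainder is \<open>o(u\<^sup>2)\<close> at zero and, \<open>H\<close> being
bounded, \<open>O(u\<^sup>2)\<close> on the whole line; hence a multiple of \<open>z\<^sup>2 K z\<close> dominates the integrands.\<close>

lemma kernel_bias_tendsto: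
  fixes K H :: "real \<Rightarrow> real" and h :: "nat \<Rightarrow> real"
  assumes K0: "integrable lborel K" "\<And>z. 0 \<le> K z"
    and K1: "integrable lborel (\<lambda>z. z * K z)" "(\<integral>z. z * K z \<partial>lborel) = 0"
    and K2: "integrable lborel (\<lambda>z. z\<^sup>2 * K z)"
    and [measurable]: "H \<in> borel_measurable borel" and bounded: "\<And>s. \<bar>H s\<bar> \<le> C"
    and Hx: "H x = 0"
    and peano: "\<And>\<epsilon>. 0 < \<epsilon> \<Longrightarrow> \<exists>d>0. \<forall>s. \<bar>s - x\<bar> < d \<longrightarrow> \<bar>H s - (s - x) * L - (s - x)\<^sup>2 * A\<bar> \<le> \<epsilon> * (s - x)\<^sup>2"
    and h: "h \<longlonglongrightarrow> 0" "\<And>n. n \<ge> 1 \<Longrightarrow> 0 < h n"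
  shows "(\<lambda>n. (\<integral>z. K z * H (x - h n * z) \<partial>lborel) / (h n)\<^sup>2) \<longlonglongrightarrow> A * (\<integral>z. z\<^sup>2 * K z \<partial>lborel)"
proof -
  define \<rho> where "\<rho> u = H (x + u) - u * L - u\<^sup>2 * A" for u
  have [measurable]: "K \<in> borel_measurable borel" using borel_measurable_integrable[OF K0(1)] by simp
  have [measurable]: "\<rho> \<in> borel_measurable borel" unfolding \<rho>_def[abs_def] by measurable
  have small: "\<exists>d>0. \<forall>u. \<bar>u\<bar> < d \<longrightarrow> \<bar>\<rho> u\<bar> \<le> \<epsilon> * u\<^sup>2" if "0 < \<epsilon>" for \<epsilon>
  proof -
    obtain d where "d > 0" and d: "\<And>s. \<bar>s - x\<bar> < d \<Longrightarrow> \<bar>H s - (s - x) * L - (s - x)\<^sup>2 * A\<bar> \<le> \<epsilon> * (s - x)\<^sup>2"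
      using peano[OF \<open>0 < \<epsilon>\<close>] by blast
    have "\<bar>\<rho> u\<bar> \<le> \<epsilon> * u\<^sup>2" if "\<bar>u\<bar> < d" for u using d[of "x + u"] that by (simp add: \<rho>_def)
    with \<open>d > 0\<close> show ?thesis by blast
  qed
  obtain B where B: "\<And>u. \<bar>\<rho> u\<bar> \<le> B * u\<^sup>2" "0 \<le> B"
  proof -
    obtain d where d: "0 < d" "\<And>u. \<bar>u\<bar> < d \<Longrightarrow> \<bar>\<rho> u\<bar> \<le> 1 * u\<^sup>2" using small[of 1] by auto
    have C: "0 \<le> C" using bounded[of 0] by linarith
    show ?thesis
    proof (rule that[of "1 + C / d\<^sup>2 + \<bar>L\<bar> / d + \<bar>A\<bar>"])
      show nn: "0 \<le> 1 + C / d\<^sup>2 + \<bar>L\<bar> / d + \<bar>A\<bar>" using C d by simp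
      fix u
      show "\<bar>\<rho> u\<bar> \<le> (1 + C / d\<^sup>2 + \<bar>L\<bar> / d + \<bar>A\<bar>) * u\<^sup>2"
      proof (cases "\<bar>u\<bar> < d")
        case True
        have "\<bar>\<rho> u\<bar> \<le> 1 * u\<^sup>2" by (rule d(2)[OF True])
        also have "\<dots> \<le> (1 + C / d\<^sup>2 + \<bar>L\<bar> / d + \<bar>A\<bar>) * u\<^sup>2"
          using C d by (intro mult_right_mono) auto
        finally show ?thesis .
      next
        case False
        then have u: "d \<le> \<bar>u\<bar>" by simp
        then have "d * d \<le> \<bar>u\<bar> * \<bar>u\<bar>" "d * \<bar>u\<bar> \<le> \<bar>u\<bar> * \<bar>u\<bar>" using d(1)
            by (auto intro!: mult_mono simp del: abs_mult_self_eq)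
        then have u2: "1 \<le> u\<^sup>2 / d\<^sup>2" "\<bar>u\<bar> \<le> u\<^sup>2 / d" using d by (auto simp: field_simps power2_eq_square)
        have "\<bar>\<rho> u\<bar> \<le> \<bar>H (x + u)\<bar> + \<bar>u * L\<bar> + \<bar>u\<^sup>2 * A\<bar>" unfolding \<rho>_def by linarith
        also have "\<dots> \<le> C * 1 + \<bar>L\<bar> * \<bar>u\<bar> + \<bar>A\<bar> * u\<^sup>2" using bounded[of "x + u"] by (simp add: abs_mult mult.commute)
        also have "\<dots> \<le> C * (u\<^sup>2 / d\<^sup>2) + \<bar>L\<bar> * (u\<^sup>2 / d) + \<bar>A\<bar> * u\<^sup>2"
          using u2 C by (intro add_mono mult_left_mono) auto
        also have "\<dots> \<le> (1 + C / d\<^sup>2 + \<bar>L\<bar> / d + \<bar>A\<bar>) * u\<^sup>2" by (simp add: algebra_simps)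
        finally show ?thesis .
      qed
    qed
  qed
  have lim: "(\<lambda>n. \<integral>z. K z * (\<rho> (- (h n * z)) / (h n)\<^sup>2) \<partial>lborel) \<longlonglongrightarrow> (\<integral>z. 0 \<partial>(lborel :: real measure))"
  proof (rule integral_dominated_convergence)
    show "integrable lborel (\<lambda>z. B * (z\<^sup>2 * K z))" using K2 by auto
    have le: "\<bar>\<rho> (- (h n * z)) / (h n)\<^sup>2\<bar> \<le> c * z\<^sup>2" if "\<bar>\<rho> (- (h n * z))\<bar> \<le> c * (- (h n * z))\<^sup>2" "0 \<le> c" for n z c
    proof (cases "h n = 0")
      case False
      then have "0 < (h n)\<^sup>2" by simp
      moreover have "\<bar>\<rho> (- (h n * z))\<bar> \<le> c * z\<^sup>2 * (h n)\<^sup>2"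
        using that by (simp add: power_mult_distrib mult_ac)
      ultimately show ?thesis by (simp add: pos_divide_le_eq)
    qed (use that in simp)
    show "AE z in lborel. norm (K z * (\<rho> (- (h n * z)) / (h n)\<^sup>2)) \<le> B * (z\<^sup>2 * K z)" for n
    proof (rule AE_I2)
      fix z
      have "K z * \<bar>\<rho> (- (h n * z)) / (h n)\<^sup>2\<bar> \<le> K z * (B * z\<^sup>2)"
        by (intro mult_left_mono le B K0)
      then show "norm (K z * (\<rho> (- (h n * z)) / (h n)\<^sup>2)) \<le> B * (z\<^sup>2 * K z)"
        using K0(2)[of z] by (simp add: abs_mult mult_ac)
    qed
    show "AE z in lborel. (\<lambda>n. K z * (\<rho> (- (h n * z)) / (h n)\<^sup>2)) \<longlonglongrightarrow> 0"
    proof (rule AE_I2)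
      fix z
      have "(\<lambda>n. \<rho> (- (h n * z)) / (h n)\<^sup>2) \<longlonglongrightarrow> 0"
      proof (rule LIMSEQ_I)
        fix e :: real assume e: "0 < e"
        define c where "c = e / (z\<^sup>2 + 1)"
        have z1: "0 < z\<^sup>2 + 1" by (simp add: add_nonneg_pos)
        then have c: "0 < c" using e by (simp add: c_def)
        obtain d where d: "d > 0" "\<And>u. \<bar>u\<bar> < d \<Longrightarrow> \<bar>\<rho> u\<bar> \<le> c * u\<^sup>2" using small[OF c] by blast
        have "(\<lambda>n. - (h n * z)) \<longlonglongrightarrow> - (0 * z)" by (intro tendsto_intros h)
        then have "\<exists>N. \<forall>n\<ge>N. norm (- (h n * z) - - (0 * z)) < d" using d(1) by (rule LIMSEQ_D)
        then obtain N where N: "\<And>n. n \<ge> N \<Longrightarrow> \<bar>- (h n * z)\<bar> < d" by auto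
        have "c * z\<^sup>2 < e" using z1 e by (simp add: c_def field_simps)
        show "\<exists>N. \<forall>n\<ge>N. norm (\<rho> (- (h n * z)) / (h n)\<^sup>2 - 0) < e"
        proof (intro exI[of _ N] allI impI)
          fix n assume "N \<le> n"
          from le[OF d(2)[OF N[OF this]] less_imp_le[OF c]]
          have "\<bar>\<rho> (- (h n * z)) / (h n)\<^sup>2\<bar> \<le> c * z\<^sup>2" .
          with \<open>c * z\<^sup>2 < e\<close> show "norm (\<rho> (- (h n * z)) / (h n)\<^sup>2 - 0) < e"
            unfolding real_norm_def diff_0_right by linarith
        qed
      qed
      then show "(\<lambda>n. K z * (\<rho> (- (h n * z)) / (h n)\<^sup>2)) \<longlonglongrightarrow> 0" by (rule tendsto_mult_right_zero)
    qed
  qed measurable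
  have split: "\<forall>\<^sub>F n in sequentially. (\<integral>z. K z * (\<rho> (- (h n * z)) / (h n)\<^sup>2) \<partial>lborel) + A * (\<integral>z. z\<^sup>2 * K z \<partial>lborel) =
      (\<integral>z. K z * H (x - h n * z) \<partial>lborel) / (h n)\<^sup>2"
    using eventually_ge_at_top[of 1]
  proof eventually_elim
    case (elim n)
    then have hn: "0 < h n" using h by simp
    have iH: "integrable lborel (\<lambda>z. K z * H (x - h n * z))"
    proof (rule Bochner_Integration.integrable_bound)
      show "integrable lborel (\<lambda>z. C * K z)" using K0 by auto
      show "AE z in lborel. norm (K z * H (x - h n * z)) \<le> norm (C * K z)"
      proof (rule AE_I2)
        fix z
        have "K z * \<bar>H (x - h n * z)\<bar> \<le> K z * C" using K0 bounded by (intro mult_left_mono) auto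
        moreover have "0 \<le> C" using bounded[of 0] by linarith
        ultimately show "norm (K z * H (x - h n * z)) \<le> norm (C * K z)"
          using K0(2)[of z] by (simp add: abs_mult mult.commute)
      qed
    qed measurable
    have "(\<integral>z. K z * (\<rho> (- (h n * z)) / (h n)\<^sup>2) \<partial>lborel) =
        (\<integral>z. K z * H (x - h n * z) / (h n)\<^sup>2 + (L / h n) * (z * K z) - A * (z\<^sup>2 * K z) \<partial>lborel)"
    proof (intro Bochner_Integration.integral_cong refl)
      fix z
      have "\<rho> (- (h n * z)) = H (x - h n * z) + h n * (z * L) - (h n)\<^sup>2 * (z\<^sup>2 * A)"
        by (simp add: \<rho>_def power_mult_distrib)
      then have "\<rho> (- (h n * z)) / (h n)\<^sup>2 = H (x - h n * z) / (h n)\<^sup>2 + L / h n * z - A * z\<^sup>2"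
        using hn by (simp add: add_divide_distrib diff_divide_distrib) (simp add: power2_eq_square)
      then show "K z * (\<rho> (- (h n * z)) / (h n)\<^sup>2) =
          K z * H (x - h n * z) / (h n)\<^sup>2 + (L / h n) * (z * K z) - A * (z\<^sup>2 * K z)"
        by (simp only:) (simp add: algebra_simps)
    qed
    also have "\<dots> = (\<integral>z. K z * H (x - h n * z) \<partial>lborel) / (h n)\<^sup>2 + (L / h n) * (\<integral>z. z * K z \<partial>lborel) - A * (\<integral>z. z\<^sup>2 * K z \<partial>lborel)"
      using iH K1 K2 by simp
    finally show ?case using K1 by simp
  qed
  have "(\<lambda>n. (\<integral>z. K z * (\<rho> (- (h n * z)) / (h n)\<^sup>2) \<partial>lborel) + A * (\<integral>z. z\<^sup>2 * K z \<partial>lborel))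
      \<longlonglongrightarrow> 0 + A * (\<integral>z. z\<^sup>2 * K z \<partial>lborel)"
    using lim by (intro tendsto_intros) simp
  from Lim_transform_eventually[OF this split] show ?thesis by simp
qed

section \<open>Moments of the kernel terms\<close>

text \<open>Integrate out \<open>Y\<close> first, then substitute \<open>s = x - h z\<close> for the value of \<open>X\<close>.\<close>

lemma (in prob_space) kernel_moment:
  fixes X Y :: "'a \<Rightarrow> real"
  assumes dist: "distributed M (lborel \<Otimes>\<^sub>M lborel) (\<lambda>\<omega>. (X \<omega>, Y \<omega>)) (\<lambda>(s, t). ennreal (g s t))"
    and g: "\<And>s t. 0 \<le> g s t" and h: "0 < h"
    and k: "integrable lborel k" and m [measurable]: "m \<in> borel_measurable borel"
    and int: "\<And>s. integrable lborel (\<lambda>t. m t * g s t)"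
    and bound: "\<And>s. (\<integral>t. \<bar>m t\<bar> * g s t \<partial>lborel) \<le> C"
  shows "integrable M (\<lambda>\<omega>. k ((x - X \<omega>) / h) * m (Y \<omega>))"
    and "expectation (\<lambda>\<omega>. k ((x - X \<omega>) / h) * m (Y \<omega>)) =
      h * (\<integral>z. k z * (\<integral>t. m t * g (x - h * z) t \<partial>lborel) \<partial>lborel)"
proof -
  have [measurable]: "k \<in> borel_measurable borel" using borel_measurable_integrable[OF k] by simp
  have dist': "distributed M (lborel \<Otimes>\<^sub>M lborel) (\<lambda>\<omega>. (X \<omega>, Y \<omega>)) (\<lambda>p. ennreal (g (fst p) (snd p)))"
    using dist by (simp add: case_prod_beta')
  have g_meas [measurable]: "(\<lambda>p. g (fst p) (snd p)) \<in> borel_measurable (lborel \<Otimes>\<^sub>M lborel)"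
    by (rule distributed_real_measurable[OF _ dist']) (simp add: g)
  have g_meas2 [measurable]: "(\<lambda>(s, t). g s t) \<in> borel_measurable (lborel \<Otimes>\<^sub>M lborel)"
    using g_meas by (simp add: case_prod_beta')
  let ?\<phi> = "\<lambda>p. k ((x - fst p) / h) * m (snd p)"
  let ?F = "\<lambda>p. g (fst p) (snd p) * ?\<phi> p"
  have ik: "integrable lborel (\<lambda>s. k ((x - s) / h))"
    using lborel_integrable_real_affine[OF k, of "- 1 / h" "x / h"] h by (simp add: diff_divide_distrib)
  have F_int: "integrable (lborel \<Otimes>\<^sub>M lborel) ?F"
  proof (rule lborel_pair.Fubini_integrable)
    show "?F \<in> borel_measurable (lborel \<Otimes>\<^sub>M lborel)" by measurable
    have norm: "(\<integral>t. norm (?F (s, t)) \<partial>lborel) = \<bar>k ((x - s) / h)\<bar> * (\<integral>t. \<bar>m t\<bar> * g s t \<partial>lborel)" for s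
    proof -
      have "norm (?F (s, t)) = \<bar>k ((x - s) / h)\<bar> * (\<bar>m t\<bar> * g s t)" for t
        using g[of s t] by (simp add: abs_mult)
      then show ?thesis by simp
    qed
    show "integrable lborel (\<lambda>s. \<integral>t. norm (?F (s, t)) \<partial>lborel)"
    proof (rule Bochner_Integration.integrable_bound[OF integrable_mult_right[OF integrable_abs[OF ik], of C]])
      show "(\<lambda>s. \<integral>t. norm (?F (s, t)) \<partial>lborel) \<in> borel_measurable lborel" by measurable
      show "AE s in lborel. norm (\<integral>t. norm (?F (s, t)) \<partial>lborel) \<le> norm (C * \<bar>k ((x - s) / h)\<bar>)"
      proof (rule AE_I2)
        fix s
        have nn: "0 \<le> (\<integral>t. \<bar>m t\<bar> * g s t \<partial>lborel)" using g by (intro Bochner_Integration.integral_nonneg) simp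
        have "\<bar>k ((x - s) / h)\<bar> * (\<integral>t. \<bar>m t\<bar> * g s t \<partial>lborel) \<le> \<bar>k ((x - s) / h)\<bar> * C"
          by (intro mult_left_mono bound) simp
        moreover have "0 \<le> C" using nn bound[of s] by linarith
        ultimately show "norm (\<integral>t. norm (?F (s, t)) \<partial>lborel) \<le> norm (C * \<bar>k ((x - s) / h)\<bar>)"
          unfolding norm using nn by (simp add: abs_mult mult.commute)
      qed
    qed
    show "AE s in lborel. integrable lborel (\<lambda>t. ?F (s, t))"
    proof (rule AE_I2)
      fix s
      have "integrable lborel (\<lambda>t. k ((x - s) / h) * (m t * g s t))" by (intro integrable_mult_right int)
      then show "integrable lborel (\<lambda>t. ?F (s, t))" by (simp add: mult_ac)
    qed
  qed
  show "integrable M (\<lambda>\<omega>. k ((x - X \<omega>) / h) * m (Y \<omega>))"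
    using distributed_integrable[OF dist', of ?\<phi>] F_int g by simp
  have "expectation (\<lambda>\<omega>. k ((x - X \<omega>) / h) * m (Y \<omega>)) = (\<integral>p. ?F p \<partial>(lborel \<Otimes>\<^sub>M lborel))"
    using distributed_integral[OF dist', of ?\<phi>] g by simp
  also have "\<dots> = (\<integral>s. (\<integral>t. ?F (s, t) \<partial>lborel) \<partial>lborel)"
    by (rule lborel_pair.integral_fst'[OF F_int, symmetric])
  also have "\<dots> = (\<integral>s. k ((x - s) / h) * (\<integral>t. m t * g s t \<partial>lborel) \<partial>lborel)"
  proof (rule Bochner_Integration.integral_cong[OF refl])
    fix s
    have "(\<integral>t. ?F (s, t) \<partial>lborel) = (\<integral>t. k ((x - s) / h) * (m t * g s t) \<partial>lborel)" by (simp add: mult_ac)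
    then show "(\<integral>t. ?F (s, t) \<partial>lborel) = k ((x - s) / h) * (\<integral>t. m t * g s t \<partial>lborel)" by simp
  qed
  also have "\<dots> = h * (\<integral>z. k z * (\<integral>t. m t * g (x - h * z) t \<partial>lborel) \<partial>lborel)"
    using lborel_integral_real_affine[of "- h" "\<lambda>s. k ((x - s) / h) * (\<integral>t. m t * g s t \<partial>lborel)" x] h by simp
  finally show "expectation (\<lambda>\<omega>. k ((x - X \<omega>) / h) * m (Y \<omega>)) =
      h * (\<integral>z. k z * (\<integral>t. m t * g (x - h * z) t \<partial>lborel) \<partial>lborel)" .
qed

text \<open>The model and the regularity assumptions at the point \<open>x\<close>, without the stepsize.\<close>

locale revesz_model = prob_space M for M :: "'a measure" +
  fixes X Y :: "nat \<Rightarrow> 'a \<Rightarrow> real" and g :: "real \<Rightarrow> real \<Rightarrow> real" and K :: "real \<Rightarrow> real"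
    and h :: "nat \<Rightarrow> real" and x :: real
  assumes g_nonneg: "\<And>s t. 0 \<le> g s t"
    and joint_density: "\<And>n. n \<ge> 1 \<Longrightarrow>
          distributed M (lborel \<Otimes>\<^sub>M lborel) (\<lambda>\<omega>. (X n \<omega>, Y n \<omega>)) (\<lambda>(s, t). ennreal (g s t))"
    and indep: "indep_vars (\<lambda>_. borel) (\<lambda>n \<omega>. (X n \<omega>, Y n \<omega>)) {1..}"
    and fx: "x_density g x \<noteq> 0"
    and K_nonneg: "\<And>z. 0 \<le> K z"
    and K_cont: "continuous_on UNIV K"
    and K_bounded: "bounded (range K)"
    and K_int: "integrable lborel K" "(\<integral>z. K z \<partial>lborel) = 1"
    and K_int1: "integrable lborel (\<lambda>z. z * K z)" "(\<integral>z. z * K z \<partial>lborel) = 0"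
    and K_int2: "integrable lborel (\<lambda>z. z\<^sup>2 * K z)"
    and h_pos: "\<And>n. n \<ge> 1 \<Longrightarrow> 0 < h n" and h_0: "h \<longlonglongrightarrow> 0"
    and g_C2: "\<And>t. twice_cont_diff (\<lambda>s. g s t)"
    and g_moments: "\<And>q::nat. q \<in> {0, 1, 2} \<Longrightarrow> bounded_param_integral (\<lambda>s t. t ^ q * g s t)"
          "\<And>q::nat. q \<in> {0, 1, 2} \<Longrightarrow> isCont (\<lambda>s. \<integral>t. t ^ q * g s t \<partial>lborel) x"
    and g_abs_moment3: "bounded_param_integral (\<lambda>s t. \<bar>t\<bar> powr 3 * g s t)"
    and ds_moments: "\<And>q::nat. q \<in> {0, 1} \<Longrightarrow> integrable lborel (\<lambda>t. \<bar>t\<bar> ^ q * \<bar>ds g x t\<bar>)"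
    and dss_moments: "\<And>q::nat. q \<in> {0, 1} \<Longrightarrow> bounded_param_integral (\<lambda>s t. t ^ q * dss g s t)"
          "\<And>q::nat. q \<in> {0, 1} \<Longrightarrow> isCont (\<lambda>s. \<integral>t. t ^ q * dss g s t \<partial>lborel) x"
    and dss_local: "dss_locally_integrable g x"
begin

abbreviation "f \<equiv> x_density g x"
abbreviation "r \<equiv> regression g x"

lemma K_measurable [measurable]: "K \<in> borel_measurable borel"
  using K_cont by (rule borel_measurable_continuous_onI)

lemma g_measurable [measurable]: "(\<lambda>(s, t). g s t) \<in> borel_measurable (lborel \<Otimes>\<^sub>M lborel)"
proof -
  have "distributed M (lborel \<Otimes>\<^sub>M lborel) (\<lambda>\<omega>. (X 1 \<omega>, Y 1 \<omega>)) (\<lambda>p. ennreal (g (fst p) (snd p)))"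
    using joint_density[of 1] by (simp add: case_prod_beta')
  from distributed_real_measurable[OF _ this] show ?thesis by (simp add: g_nonneg case_prod_beta')
qed

lemma K_power_integrable: "integrable lborel (\<lambda>z. K z ^ Suc j)"
proof -
  obtain B where B: "\<And>z. \<bar>K z\<bar> \<le> B" using K_bounded by (auto simp: bounded_iff)
  show ?thesis
  proof (rule Bochner_Integration.integrable_bound[OF integrable_mult_right[OF K_int(1), of "B ^ j"]])
    show "AE z in lborel. norm (K z ^ Suc j) \<le> norm (B ^ j * K z)"
    proof (rule AE_I2)
      fix z
      have "K z ^ j \<le> B ^ j" using K_nonneg B[of z] by (intro power_mono) auto
      then have "K z ^ j * K z \<le> B ^ j * K z" using K_nonneg by (intro mult_right_mono)
      moreover have "0 \<le> K z ^ j * K z" using K_nonneg by simp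
      ultimately show "norm (K z ^ Suc j) \<le> norm (B ^ j * K z)" by (simp add: mult.commute)
    qed
  qed measurable
qed

lemma bounded_param_integralE:
  assumes "bounded_param_integral F"
  obtains C where "\<And>s. integrable lborel (F s)" "\<And>s. \<bar>\<integral>t. F s t \<partial>lborel\<bar> \<le> C"
  using assms unfolding bounded_param_integral_def bounded_iff by (auto simp: image_iff)

text \<open>The functions \<open>m\<close> of \<open>Y\<close> whose kernel-weighted moments are controlled uniformly in the bandwidth: \<open>\<integral> \<bar>m t\<bar> g s t dt\<close> is bounded
by \<open>C\<close>, uniformly in \<open>s\<close>.\<close>

definition admissible :: "(real \<Rightarrow> real) \<Rightarrow> real \<Rightarrow> bool" where
  "admissible m C \<longleftrightarrow> m \<in> borel_measurable borel \<and>
     (\<forall>s. integrable lborel (\<lambda>t. m t * g s t) \<and> (\<integral>t. \<bar>m t\<bar> * g s t \<partial>lborel) \<le> C)"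

lemma g_slice_measurable [measurable]: "(\<lambda>t. g s t) \<in> borel_measurable borel"
proof -
  have "(\<lambda>t. (\<lambda>(s, t). g s t) (s, t)) \<in> borel_measurable lborel" by (rule measurable_compose[OF _ g_measurable]) simp
  then show ?thesis by simp
qed

text \<open>The powers 1, \<open>t\<^sup>2\<close> and \<open>\<bar>t\<bar>^3\<close> have bounded moments; an absolute first moment is interpolated by \<open>\<bar>t\<bar> \<le> 1 + t\<^sup>2\<close> where it occurs.\<close>

lemma admissible_cubic:
  assumes [measurable]: "m \<in> borel_measurable borel"
    and bound: "\<And>t. \<bar>m t\<bar> \<le> c0 + c2 * t\<^sup>2 + c3 * \<bar>t\<bar> ^ 3"
  obtains C where "admissible m C"
proof -
  obtain C0 where C0: "\<And>s. integrable lborel (\<lambda>t. t ^ 0 * g s t)" "\<And>s. \<bar>\<integral>t. t ^ 0 * g s t \<partial>lborel\<bar> \<le> C0"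
    using bounded_param_integralE[OF g_moments(1)[of 0]] by auto
  obtain C2 where C2: "\<And>s. integrable lborel (\<lambda>t. t ^ 2 * g s t)" "\<And>s. \<bar>\<integral>t. t ^ 2 * g s t \<partial>lborel\<bar> \<le> C2"
    using bounded_param_integralE[OF g_moments(1)[of 2]] by auto
  obtain C3 where C3: "\<And>s. integrable lborel (\<lambda>t. \<bar>t\<bar> ^ 3 * g s t)" "\<And>s. \<bar>\<integral>t. \<bar>t\<bar> ^ 3 * g s t \<partial>lborel\<bar> \<le> C3"
    using bounded_param_integralE[OF g_abs_moment3] by (auto simp: powr_numeral)
  let ?D = "\<lambda>s t. c0 * (t ^ 0 * g s t) + c2 * (t ^ 2 * g s t) + c3 * (\<bar>t\<bar> ^ 3 * g s t)"
  have D: "integrable lborel (?D s)" for s using C0 C2 C3 by auto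
  have le: "\<bar>m t\<bar> * g s t \<le> ?D s t" for s t
    using mult_right_mono[OF bound[of t] g_nonneg[of s t]] by (simp add: algebra_simps)
  have i: "integrable lborel (\<lambda>t. m t * g s t)" for s
  proof (rule Bochner_Integration.integrable_bound[OF D[of s]])
    show "AE t in lborel. norm (m t * g s t) \<le> norm (?D s t)"
    proof (rule AE_I2)
      fix t
      have "0 \<le> \<bar>m t\<bar> * g s t" using g_nonneg by simp
      with le[of t s] show "norm (m t * g s t) \<le> norm (?D s t)"
        using g_nonneg[of s t] unfolding real_norm_def abs_mult[of "m t"] by linarith
    qed
  qed measurable
  have "(\<integral>t. \<bar>m t\<bar> * g s t \<partial>lborel) \<le> \<bar>c0\<bar> * C0 + \<bar>c2\<bar> * C2 + \<bar>c3\<bar> * C3" for s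
  proof -
    have "integrable lborel (\<lambda>t. \<bar>m t * g s t\<bar>)" using i by auto
    then have "integrable lborel (\<lambda>t. \<bar>m t\<bar> * g s t)" using g_nonneg by (simp add: abs_mult)
    then have "(\<integral>t. \<bar>m t\<bar> * g s t \<partial>lborel) \<le> (\<integral>t. ?D s t \<partial>lborel)" by (intro integral_mono D le)
    also have "\<dots> = c0 * (\<integral>t. t ^ 0 * g s t \<partial>lborel) + c2 * (\<integral>t. t ^ 2 * g s t \<partial>lborel) + c3 * (\<integral>t. \<bar>t\<bar> ^ 3 * g s t \<partial>lborel)"
      using C0 C2 C3 by simp
    also have "\<dots> \<le> \<bar>c0\<bar> * C0 + \<bar>c2\<bar> * C2 + \<bar>c3\<bar> * C3"
    proof -
      have ab: "c * y \<le> \<bar>c\<bar> * C" if "\<bar>y\<bar> \<le> C" for c y C :: real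
      proof -
        have "c * y \<le> \<bar>c\<bar> * \<bar>y\<bar>" by (simp add: abs_mult[symmetric])
        also have "\<dots> \<le> \<bar>c\<bar> * C" using that by (intro mult_left_mono) auto
        finally show ?thesis .
      qed
      show ?thesis by (intro add_mono ab C0 C2 C3)
    qed
    finally show ?thesis .
  qed
  with i show ?thesis by (intro that) (auto simp: admissible_def)
qed

lemma admissible_one: obtains C where "admissible (\<lambda>t. 1) C"
  by (rule admissible_cubic[of "\<lambda>t. 1" 1 0 0]) auto

lemma admissible_dev: obtains C where "admissible (\<lambda>t. t - r) C"
proof (rule admissible_cubic[of "\<lambda>t. t - r" "1 + \<bar>r\<bar>" 1 0])
  fix t :: real
  have "\<bar>t\<bar> \<le> 1 + t\<^sup>2"
  proof (cases "\<bar>t\<bar> \<le> 1")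
    case False
    then have "\<bar>t\<bar> * 1 \<le> \<bar>t\<bar> * \<bar>t\<bar>" by (intro mult_left_mono) auto
    then show ?thesis by (simp add: power2_eq_square)
  qed (simp add: add_increasing2)
  then show "\<bar>t - r\<bar> \<le> 1 + \<bar>r\<bar> + 1 * t\<^sup>2 + 0 * \<bar>t\<bar> ^ 3" by linarith
qed auto

lemma admissible_dev2: obtains C where "admissible (\<lambda>t. (t - r)\<^sup>2) C"
proof (rule admissible_cubic[of "\<lambda>t. (t - r)\<^sup>2" "2 * r\<^sup>2" 2 0])
  fix t :: real
  have "(t - r)\<^sup>2 + (t + r)\<^sup>2 = 2 * r\<^sup>2 + 2 * t\<^sup>2" by (simp add: power2_eq_square algebra_simps)
  moreover have "0 \<le> (t + r)\<^sup>2" by simp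
  ultimately show "\<bar>(t - r)\<^sup>2\<bar> \<le> 2 * r\<^sup>2 + 2 * t\<^sup>2 + 0 * \<bar>t\<bar> ^ 3" unfolding abs_power2 by linarith
qed auto

lemma admissible_dev3: obtains C where "admissible (\<lambda>t. \<bar>t - r\<bar> ^ 3) C"
proof (rule admissible_cubic[of "\<lambda>t. \<bar>t - r\<bar> ^ 3" "4 * \<bar>r\<bar> ^ 3" 0 4])
  fix t :: real
  show "\<bar>\<bar>t - r\<bar> ^ 3\<bar> \<le> 4 * \<bar>r\<bar> ^ 3 + 0 * t\<^sup>2 + 4 * \<bar>t\<bar> ^ 3"
    using abs_diff_cube_le[of t r] by simp
qed auto

definition moment :: "(real \<Rightarrow> real) \<Rightarrow> real \<Rightarrow> real" where
  "moment m s = (\<integral>t. m t * g s t \<partial>lborel)"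

lemma moment_measurable:
  assumes "m \<in> borel_measurable borel"
  shows "moment m \<in> borel_measurable borel"
proof -
  have [measurable]: "m \<in> borel_measurable borel" by fact
  have "(\<lambda>s. \<integral>t. m t * g s t \<partial>lborel) \<in> borel_measurable lborel" by measurable
  then show ?thesis by (simp add: moment_def[abs_def])
qed

lemma moment_bound:
  assumes "admissible m C"
  shows "\<bar>moment m s\<bar> \<le> C"
proof -
  have "\<bar>moment m s\<bar> \<le> (\<integral>t. \<bar>m t * g s t\<bar> \<partial>lborel)" unfolding moment_def by (rule integral_abs_bound)
  also have "\<dots> = (\<integral>t. \<bar>m t\<bar> * g s t \<partial>lborel)" using g_nonneg by (simp add: abs_mult)
  also have "\<dots> \<le> C" using assms by (simp add: admissible_def)
  finally show ?thesis .
qed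

lemma kernel_expectation:
  assumes "admissible m C" "integrable lborel k" "n \<ge> 1"
  shows "integrable M (\<lambda>\<omega>. k ((x - X n \<omega>) / h n) * m (Y n \<omega>))"
    and "expectation (\<lambda>\<omega>. k ((x - X n \<omega>) / h n) * m (Y n \<omega>)) = h n * (\<integral>z. k z * moment m (x - h n * z) \<partial>lborel)"
  unfolding moment_def
  using assms kernel_moment[OF joint_density[OF assms(3)] g_nonneg h_pos[OF assms(3)] assms(2), of m C x]
  by (simp_all add: admissible_def)

lemma kernel_expectation_tendsto:
  assumes "admissible m C" "integrable lborel k" "isCont (moment m) x"
  shows "(\<lambda>n. \<integral>z. k z * moment m (x - h n * z) \<partial>lborel) \<longlonglongrightarrow> moment m x * (\<integral>z. k z \<partial>lborel)"
  using assms moment_bound[OF assms(1)]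
  by (intro kernel_integral_tendsto h_0 moment_measurable) (auto simp: admissible_def)

lemma kernel_expectation_bounded:
  assumes m: "admissible m C" and k: "integrable lborel k"
  shows "\<bar>\<integral>z. k z * moment m (x - h n * z) \<partial>lborel\<bar> \<le> C * (\<integral>z. \<bar>k z\<bar> \<partial>lborel)"
proof -
  have [measurable]: "k \<in> borel_measurable borel" using borel_measurable_integrable[OF k] by simp
  have [measurable]: "moment m \<in> borel_measurable borel" using m by (intro moment_measurable) (simp add: admissible_def)
  have le: "\<bar>k z * moment m (x - h n * z)\<bar> \<le> C * \<bar>k z\<bar>" for z
    using mult_left_mono[OF moment_bound[OF m, of "x - h n * z"], of "\<bar>k z\<bar>"] by (simp add: abs_mult mult.commute)
  have ik: "integrable lborel (\<lambda>z. C * \<bar>k z\<bar>)" using k by auto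
  have "integrable lborel (\<lambda>z. k z * moment m (x - h n * z))"
  proof (rule Bochner_Integration.integrable_bound[OF ik])
    show "AE z in lborel. norm (k z * moment m (x - h n * z)) \<le> norm (C * \<bar>k z\<bar>)"
      unfolding real_norm_def by (rule AE_I2) (rule order_trans[OF le abs_ge_self])
  qed measurable
  then have "(\<integral>z. \<bar>k z * moment m (x - h n * z)\<bar> \<partial>lborel) \<le> (\<integral>z. C * \<bar>k z\<bar> \<partial>lborel)"
    by (intro integral_mono integrable_abs ik le)
  also have "\<dots> = C * (\<integral>z. \<bar>k z\<bar> \<partial>lborel)" by simp
  finally show ?thesis by (rule order_trans[OF integral_abs_bound])
qed


lemma f_pos: "0 < f"
proof -
  have "0 \<le> f" unfolding x_density_def using g_nonneg by (intro Bochner_Integration.integral_nonneg) simp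
  with fx show ?thesis by simp
qed

lemma power_moment_integrable: "q \<in> {0, 1, 2} \<Longrightarrow> integrable lborel (\<lambda>t. t ^ q * g s t)"
  using g_moments(1)[of q] by (auto simp: bounded_param_integral_def)

lemma moments_integrable:
  "integrable lborel (g s)" "integrable lborel (\<lambda>t. t * g s t)" "integrable lborel (\<lambda>t. t\<^sup>2 * g s t)"
  using power_moment_integrable[of 0 s] power_moment_integrable[of 1 s] power_moment_integrable[of 2 s] by simp_all

lemma moment_one: "moment (\<lambda>t. 1) = x_density g"
  by (simp add: moment_def x_density_def fun_eq_iff)

lemma moment_dev: "moment (\<lambda>t. t - r) s = (\<integral>t. t * g s t \<partial>lborel) - r * x_density g s"
  unfolding moment_def x_density_def using moments_integrable[of s] by (simp add: left_diff_distrib)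

lemma moment_dev_x: "moment (\<lambda>t. t - r) x = 0"
  using fx unfolding moment_dev by (simp add: regression_def)

lemma moment_dev2: "moment (\<lambda>t. (t - r)\<^sup>2) s =
    (\<integral>t. t\<^sup>2 * g s t \<partial>lborel) - 2 * r * (\<integral>t. t * g s t \<partial>lborel) + r\<^sup>2 * x_density g s"
proof -
  have "(\<lambda>t. (t - r)\<^sup>2 * g s t) = (\<lambda>t. t\<^sup>2 * g s t - 2 * r * (t * g s t) + r\<^sup>2 * g s t)"
    by (simp add: fun_eq_iff power2_eq_square algebra_simps)
  then show ?thesis unfolding moment_def x_density_def using moments_integrable[of s] by simp
qed

lemma moment_dev2_x: "moment (\<lambda>t. (t - r)\<^sup>2) x = cond_var g x * f"
  using fx by (simp add: moment_def cond_var_def)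

lemma isCont_moments:
  "isCont (moment (\<lambda>t. 1)) x" "isCont (moment (\<lambda>t. (t - r)\<^sup>2)) x"
proof -
  have c: "isCont (x_density g) x" "isCont (\<lambda>s. \<integral>t. t * g s t \<partial>lborel) x" "isCont (\<lambda>s. \<integral>t. t\<^sup>2 * g s t \<partial>lborel) x"
    using g_moments(2)[of 0] g_moments(2)[of 1] g_moments(2)[of 2] by (simp_all add: x_density_def[abs_def])
  show "isCont (moment (\<lambda>t. 1)) x" using c(1) by (simp add: moment_one)
  have "isCont (\<lambda>s. (\<integral>t. t\<^sup>2 * g s t \<partial>lborel) - 2 * r * (\<integral>t. t * g s t \<partial>lborel) + r\<^sup>2 * x_density g s) x"
    by (intro continuous_intros c)
  then show "isCont (moment (\<lambda>t. (t - r)\<^sup>2)) x" by (simp add: moment_dev2[abs_def])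
qed

text \<open>Were it zero, \<open>g x t\<close> would vanish for almost all \<open>t \<noteq> r\<close>, hence almost everywhere, and so would \<open>f\<close>.\<close>

lemma cond_var_pos: "0 < cond_var g x * f"
proof -
  have i: "integrable lborel (\<lambda>t. (t - r)\<^sup>2 * g x t)" by (rule admissible_dev2) (auto simp: admissible_def)
  have nn: "0 \<le> (t - r)\<^sup>2 * g x t" for t using g_nonneg by simp
  have "0 \<le> moment (\<lambda>t. (t - r)\<^sup>2) x" unfolding moment_def using nn by (intro Bochner_Integration.integral_nonneg)
  moreover have "moment (\<lambda>t. (t - r)\<^sup>2) x \<noteq> 0"
  proof
    assume "moment (\<lambda>t. (t - r)\<^sup>2) x = 0"
    then have "AE t in lborel. (t - r)\<^sup>2 * g x t = 0"
      using integral_nonneg_eq_0_iff_AE[OF i] nn by (simp add: moment_def)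
    moreover have "AE t in lborel. t \<noteq> r" by (rule AE_lborel_singleton)
    ultimately have "AE t in lborel. g x t = 0" by eventually_elim simp
    then have "(\<integral>t. g x t \<partial>lborel) = (\<integral>t. 0 \<partial>(lborel :: real measure))" by (intro integral_cong_AE) auto
    then show False using fx by (simp add: x_density_def)
  qed
  ultimately have "0 < moment (\<lambda>t. (t - r)\<^sup>2) x" by linarith
  then show ?thesis unfolding moment_dev2_x .
qed

lemma K_square_pos: "0 < (\<integral>z. (K z)\<^sup>2 \<partial>lborel)"
proof -
  have i: "integrable lborel (\<lambda>z. (K z)\<^sup>2)" using K_power_integrable[of 1] by (simp add: power2_eq_square)
  have "(\<integral>z. (K z)\<^sup>2 \<partial>lborel) \<noteq> 0"
  proof
    assume "(\<integral>z. (K z)\<^sup>2 \<partial>lborel) = 0"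
    then have "AE z in lborel. (K z)\<^sup>2 = 0" using integral_nonneg_eq_0_iff_AE[OF i] by simp
    then have "AE z in lborel. K z = 0" by eventually_elim simp
    then have "(\<integral>z. K z \<partial>lborel) = (\<integral>z. 0 \<partial>(lborel :: real measure))" by (intro integral_cong_AE) auto
    then show False using K_int by simp
  qed
  moreover have "0 \<le> (\<integral>z. (K z)\<^sup>2 \<partial>lborel)" by simp
  ultimately show ?thesis by linarith
qed

text \<open>Measurability does not follow from integrability of \<open>\<bar>ds g x t\<bar>\<close>; it holds because \<open>ds\<close> is a limit of difference quotients.\<close>

lemma ds_measurable: "(\<lambda>t. ds g x t) \<in> borel_measurable borel"
proof (rule borel_measurable_LIMSEQ_real)
  fix t
  have "((\<lambda>s. g s t) has_real_derivative ds g x t) (at x)"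
    using g_C2[of t] unfolding twice_cont_diff_def ds_def by (simp add: DERIV_deriv_iff_real_differentiable)
  then have "((\<lambda>u. (g (x + u) t - g x t) / u) \<longlongrightarrow> ds g x t) (at 0)" by (simp add: DERIV_def)
  moreover have "filterlim (\<lambda>n. 1 / real (Suc n)) (at 0) sequentially"
    using LIMSEQ_Suc[OF lim_1_over_n[where 'a = real]] by (auto simp: filterlim_at)
  ultimately show "(\<lambda>n. (g (x + 1 / real (Suc n)) t - g x t) / (1 / real (Suc n))) \<longlonglongrightarrow> ds g x t"
    by (rule filterlim_compose)
qed measurable

lemma ds_dev_integrable: "integrable lborel (\<lambda>t. (t - r) * ds g x t)"
proof -
  note [measurable] = ds_measurable
  have "integrable lborel (\<lambda>t. \<bar>ds g x t\<bar>)" "integrable lborel (\<lambda>t. \<bar>t * ds g x t\<bar>)"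
    using ds_moments[of 0] ds_moments[of 1] by (simp_all add: abs_mult)
  then have "integrable lborel (\<lambda>t. ds g x t)" "integrable lborel (\<lambda>t. t * ds g x t)"
    by (simp_all add: integrable_abs_iff)
  then show ?thesis by (simp add: left_diff_distrib)
qed

definition dev_curvature :: "real \<Rightarrow> real" where
  "dev_curvature v = (\<integral>t. (t - r) * dss g v t \<partial>lborel)"

lemma dev_curvature_eq: "dev_curvature v = (\<integral>t. t * dss g v t \<partial>lborel) - r * (\<integral>t. dss g v t \<partial>lborel)"
proof -
  have "integrable lborel (\<lambda>t. t ^ 0 * dss g v t)" "integrable lborel (\<lambda>t. t ^ 1 * dss g v t)"
    using dss_moments(1)[of 0] dss_moments(1)[of 1] by (auto simp: bounded_param_integral_def)
  then show ?thesis unfolding dev_curvature_def by (simp add: left_diff_distrib)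
qed

lemma isCont_dev_curvature: "isCont dev_curvature x"
proof -
  have "isCont (\<lambda>v. (\<integral>t. t * dss g v t \<partial>lborel) - r * (\<integral>t. dss g v t \<partial>lborel)) x"
    using dss_moments(2)[of 0] dss_moments(2)[of 1] by (intro continuous_intros) simp_all
  then show ?thesis by (simp add: dev_curvature_eq[abs_def])
qed

text \<open>The function \<open>s \<mapsto> \<integral> (t - r) g s t dt\<close> vanishes at \<open>x\<close> by the definition of \<open>r\<close>; half of its second derivative at \<open>x\<close>, times
\<open>\<integral> z\<^sup>2 K z dz\<close>, is \<open>f * m2 K g x\<close>.\<close>

lemma kernel_average_bias:
  "(\<lambda>n. (\<integral>z. K z * moment (\<lambda>t. t - r) (x - h n * z) \<partial>lborel) / (h n)\<^sup>2) \<longlonglongrightarrow> f * m2 K g x"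
proof -
  let ?H = "moment (\<lambda>t. t - r)"
  obtain \<delta> where \<delta>: "\<delta> > 0" and loc: "\<And>q. q \<in> {0, 1::nat} \<Longrightarrow>
      set_integrable (lborel \<Otimes>\<^sub>M lborel) ({x - \<delta>..x + \<delta>} \<times> UNIV) (\<lambda>(s, t). t ^ q * dss g s t)"
    using dss_local unfolding dss_locally_integrable_def by blast
  have loc_dev: "set_integrable (lborel \<Otimes>\<^sub>M lborel) ({x - \<delta>..x + \<delta>} \<times> UNIV) (\<lambda>(s, t). (t - r) * dss g s t)"
  proof -
    have "set_integrable (lborel \<Otimes>\<^sub>M lborel) ({x - \<delta>..x + \<delta>} \<times> UNIV)
        (\<lambda>p. (case p of (s, t) \<Rightarrow> t ^ 1 * dss g s t) - r * (case p of (s, t) \<Rightarrow> t ^ 0 * dss g s t))"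
      by (intro set_integral_diff set_integrable_mult_right loc) auto
    then show ?thesis by (simp add: case_prod_beta' left_diff_distrib)
  qed
  define L where "L = (\<integral>t. (t - r) * ds g x t \<partial>lborel)"
  have dev_int: "integrable lborel (\<lambda>t. (t - r) * g s t)" for s
    by (rule admissible_dev) (auto simp: admissible_def)
  note taylor = parametric_taylor[where p = g and m = "\<lambda>t. t - r", OF g_C2 dev_int ds_dev_integrable loc_dev]
  have peano: "\<exists>d>0. \<forall>s. \<bar>s - x\<bar> < d \<longrightarrow>
      \<bar>?H s - (s - x) * L - (s - x)\<^sup>2 * (dev_curvature x / 2)\<bar> \<le> \<epsilon> * (s - x)\<^sup>2" if \<epsilon>: "0 < \<epsilon>" for \<epsilon>
  proof -
    obtain d where d: "0 < d" "\<And>s. \<bar>s - x\<bar> < d \<Longrightarrow>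
        \<bar>?H s - ?H x - (s - x) * L - (s - x)\<^sup>2 / 2 * dev_curvature x\<bar> \<le> \<epsilon> * (s - x)\<^sup>2"
    proof (rule peano_remainder[where H = ?H and ?H2.0 = dev_curvature and L = L and x = x, OF \<delta> _ _ isCont_dev_curvature \<epsilon>])
      fix s assume s: "\<bar>s - x\<bar> \<le> \<delta>"
      show "integrable lborel (\<lambda>v. indicator {min x s..max x s} v * (\<bar>s - v\<bar> * dev_curvature v))"
        using taylor(1)[OF s] by (simp add: dev_curvature_def)
      show "?H s = ?H x + (s - x) * L + (\<integral>v. indicator {min x s..max x s} v * (\<bar>s - v\<bar> * dev_curvature v) \<partial>lborel)"
        using taylor(2)[OF s] by (simp add: dev_curvature_def moment_def L_def)
    next
      fix d assume "0 < d" "\<And>s. \<bar>s - x\<bar> < d \<Longrightarrow>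
        \<bar>?H s - ?H x - (s - x) * L - (s - x)\<^sup>2 / 2 * dev_curvature x\<bar> \<le> \<epsilon> * (s - x)\<^sup>2"
      then show thesis by (rule that)
    qed
    show ?thesis using d by (intro exI[of _ d]) (simp add: moment_dev_x)
  qed
  obtain C where C: "admissible (\<lambda>t. t - r) C" by (rule admissible_dev)
  have "(\<lambda>n. (\<integral>z. K z * ?H (x - h n * z) \<partial>lborel) / (h n)\<^sup>2) \<longlonglongrightarrow> dev_curvature x / 2 * (\<integral>z. z\<^sup>2 * K z \<partial>lborel)"
    by (rule kernel_bias_tendsto[OF K_int(1) K_nonneg K_int1 K_int2 moment_measurable moment_bound[OF C] moment_dev_x peano h_0 h_pos])
       auto
  moreover have "dev_curvature x / 2 * (\<integral>z. z\<^sup>2 * K z \<partial>lborel) = f * m2 K g x"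
    using fx by (simp add: m2_def dev_curvature_eq)
  ultimately show ?thesis by simp
qed

text \<open>The coefficient and the noise of the recursion for \<open>revesz \<dots> n x - r\<close>.\<close>

definition Z :: "nat \<Rightarrow> 'a \<Rightarrow> real" where
  "Z n \<omega> = Zterm K h X n x \<omega>"

definition \<eta> :: "nat \<Rightarrow> 'a \<Rightarrow> real" where
  "\<eta> n \<omega> = Wterm K h X Y n x \<omega> - r * Zterm K h X n x \<omega>"

lemma \<eta>_eq: "\<eta> n \<omega> = inverse (h n) * (K ((x - X n \<omega>) / h n) * (Y n \<omega> - r))"
  by (simp add: \<eta>_def Wterm_def Zterm_def algebra_simps)

lemma Z_eq: "Z n \<omega> = inverse (h n) * (K ((x - X n \<omega>) / h n) * 1)"
  by (simp add: Z_def Zterm_def)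

lemma Z_square_eq: "(Z n \<omega>)\<^sup>2 = (inverse (h n))\<^sup>2 * ((K ((x - X n \<omega>) / h n))\<^sup>2 * 1)"
  by (simp add: Z_eq power_mult_distrib)

lemma \<eta>_square_eq: "(\<eta> n \<omega>)\<^sup>2 = (inverse (h n))\<^sup>2 * ((K ((x - X n \<omega>) / h n))\<^sup>2 * (Y n \<omega> - r)\<^sup>2)"
  by (simp add: \<eta>_eq power_mult_distrib)

lemma \<eta>_cube_eq:
  "n \<ge> 1 \<Longrightarrow> \<bar>\<eta> n \<omega>\<bar> ^ 3 = inverse (h n) ^ 3 * (K ((x - X n \<omega>) / h n) ^ 3 * \<bar>Y n \<omega> - r\<bar> ^ 3)"
  using h_pos[of n] K_nonneg by (simp add: \<eta>_eq abs_mult power_mult_distrib)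

lemma K_powers: "integrable lborel (\<lambda>z. (K z)\<^sup>2)" "integrable lborel (\<lambda>z. K z ^ 3)"
  using K_power_integrable[of 1] K_power_integrable[of 2] by (simp_all add: eval_nat_numeral)

lemma EZ_tendsto: "(\<lambda>n. expectation (Z n)) \<longlonglongrightarrow> f"
proof -
  obtain C where C: "admissible (\<lambda>t. 1) C" by (rule admissible_one)
  have "\<forall>\<^sub>F n in sequentially. (\<integral>z. K z * moment (\<lambda>t. 1) (x - h n * z) \<partial>lborel) = expectation (Z n)"
    using eventually_ge_at_top[of 1]
  proof eventually_elim
    case (elim n)
    then show ?case using kernel_expectation(2)[OF C K_int(1) elim] h_pos[OF elim] by (simp add: Z_eq[abs_def])
  qed
  from Lim_transform_eventually[OF kernel_expectation_tendsto[OF C K_int(1) isCont_moments(1)] this]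
  show ?thesis by (simp add: moment_one K_int(2))
qed

lemma int_Z_square: "n \<ge> 1 \<Longrightarrow> integrable M (\<lambda>\<omega>. (Z n \<omega>)\<^sup>2)"
  unfolding Z_square_eq by (rule admissible_one) (intro integrable_mult_right kernel_expectation K_powers, assumption+)

lemma EZ_square_tendsto: "(\<lambda>n. h n * expectation (\<lambda>\<omega>. (Z n \<omega>)\<^sup>2)) \<longlonglongrightarrow> f * (\<integral>z. (K z)\<^sup>2 \<partial>lborel)"
proof -
  obtain C where C: "admissible (\<lambda>t. 1) C" by (rule admissible_one)
  have "\<forall>\<^sub>F n in sequentially. (\<integral>z. (K z)\<^sup>2 * moment (\<lambda>t. 1) (x - h n * z) \<partial>lborel) = h n * expectation (\<lambda>\<omega>. (Z n \<omega>)\<^sup>2)"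
    using eventually_ge_at_top[of 1]
  proof eventually_elim
    case (elim n)
    have "h n * ((inverse (h n))\<^sup>2 * (h n * I)) = I" for I
      using h_pos[OF elim] by (simp add: power2_eq_square)
    then show ?case
      unfolding Z_square_eq Bochner_Integration.integral_mult_right_zero kernel_expectation(2)[OF C K_powers(1) elim] by simp
  qed
  from Lim_transform_eventually[OF kernel_expectation_tendsto[OF C K_powers(1) isCont_moments(1)] this]
  show ?thesis by (simp add: moment_one)
qed

lemma E\<eta>_tendsto: "(\<lambda>n. expectation (\<eta> n) / (h n)\<^sup>2) \<longlonglongrightarrow> f * m2 K g x"
proof -
  obtain C where C: "admissible (\<lambda>t. t - r) C" by (rule admissible_dev)
  have "\<forall>\<^sub>F n in sequentially. (\<integral>z. K z * moment (\<lambda>t. t - r) (x - h n * z) \<partial>lborel) / (h n)\<^sup>2 = expectation (\<eta> n) / (h n)\<^sup>2"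
    using eventually_ge_at_top[of 1]
  proof eventually_elim
    case (elim n)
    then show ?case using kernel_expectation(2)[OF C K_int(1) elim] h_pos[OF elim] by (simp add: \<eta>_eq[abs_def])
  qed
  from Lim_transform_eventually[OF kernel_average_bias this] show ?thesis .
qed

lemma int_\<eta>_square: "n \<ge> 1 \<Longrightarrow> integrable M (\<lambda>\<omega>. (\<eta> n \<omega>)\<^sup>2)"
  unfolding \<eta>_square_eq by (rule admissible_dev2) (intro integrable_mult_right kernel_expectation K_powers, assumption+)

lemma E\<eta>_square_tendsto:
  "(\<lambda>n. h n * expectation (\<lambda>\<omega>. (\<eta> n \<omega>)\<^sup>2)) \<longlonglongrightarrow> cond_var g x * f * (\<integral>z. (K z)\<^sup>2 \<partial>lborel)"
proof -
  obtain C where C: "admissible (\<lambda>t. (t - r)\<^sup>2) C" by (rule admissible_dev2)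
  have "\<forall>\<^sub>F n in sequentially. (\<integral>z. (K z)\<^sup>2 * moment (\<lambda>t. (t - r)\<^sup>2) (x - h n * z) \<partial>lborel) =
      h n * expectation (\<lambda>\<omega>. (\<eta> n \<omega>)\<^sup>2)"
    using eventually_ge_at_top[of 1]
  proof eventually_elim
    case (elim n)
    then show ?case using kernel_expectation(2)[OF C K_powers(1) elim] h_pos[OF elim]
      by (simp add: \<eta>_square_eq power2_eq_square[of "inverse _"])
  qed
  from Lim_transform_eventually[OF kernel_expectation_tendsto[OF C K_powers(1) isCont_moments(2)] this]
  show ?thesis by (simp add: moment_dev2_x)
qed

lemma int_\<eta>_cube: "n \<ge> 1 \<Longrightarrow> integrable M (\<lambda>\<omega>. \<bar>\<eta> n \<omega>\<bar> ^ 3)"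
  by (simp only: \<eta>_cube_eq, rule admissible_dev3)
     (intro integrable_mult_right kernel_expectation[where m = "\<lambda>t. \<bar>t - r\<bar> ^ 3"] K_powers, assumption+)

lemma E\<eta>_cube_bounded:
  obtains B where "\<And>n. n \<ge> 1 \<Longrightarrow> (h n)\<^sup>2 * expectation (\<lambda>\<omega>. \<bar>\<eta> n \<omega>\<bar> ^ 3) \<le> B"
proof -
  obtain C where C: "admissible (\<lambda>t. \<bar>t - r\<bar> ^ 3) C" by (rule admissible_dev3)
  have "(h n)\<^sup>2 * expectation (\<lambda>\<omega>. \<bar>\<eta> n \<omega>\<bar> ^ 3) \<le> C * (\<integral>z. \<bar>K z ^ 3\<bar> \<partial>lborel)" if n: "n \<ge> 1" for n
  proof -
    have "(h n)\<^sup>2 * expectation (\<lambda>\<omega>. \<bar>\<eta> n \<omega>\<bar> ^ 3) = (\<integral>z. K z ^ 3 * moment (\<lambda>t. \<bar>t - r\<bar> ^ 3) (x - h n * z) \<partial>lborel)"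
    proof -
      have "(h n)\<^sup>2 * (inverse (h n) ^ 3 * (h n * I)) = I" for I
        using h_pos[OF n] by (simp add: inverse_eq_divide power2_eq_square power3_eq_cube)
      then show ?thesis
        unfolding \<eta>_cube_eq[OF n] Bochner_Integration.integral_mult_right_zero kernel_expectation(2)[OF C K_powers(2) n] by simp
    qed
    also have "\<dots> \<le> C * (\<integral>z. \<bar>K z ^ 3\<bar> \<partial>lborel)"
      by (rule order_trans[OF abs_ge_self kernel_expectation_bounded[OF C K_powers(2)]])
    finally show ?thesis .
  qed
  then show ?thesis by (rule that)
qed

lemma indep_Z_\<eta>: "indep_vars (\<lambda>_. borel) (\<lambda>n \<omega>. (Z n \<omega>, \<eta> n \<omega>)) {1..}"
proof -
  have "indep_vars (\<lambda>_. borel) (\<lambda>n \<omega>. (\<lambda>p. (inverse (h n) * K ((x - fst p) / h n),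
      inverse (h n) * (K ((x - fst p) / h n) * (snd p - r)))) (X n \<omega>, Y n \<omega>)) {1..}"
  proof (rule indep_vars_compose2[OF indep])
    fix n
    show "(\<lambda>p. (inverse (h n) * K ((x - fst p) / h n), inverse (h n) * (K ((x - fst p) / h n) * (snd p - r))))
        \<in> borel_measurable (borel :: (real \<times> real) measure)"
      unfolding borel_prod[symmetric] by measurable
  qed
  then show ?thesis by (simp add: Z_eq \<eta>_eq)
qed

text \<open>The three moments of \<open>\<eta> n\<close> are of order \<open>(h n)\<^sup>2\<close>, \<open>1 / h n\<close> and \<open>1 / (h n)\<^sup>2\<close>. So \<open>\<kappa>\<close> and \<open>\<sigma>\<close> measure bias and variance in the
scale of \<open>v\<close>, and \<open>\<gamma> / h \<longlonglongrightarrow> 0\<close> takes care of the rest: \<open>\<gamma> E Z\<^sup>2\<close> is of order \<open>\<gamma> / h\<close>, and the Lyapunov term \<open>v^3 \<gamma>\<^sup>2 / h\<^sup>2\<close> is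
the product of \<open>v\<^sup>2 \<gamma> / h\<close> and \<open>sqrt (v\<^sup>2 \<gamma> / h * (\<gamma> / h))\<close>.\<close>

theorem revesz_linear_recursion:
  assumes \<gamma>: "\<And>n. n \<ge> 1 \<Longrightarrow> 0 < \<gamma> n" "\<gamma> \<longlonglongrightarrow> 0" "\<not> summable \<gamma>"
    and v: "growth_rate \<gamma> v \<zeta>" "\<zeta> < f"
    and \<gamma>_h: "(\<lambda>n. \<gamma> n / h n) \<longlonglongrightarrow> 0"
    and bias: "(\<lambda>n. v n * (h n)\<^sup>2) \<longlonglongrightarrow> \<kappa>"
    and var: "(\<lambda>n. (v n)\<^sup>2 * (\<gamma> n / h n)) \<longlonglongrightarrow> \<sigma>"
  shows "linear_recursion M Z \<eta> (\<lambda>n \<omega>. revesz K \<gamma> h r0 X Y n x \<omega> - r) \<gamma> v (r0 x - r) f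
    (\<kappa> * (f * m2 K g x)) (\<sigma> * (cond_var g x * f * (\<integral>z. (K z)\<^sup>2 \<partial>lborel))) \<zeta>"
proof
  have h_nz: "\<forall>\<^sub>F n in sequentially. h n \<noteq> 0"
    using eventually_ge_at_top[of 1] by eventually_elim (use h_pos in fastforce)
  show "indep_vars (\<lambda>_. borel) (\<lambda>n \<omega>. (Z n \<omega>, \<eta> n \<omega>)) {1..}" by (rule indep_Z_\<eta>)
  show "revesz K \<gamma> h r0 X Y (Suc n) x \<omega> - r =
      (1 - \<gamma> (Suc n) * Z (Suc n) \<omega>) * (revesz K \<gamma> h r0 X Y n x \<omega> - r) + \<gamma> (Suc n) * \<eta> (Suc n) \<omega>" for n \<omega>
    by (simp add: Z_def \<eta>_def algebra_simps)
  show "(\<lambda>n. expectation (Z n)) \<longlonglongrightarrow> f" by (rule EZ_tendsto)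
  have "(\<lambda>n. \<gamma> n / h n * (h n * expectation (\<lambda>\<omega>. (Z n \<omega>)\<^sup>2))) \<longlonglongrightarrow> 0 * (f * (\<integral>z. (K z)\<^sup>2 \<partial>lborel))"
    by (intro tendsto_mult \<gamma>_h EZ_square_tendsto)
  moreover have "\<forall>\<^sub>F n in sequentially. \<gamma> n / h n * (h n * expectation (\<lambda>\<omega>. (Z n \<omega>)\<^sup>2)) =
      \<gamma> n * expectation (\<lambda>\<omega>. (Z n \<omega>)\<^sup>2)" using h_nz by eventually_elim simp
  ultimately show "(\<lambda>n. \<gamma> n * expectation (\<lambda>\<omega>. (Z n \<omega>)\<^sup>2)) \<longlonglongrightarrow> 0" by (simp add: tendsto_cong)
  have "(\<lambda>n. v n * (h n)\<^sup>2 * (expectation (\<eta> n) / (h n)\<^sup>2)) \<longlonglongrightarrow> \<kappa> * (f * m2 K g x)"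
    by (intro tendsto_mult bias E\<eta>_tendsto)
  moreover have "\<forall>\<^sub>F n in sequentially. v n * (h n)\<^sup>2 * (expectation (\<eta> n) / (h n)\<^sup>2) = v n * expectation (\<eta> n)"
    using h_nz by eventually_elim simp
  ultimately show "(\<lambda>n. v n * expectation (\<eta> n)) \<longlonglongrightarrow> \<kappa> * (f * m2 K g x)" by (simp add: tendsto_cong)
  have "(\<lambda>n. (v n)\<^sup>2 * (\<gamma> n / h n) * (h n * expectation (\<lambda>\<omega>. (\<eta> n \<omega>)\<^sup>2))) \<longlonglongrightarrow>
      \<sigma> * (cond_var g x * f * (\<integral>z. (K z)\<^sup>2 \<partial>lborel))"
    by (intro tendsto_mult var E\<eta>_square_tendsto)
  moreover have "\<forall>\<^sub>F n in sequentially. (v n)\<^sup>2 * (\<gamma> n / h n) * (h n * expectation (\<lambda>\<omega>. (\<eta> n \<omega>)\<^sup>2)) =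
      (v n)\<^sup>2 * \<gamma> n * expectation (\<lambda>\<omega>. (\<eta> n \<omega>)\<^sup>2)" using h_nz by eventually_elim simp
  ultimately show "(\<lambda>n. (v n)\<^sup>2 * \<gamma> n * expectation (\<lambda>\<omega>. (\<eta> n \<omega>)\<^sup>2)) \<longlonglongrightarrow>
      \<sigma> * (cond_var g x * f * (\<integral>z. (K z)\<^sup>2 \<partial>lborel))" by (simp add: tendsto_cong)
  show "(\<lambda>n. v n ^ 3 * (\<gamma> n)\<^sup>2 * expectation (\<lambda>\<omega>. \<bar>\<eta> n \<omega>\<bar> ^ 3)) \<longlonglongrightarrow> 0"
  proof -
    obtain B where B: "\<And>n. n \<ge> 1 \<Longrightarrow> (h n)\<^sup>2 * expectation (\<lambda>\<omega>. \<bar>\<eta> n \<omega>\<bar> ^ 3) \<le> B" using E\<eta>_cube_bounded by blast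
    have "(\<lambda>n. sqrt ((v n)\<^sup>2 * (\<gamma> n / h n) * (\<gamma> n / h n))) \<longlonglongrightarrow> sqrt (\<sigma> * 0)"
      by (intro tendsto_intros var \<gamma>_h)
    moreover have "\<forall>\<^sub>F n in sequentially. sqrt ((v n)\<^sup>2 * (\<gamma> n / h n) * (\<gamma> n / h n)) = v n * \<gamma> n / h n"
      using eventually_ge_at_top[of 1]
    proof eventually_elim
      case (elim n)
      then have p: "0 < v n" "0 < \<gamma> n" "0 < h n" using v \<gamma> h_pos by (auto simp: growth_rate_def)
      have "(v n)\<^sup>2 * (\<gamma> n / h n) * (\<gamma> n / h n) = (v n * \<gamma> n / h n)\<^sup>2" by (simp add: power2_eq_square)
      then show ?case using p by (simp only: real_sqrt_abs) simp
    qed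
    ultimately have "(\<lambda>n. v n * \<gamma> n / h n) \<longlonglongrightarrow> sqrt (\<sigma> * 0)" by (rule Lim_transform_eventually)
    then have "(\<lambda>n. (v n)\<^sup>2 * (\<gamma> n / h n) * (v n * \<gamma> n / h n)) \<longlonglongrightarrow> \<sigma> * sqrt (\<sigma> * 0)" by (intro tendsto_mult var)
    then have "(\<lambda>n. (v n)\<^sup>2 * (\<gamma> n / h n) * (v n * \<gamma> n / h n)) \<longlonglongrightarrow> 0" by simp
    then have "(\<lambda>n. ((v n)\<^sup>2 * (\<gamma> n / h n) * (v n * \<gamma> n / h n)) * ((h n)\<^sup>2 * expectation (\<lambda>\<omega>. \<bar>\<eta> n \<omega>\<bar> ^ 3))) \<longlonglongrightarrow> 0"
    proof (rule lim_null_mult_right_bounded[where B = B])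
      show "\<forall>\<^sub>F n in sequentially. norm ((h n)\<^sup>2 * expectation (\<lambda>\<omega>. \<bar>\<eta> n \<omega>\<bar> ^ 3)) \<le> B"
        using eventually_ge_at_top[of 1] by eventually_elim (simp add: B abs_mult abs_of_nonneg)
    qed
    moreover have "\<forall>\<^sub>F n in sequentially.
        ((v n)\<^sup>2 * (\<gamma> n / h n) * (v n * \<gamma> n / h n)) * ((h n)\<^sup>2 * expectation (\<lambda>\<omega>. \<bar>\<eta> n \<omega>\<bar> ^ 3)) =
        v n ^ 3 * (\<gamma> n)\<^sup>2 * expectation (\<lambda>\<omega>. \<bar>\<eta> n \<omega>\<bar> ^ 3)"
      using h_nz by eventually_elim (simp add: power2_eq_square power3_eq_cube)
    ultimately show ?thesis by (rule Lim_transform_eventually)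
  qed
qed (use \<gamma> v int_Z_square int_\<eta>_square int_\<eta>_cube in auto)

end

section \<open>The generalized Revesz estimator\<close>

lemma not_summable_step:
  assumes pos: "\<And>n. n \<ge> 1 \<Longrightarrow> 0 < \<gamma> n" and \<xi>: "(\<lambda>n. inverse (real n * \<gamma> n)) \<longlonglongrightarrow> \<xi>"
  shows "\<not> summable \<gamma>"
proof
  assume "summable \<gamma>"
  then have s: "summable (\<lambda>n. (\<xi> + 1) * \<gamma> n)" by (rule summable_mult)
  have "\<forall>\<^sub>F n in sequentially. inverse (real n * \<gamma> n) < \<xi> + 1" using \<xi> by (rule order_tendstoD) simp
  then have "\<forall>\<^sub>F n in sequentially. norm (1 / real n) \<le> (\<xi> + 1) * \<gamma> n"
    using eventually_ge_at_top[of 1]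
  proof eventually_elim
    case (elim n)
    then have "0 < real n" "0 < \<gamma> n" using pos by auto
    with elim show ?case by (simp add: field_simps)
  qed
  then have "summable (\<lambda>n. 1 / real n)" using s by (rule summable_comparison_test_ev)
  then show False using harmonic_step(3) by blast
qed

lemma step_limit_nonneg:
  assumes pos: "\<And>n. n \<ge> 1 \<Longrightarrow> 0 < \<gamma> n" and \<xi>: "(\<lambda>n. inverse (real n * \<gamma> n)) \<longlonglongrightarrow> \<xi>"
  shows "0 \<le> \<xi>"
proof (rule tendsto_lowerbound[OF \<xi>])
  show "\<forall>\<^sub>F n in sequentially. 0 \<le> inverse (real n * \<gamma> n)"
    using eventually_ge_at_top[of 1] by eventually_elim (use pos in \<open>auto simp: less_imp_le\<close>)
qed simp

text \<open>In the time scale of \<open>\<gamma>\<close> the rate is \<open>- \<alpha> \<xi>\<close>. It equals \<open>- \<xi>\<close>, since \<open>1 / (n \<gamma> n)\<close> has rate \<open>\<alpha> - 1\<close> in the time scale \<open>1 / n\<close>, so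
that \<open>\<alpha> = 1\<close> unless its limit \<open>\<xi>\<close> is zero.\<close>

lemma growth_rate_step:
  assumes \<gamma>: "\<gamma> \<in> GS (- \<alpha>)" and \<xi>: "(\<lambda>n. inverse (real n * \<gamma> n)) \<longlonglongrightarrow> \<xi>"
  shows "growth_rate \<gamma> \<gamma> (- \<xi>)"
proof -
  note H = GS_growth_rate[OF \<gamma>]
  have "growth_rate (\<lambda>n. 1 / real n) real 1"
  proof -
    have "(\<lambda>n. 1 + 1 / real n) \<longlonglongrightarrow> 1 + 0" by (intro tendsto_intros harmonic_step)
    moreover have "\<forall>\<^sub>F n in sequentially. 1 + 1 / real n = (real (Suc n) / real n - 1) / (1 / real (Suc n))"
      using eventually_ge_at_top[of 1] by eventually_elim (simp add: field_simps)
    ultimately have "(\<lambda>n. (real (Suc n) / real n - 1) / (1 / real (Suc n))) \<longlonglongrightarrow> 1 + 0"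
      by (rule Lim_transform_eventually)
    then show ?thesis by (simp add: growth_rate_def)
  qed
  from growth_rate_inverse[OF growth_rate_mult[OF this H harmonic_step(1,2)] harmonic_step(1,2)]
  have rate: "growth_rate (\<lambda>n. 1 / real n) (\<lambda>n. inverse (real n * \<gamma> n)) (- (1 + - \<alpha>))" .
  have "\<alpha> * \<xi> = \<xi>"
  proof (cases "\<xi> = 0")
    case False
    with growth_rate_eq_0[OF rate harmonic_step \<xi>] show ?thesis by simp
  qed simp
  moreover have "(\<lambda>n. 1 / real n / \<gamma> n) \<longlonglongrightarrow> \<xi>" using \<xi> by (simp add: inverse_eq_divide)
  from growth_rate_change_step[OF H harmonic_step(1) this] have "growth_rate \<gamma> \<gamma> (- \<alpha> * \<xi>)" .
  ultimately show ?thesis by (simp only: mult_minus_left)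
qed

text \<open>If \<open>\<xi> = 0\<close> there is nothing to show; otherwise \<open>n \<gamma> n \<longlonglongrightarrow> 1 / \<xi>\<close>, and the limit in the extended reals is this one.\<close>

lemma step_limit_condition:
  assumes pos: "\<And>n. n \<ge> 1 \<Longrightarrow> 0 < \<gamma> n" and \<xi>: "(\<lambda>n. inverse (real n * \<gamma> n)) \<longlonglongrightarrow> \<xi>"
    and lim: "lim (\<lambda>n. ereal (real n * \<gamma> n)) > ereal C"
  shows "C * \<xi> < 1"
proof (cases "\<xi> = 0")
  case False
  then have p: "0 < \<xi>" using step_limit_nonneg[OF pos \<xi>] by simp
  have "(\<lambda>n. inverse (inverse (real n * \<gamma> n))) \<longlonglongrightarrow> inverse \<xi>" using \<xi> False by (rule tendsto_inverse)
  then have "(\<lambda>n. ereal (real n * \<gamma> n)) \<longlonglongrightarrow> ereal (inverse \<xi>)" by simp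
  then have "lim (\<lambda>n. ereal (real n * \<gamma> n)) = ereal (inverse \<xi>)" by (rule limI)
  with lim have "C < inverse \<xi>" by simp
  with p show ?thesis by (simp add: field_simps)
qed simp

theorem theorem1:
  fixes M :: "'a measure"
    and X Y :: "nat \<Rightarrow> 'a \<Rightarrow> real"
    and g :: "real \<Rightarrow> real \<Rightarrow> real"
    and K :: "real \<Rightarrow> real"
    and \<gamma> h :: "nat \<Rightarrow> real"
    and r0 :: "real \<Rightarrow> real"
    and x \<alpha> a \<xi> :: real
  assumes "prob_space M"
    and g_nonneg: "\<And>s t. 0 \<le> g s t"
    and joint_density: "\<And>n. n \<ge> 1 \<Longrightarrow>
          distributed M (lborel \<Otimes>\<^sub>M lborel) (\<lambda>\<omega>. (X n \<omega>, Y n \<omega>)) (\<lambda>(s, t). ennreal (g s t))"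
    and indep: "prob_space.indep_vars M (\<lambda>_. borel) (\<lambda>n \<omega>. (X n \<omega>, Y n \<omega>)) {1..}"
    and fx: "x_density g x \<noteq> 0"
    (* (i) *)
    and K_nonneg: "\<And>z. 0 \<le> K z"
    and K_cont: "continuous_on UNIV K"
    and K_bounded: "bounded (range K)"
    and K_int: "integrable lborel K" "(\<integral>z. K z \<partial>lborel) = 1"
    and K_int1: "integrable lborel (\<lambda>z. z * K z)" "(\<integral>z. z * K z \<partial>lborel) = 0"
    and K_int2: "integrable lborel (\<lambda>z. z\<^sup>2 * K z)"
    (* (ii) *)
    and \<gamma>_GS: "\<gamma> \<in> GS (- \<alpha>)" and \<gamma>_0: "\<gamma> \<longlonglongrightarrow> 0"
    and \<alpha>: "3 / 4 < \<alpha>" "\<alpha> \<le> 1"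
    and \<xi>: "(\<lambda>n. inverse (real n * \<gamma> n)) \<longlonglongrightarrow> \<xi>"
    and h_GS: "h \<in> GS (- a)" and h_0: "h \<longlonglongrightarrow> 0"
    and a: "(1 - \<alpha>) / 4 < a" "a < \<alpha> / 3"
    (* (iii) *)
    and g_C2: "\<And>t. twice_cont_diff (\<lambda>s. g s t)"
    and g_moments: "\<And>q::nat. q \<in> {0, 1, 2} \<Longrightarrow> bounded_param_integral (\<lambda>s t. t ^ q * g s t)"
          "\<And>q::nat. q \<in> {0, 1, 2} \<Longrightarrow> isCont (\<lambda>s. \<integral>t. t ^ q * g s t \<partial>lborel) x"
    and g_abs_moments: "\<And>q::real. q \<in> {2..3} \<Longrightarrow>
          bounded_param_integral (\<lambda>s t. \<bar>t\<bar> powr q * g s t)"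
    and ds_moments: "\<And>q::nat. q \<in> {0, 1} \<Longrightarrow> integrable lborel (\<lambda>t. \<bar>t\<bar> ^ q * \<bar>ds g x t\<bar>)"
    and dss_moments: "\<And>q::nat. q \<in> {0, 1} \<Longrightarrow> bounded_param_integral (\<lambda>s t. t ^ q * dss g s t)"
          "\<And>q::nat. q \<in> {0, 1} \<Longrightarrow> isCont (\<lambda>s. \<integral>t. t ^ q * dss g s t \<partial>lborel) x"
    and dss_local: "dss_locally_integrable g x"
  shows "(\<forall>c\<ge>0. (\<lambda>n. inverse (\<gamma> n) * h n ^ 5) \<longlonglongrightarrow> c \<longrightarrow>
            lim (\<lambda>n. ereal (real n * \<gamma> n)) > ereal ((1 - a) / (2 * x_density g x)) \<longrightarrow>
            conv_in_distr M
              (\<lambda>n \<omega>. sqrt (inverse (\<gamma> n) * h n) * (revesz K \<gamma> h r0 X Y n x \<omega> - regression g x))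
              (gaussian
                (sqrt c * x_density g x * m2 K g x / (x_density g x - 2 * a * \<xi>))
                (cond_var g x * x_density g x / (2 * x_density g x - (1 - a) * \<xi>) *
                  (\<integral>z. (K z)\<^sup>2 \<partial>lborel))))
       \<and> (filterlim (\<lambda>n. inverse (\<gamma> n) * h n ^ 5) at_top sequentially \<longrightarrow>
            lim (\<lambda>n. ereal (real n * \<gamma> n)) > ereal (2 * a / x_density g x) \<longrightarrow>
            conv_in_prob M
              (\<lambda>n \<omega>. 1 / (h n)\<^sup>2 * (revesz K \<gamma> h r0 X Y n x \<omega> - regression g x))
              (x_density g x * m2 K g x / (x_density g x - 2 * a * \<xi>)))"
proof -
  interpret revesz_model M X Y g K h x
  proof (intro revesz_model.intro revesz_model_axioms.intro)
    show "prob_space M" by fact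
    show "bounded_param_integral (\<lambda>s t. \<bar>t\<bar> powr 3 * g s t)" by (rule g_abs_moments) simp
    show "0 < h n" if "n \<ge> 1" for n using h_GS that by (simp add: GS_def)
  qed (fact assms)+
  have \<gamma>_pos: "0 < \<gamma> n" if "n \<ge> 1" for n using \<gamma>_GS that by (simp add: GS_def)
  note \<gamma> = \<gamma>_pos \<gamma>_0 not_summable_step[OF \<gamma>_pos \<xi>]
  note rate_\<gamma> = growth_rate_step[OF \<gamma>_GS \<xi>]
  have rate_h: "growth_rate \<gamma> h (- a * \<xi>)"
    using growth_rate_change_step[OF GS_growth_rate[OF h_GS] harmonic_step(1), of \<gamma> \<xi>] \<xi>
    by (simp add: inverse_eq_divide)
  have \<gamma>_h: "(\<lambda>n. \<gamma> n / h n) \<longlonglongrightarrow> 0"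
  proof -
    have rate: "growth_rate (\<lambda>n. 1 / real n) (\<lambda>n. \<gamma> n * inverse (h n)) (- \<alpha> + - (- a))"
      by (rule growth_rate_mult[OF GS_growth_rate[OF \<gamma>_GS]
            growth_rate_inverse[OF GS_growth_rate[OF h_GS] harmonic_step(1,2)] harmonic_step(1,2)])
    have "- \<alpha> + - (- a) < 0" using a(2) \<alpha>(1) by linarith
    from growth_rate_decay[OF rate harmonic_step this] have "(\<lambda>n. \<gamma> n * inverse (h n)) \<longlonglongrightarrow> 0" .
    then show ?thesis by (simp only: divide_inverse)
  qed
  have rate_hyp: "growth_rate \<gamma> (\<lambda>n. inverse (\<gamma> n) * h n) (- (- \<xi>) + - a * \<xi>)"
    by (rule growth_rate_mult[OF growth_rate_inverse[OF rate_\<gamma> \<gamma>(1,2)] rate_h \<gamma>(1,2)])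
  show ?thesis
  proof (intro conjI allI impI)
    fix c :: real
    assume c: "0 \<le> c" and lim_c: "(\<lambda>n. inverse (\<gamma> n) * h n ^ 5) \<longlonglongrightarrow> c"
      and cond: "lim (\<lambda>n. ereal (real n * \<gamma> n)) > ereal ((1 - a) / (2 * f))"
    define v where "v n = sqrt (inverse (\<gamma> n) * h n)" for n
    define \<zeta> where "\<zeta> = (1 - a) * \<xi> / 2"
    have rate_v: "growth_rate \<gamma> v \<zeta>"
      using growth_rate_sqrt[OF rate_hyp \<gamma>(1,2)] by (simp add: v_def[abs_def] \<zeta>_def left_diff_distrib)
    have \<zeta>: "\<zeta> < f"
      using step_limit_condition[OF \<gamma>_pos \<xi> cond] f_pos by (simp add: \<zeta>_def field_simps)
    have "(\<lambda>n. sqrt (inverse (\<gamma> n) * h n ^ 5)) \<longlonglongrightarrow> sqrt c" by (intro tendsto_intros lim_c)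
    moreover have "\<forall>\<^sub>F n in sequentially. sqrt (inverse (\<gamma> n) * h n ^ 5) = v n * (h n)\<^sup>2"
      using eventually_ge_at_top[of 1]
    proof eventually_elim
      case (elim n)
      have "inverse (\<gamma> n) * h n ^ 5 = inverse (\<gamma> n) * h n * ((h n)\<^sup>2)\<^sup>2" by (simp add: eval_nat_numeral)
      then have "sqrt (inverse (\<gamma> n) * h n ^ 5) = v n * sqrt (((h n)\<^sup>2)\<^sup>2)"
        unfolding v_def by (simp only: real_sqrt_mult)
      then show ?case by (simp only: real_sqrt_abs abs_power2)
    qed
    ultimately have bias: "(\<lambda>n. v n * (h n)\<^sup>2) \<longlonglongrightarrow> sqrt c" by (rule Lim_transform_eventually)
    have var: "(\<lambda>n. (v n)\<^sup>2 * (\<gamma> n / h n)) \<longlonglongrightarrow> 1"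
    proof (rule tendsto_eventually)
      show "\<forall>\<^sub>F n in sequentially. (v n)\<^sup>2 * (\<gamma> n / h n) = 1"
        using eventually_ge_at_top[of 1]
      proof eventually_elim
        case (elim n)
        then have "0 < \<gamma> n" "0 < h n" using \<gamma>_pos h_pos by auto
        then show ?case by (simp add: v_def field_simps)
      qed
    qed
    \<comment> \<open>The factor 1 is the limit of \<open>v\<^sup>2 \<gamma> / h\<close>.\<close>
    define \<tau> where "\<tau> = 1 * (cond_var g x * f * (\<integral>z. (K z)\<^sup>2 \<partial>lborel))"
    interpret rec: linear_recursion M Z \<eta> "\<lambda>n \<omega>. revesz K \<gamma> h r0 X Y n x \<omega> - r" \<gamma> v "r0 x - r" f
      "sqrt c * (f * m2 K g x)" \<tau> \<zeta>
      unfolding \<tau>_def by (rule revesz_linear_recursion[OF \<gamma> rate_v \<zeta> \<gamma>_h bias var])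
    have "0 < \<tau>" using cond_var_pos K_square_pos by (simp add: \<tau>_def)
    note conv = rec.asymptotic_normality[OF this]
    \<comment> \<open>The weight yields the denominator \<open>f - (1 - a) \<xi> / 2\<close>. For \<open>c = 0\<close> both sides vanish, whatever the
      denominators; for \<open>c > 0\<close> the sequence \<open>h^5 / \<gamma>\<close> has rate zero, which makes them equal.\<close>
    have mean: "sqrt c * (f * m2 K g x) / (f - \<zeta>) = sqrt c * f * m2 K g x / (f - 2 * a * \<xi>)"
    proof (cases "c = 0")
      case False
      have "growth_rate \<gamma> (\<lambda>n. inverse (\<gamma> n) * h n ^ 5) (- (- \<xi>) + real 5 * (- a * \<xi>))"
        by (rule growth_rate_mult[OF growth_rate_inverse[OF rate_\<gamma> \<gamma>(1,2)]
              growth_rate_power[OF rate_h \<gamma>(1,2), of 5] \<gamma>(1,2)])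
      from growth_rate_eq_0[OF this \<gamma> lim_c False] have "\<xi> = 5 * (a * \<xi>)" by simp
      then have "\<zeta> = 2 * a * \<xi>" by (simp add: \<zeta>_def left_diff_distrib)
      then show ?thesis by simp
    qed simp
    have variance: "\<tau> / (2 * (f - \<zeta>)) = cond_var g x * f / (2 * f - (1 - a) * \<xi>) * (\<integral>z. (K z)\<^sup>2 \<partial>lborel)"
    proof -
      have "2 * (f - \<zeta>) = 2 * f - (1 - a) * \<xi>" by (simp add: \<zeta>_def)
      then show ?thesis by (simp add: \<tau>_def)
    qed
    show "conv_in_distr M (\<lambda>n \<omega>. sqrt (inverse (\<gamma> n) * h n) * (revesz K \<gamma> h r0 X Y n x \<omega> - r))
        (gaussian (sqrt c * f * m2 K g x / (f - 2 * a * \<xi>))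
          (cond_var g x * f / (2 * f - (1 - a) * \<xi>) * (\<integral>z. (K z)\<^sup>2 \<partial>lborel)))"
      using conv unfolding mean variance conv_in_distr_def gaussian_def v_def .
  next
    assume lim_inf: "filterlim (\<lambda>n. inverse (\<gamma> n) * h n ^ 5) at_top sequentially"
      and cond: "lim (\<lambda>n. ereal (real n * \<gamma> n)) > ereal (2 * a / f)"
    define v where "v n = 1 / (h n)\<^sup>2" for n
    have rate_v: "growth_rate \<gamma> v (2 * a * \<xi>)"
      using growth_rate_inverse[OF growth_rate_power[OF rate_h \<gamma>(1,2), of 2] \<gamma>(1,2)]
      by (simp add: v_def[abs_def] inverse_eq_divide mult.assoc)
    have \<zeta>: "2 * a * \<xi> < f"
      using step_limit_condition[OF \<gamma>_pos \<xi> cond] f_pos by (simp add: field_simps)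
    have bias: "(\<lambda>n. v n * (h n)\<^sup>2) \<longlonglongrightarrow> 1"
    proof (rule tendsto_eventually)
      show "\<forall>\<^sub>F n in sequentially. v n * (h n)\<^sup>2 = 1"
        using eventually_ge_at_top[of 1] by eventually_elim (use h_pos in \<open>fastforce simp: v_def\<close>)
    qed
    have "(\<lambda>n. inverse (inverse (\<gamma> n) * h n ^ 5)) \<longlonglongrightarrow> 0"
      by (rule tendsto_inverse_0_at_top[OF lim_inf])
    moreover have "inverse (inverse (\<gamma> n) * h n ^ 5) = (v n)\<^sup>2 * (\<gamma> n / h n)" for n
      by (simp add: v_def eval_nat_numeral divide_inverse)
    ultimately have var: "(\<lambda>n. (v n)\<^sup>2 * (\<gamma> n / h n)) \<longlonglongrightarrow> 0" by simp
    \<comment> \<open>Here the limit of \<open>v\<^sup>2 \<gamma> / h\<close> is 0: the variance is negligible.\<close>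
    define \<tau> where "\<tau> = 0 * (cond_var g x * f * (\<integral>z. (K z)\<^sup>2 \<partial>lborel))"
    interpret rec: linear_recursion M Z \<eta> "\<lambda>n \<omega>. revesz K \<gamma> h r0 X Y n x \<omega> - r" \<gamma> v "r0 x - r" f
      "1 * (f * m2 K g x)" \<tau> "2 * a * \<xi>"
      unfolding \<tau>_def by (rule revesz_linear_recursion[OF \<gamma> rate_v \<zeta> \<gamma>_h bias var])
    have "\<tau> = 0" by (simp add: \<tau>_def)
    from rec.convergence_in_probability[OF this]
    show "conv_in_prob M (\<lambda>n \<omega>. 1 / (h n)\<^sup>2 * (revesz K \<gamma> h r0 X Y n x \<omega> - r)) (f * m2 K g x / (f - 2 * a * \<xi>))"
      unfolding conv_in_prob_def v_def by simp
  qed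
qed

end
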